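(* Let $t>0$, $T=[-t,t]^2$, and let $X$ be a real-valued random field on $\mathbb{R}^2$ satisfying Assumption A and Assumption B (both stated in the context). Let $(m_n)_{n\ge 1}$ be a non-decreasing sequence in $\mathbb{N}^+$ tending to $\infty$ as $n\to\infty$. Let $(\epsilon_n)_{n\ge1}$ be a sequence of positive reals such that $m_n\epsilon_n^{2/3}$ converges to a constant $C\in(0,\infty)$ and such that the vertices of $T$ are contained in $\mathcal{G}^{(T,\epsilon_n)}$ for all $n\in\mathbb{N}^+$. Then, for each fixed $u\in\mathbb{R}$, $$g_n\,\big|\hat{P}^{(2)}_X(\epsilon_n,m_n;T,u)-P_X^T(u)\big|\longrightarrow 0\quad\text{almost surely as } n\to\infty,$$ where $(g_n)_{n\ge1}$ is any non-decreasing sequence such that $g_n=o(m_n)$.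
   Context: Assumption A: $X=\{X(s):s\in\mathbb{R}^2\}$ is a real-valued random field on a probability space $(\Omega,\mathcal{F},\mathbb{P})$ with $C^2$ sample paths. Let $X_1,X_2$ be the partial derivatives of $X$ in the two Cartesian directions and $X_{11},X_{22}$ the corresponding second-order partial derivatives. Assumption B (for $T$): for any $u\in\mathbb{R}$, the following hold almost surely: (1) $X$ has no critical points in $T$ at the level $u$; (2) the restriction of $X$ to each face of the square boundary $\partial(T)$ has no local extrema at the level $u$; (3) for $k\in\{1,2\}$ there is no $s\in T$ with $X(s)-u=X_k(s)=X_{kk}(s)=0$. Excursion set and perimeter: $E_X(u)=\{s\in\mathbb{R}^2:X(s)\ge u\}$; $E_X^\partial(T,u)=T\cap\partial(E_X(u))$, where $\partial$ denotes topological boundary; $P_X^T(u)=\mathcal{H}^1(E_X^\partial(T,u))$, with $\mathcal{H}^1$ the one-dimensional Hausdorff measure. Grid: for $\epsilon>0$ put $s_{i,j}=(-t+i\epsilon,-t+j\epsilon)$ for $i,j\in\mathbb{N}_0=\{0,1,2,\dots\}$, and $\mathcal{G}^{(T,\epsilon)}=\{s_{i,j}:i,j\in\mathbb{N}_0\}\cap T$. Let $M$ be the number of rows (equivalently, columns) of $\mathcal{G}^{(T,\epsilon)}$, $I^{(T,\epsilon)}=\{0,\dots,M-1\}$, and for $m\in\mathbb{N}^+$ let $I^{(T,\epsilon,m)}=\{i\in I^{(T,\epsilon)}: i\equiv 0 \pmod m\}$. For $i,j\in I^{(T,\epsilon)}$ let $\zeta_{i,j}=1$ if $X(s_{i,j})\ge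 u$ and $\zeta_{i,j}=0$ otherwise. Estimator: for $a,b\in I^{(T,\epsilon,m)}$ let $$N_h(a,b)=\sum_{i=a}^{\min(a+m-1,M-1)}\ \sum_{j=b}^{\min(b+m-1,M-2)}|\zeta_{i,j}-\zeta_{i,j+1}|,\qquad N_v(a,b)=\sum_{i=a}^{\min(a+m-1,M-2)}\ \sum_{j=b}^{\min(b+m-1,M-1)}|\zeta_{i,j}-\zeta_{i+1,j}|,$$ and $$\hat P_X^{(2)}(\epsilon,m;T,u)=\epsilon\sum_{a\in I^{(T,\epsilon,m)}}\sum_{b\in I^{(T,\epsilon,m)}}\big\|(N_h(a,b),N_v(a,b))\big\|_2,$$ with $\|\cdot\|_2$ the Euclidean norm. (Empty sums are $0$.) *)

theory Defs
  imports "HOL-Probability.Probability" "HOL-Library.Landau_Symbols"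
begin

text \<open>The plane is \<^typ>\<open>real \<times> real\<close>, whose norm and distance are the Euclidean ones; its
  \<^const>\<open>Basis\<close> consists of the two Cartesian directions \<open>(1, 0)\<close> and \<open>(0, 1)\<close>.\<close>

definition partial :: "real \<times> real \<Rightarrow> (real \<times> real \<Rightarrow> real) \<Rightarrow> real \<times> real \<Rightarrow> real" where
  "partial e f s = deriv (\<lambda>h. f (s + h *\<^sub>R e)) 0"

definition C1 :: "(real \<times> real \<Rightarrow> real) \<Rightarrow> bool" where
  "C1 f \<longleftrightarrow> (\<forall>e\<in>Basis. (\<forall>s. (\<lambda>h. f (s + h *\<^sub>R e)) field_differentiable at 0) \<and>
      continuous_on UNIV (partial e f))"

definition C2 :: "(real \<times> real \<Rightarrow> real) \<Rightarrow> bool" where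
  "C2 f \<longleftrightarrow> C1 f \<and> (\<forall>e\<in>Basis. C1 (partial e f))"

definition local_extremum_on :: "('a::topological_space) set \<Rightarrow> ('a \<Rightarrow> real) \<Rightarrow> 'a \<Rightarrow> bool" where
  "local_extremum_on S f s \<longleftrightarrow> s \<in> S \<and>
     ((\<forall>\<^sub>F x in at s within S. f x \<le> f s) \<or> (\<forall>\<^sub>F x in at s within S. f s \<le> f x))"

definition square :: "real \<Rightarrow> (real \<times> real) set" where
  "square t = {-t..t} \<times> {-t..t}"

definition C2_random_field :: "'w measure \<Rightarrow> (real \<times> real \<Rightarrow> 'w \<Rightarrow> real) \<Rightarrow> bool" where
  "C2_random_field M X \<longleftrightarrow> prob_space M \<and> (\<forall>s. X s \<in> borel_measurable M) \<and>
     (\<forall>\<omega>\<in>space M. C2 (\<lambda>s. X s \<omega>))"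

text \<open>The sides of the square are taken relatively open: otherwise a corner, being an endpoint of
  two sides, would typically count as a local extremum of the restriction to each of them.\<close>

definition regular_at_level :: "(real \<times> real) set \<Rightarrow> (real \<times> real \<Rightarrow> real) \<Rightarrow> real \<Rightarrow> bool" where
  "regular_at_level T f u \<longleftrightarrow>
     \<not> (\<exists>s\<in>T. f s = u \<and> (\<forall>e\<in>Basis. partial e f s = 0)) \<and>
     (\<forall>F. F facet_of T \<longrightarrow> \<not> (\<exists>s. local_extremum_on (rel_interior F) f s \<and> f s = u)) \<and>
     (\<forall>e\<in>Basis. \<not> (\<exists>s\<in>T. f s - u = 0 \<and> partial e f s = 0 \<and> partial e (partial e f) s = 0))"

definition as_regular_field ::
  "'w measure \<Rightarrow> (real \<times> real) set \<Rightarrow> (real \<times> real \<Rightarrow> 'w \<Rightarrow> real) \<Rightarrow> bool" where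
  "as_regular_field M T X \<longleftrightarrow> (\<forall>u. AE \<omega> in M. regular_at_level T (\<lambda>s. X s \<omega>) u)"

text \<open>One-dimensional Hausdorff (outer) measure. Boundedness of the covering sets is required
  explicitly because \<^const>\<open>diameter\<close> has no meaningful value on unbounded sets.\<close>

definition hausdorff1_delta :: "real \<Rightarrow> ('a::metric_space) set \<Rightarrow> ennreal" where
  "hausdorff1_delta \<delta> A =
     (INF U\<in>{U :: nat \<Rightarrow> 'a set. A \<subseteq> (\<Union>i. U i) \<and> (\<forall>i. bounded (U i) \<and> diameter (U i) \<le> \<delta>)}.
        \<Sum>i. ennreal (diameter (U i)))"

definition hausdorff1 :: "('a::metric_space) set \<Rightarrow> ennreal" where
  "hausdorff1 A = (SUP \<delta>\<in>{0<..}. hausdorff1_delta \<delta> A)"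

definition excursion :: "(real \<times> real \<Rightarrow> real) \<Rightarrow> real \<Rightarrow> (real \<times> real) set" where
  "excursion f u = {s. f s \<ge> u}"

definition perimeter :: "(real \<times> real) set \<Rightarrow> (real \<times> real \<Rightarrow> real) \<Rightarrow> real \<Rightarrow> ennreal" where
  "perimeter T f u = hausdorff1 (T \<inter> frontier (excursion f u))"

definition grid_point :: "real \<Rightarrow> real \<Rightarrow> nat \<Rightarrow> nat \<Rightarrow> real \<times> real" where
  "grid_point t \<epsilon> i j = (-t + real i * \<epsilon>, -t + real j * \<epsilon>)"

definition grid :: "real \<Rightarrow> real \<Rightarrow> (real \<times> real) set" where
  "grid t \<epsilon> = {grid_point t \<epsilon> i j | i j. True} \<inter> square t"

definition grid_size :: "real \<Rightarrow> real \<Rightarrow> nat" where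
  "grid_size t \<epsilon> = card (fst ` grid t \<epsilon>)"

definition block_starts :: "real \<Rightarrow> real \<Rightarrow> nat \<Rightarrow> nat set" where
  "block_starts t \<epsilon> m = {i \<in> {..<grid_size t \<epsilon>}. m dvd i}"

definition zeta :: "(real \<times> real \<Rightarrow> real) \<Rightarrow> real \<Rightarrow> real \<Rightarrow> real \<Rightarrow> nat \<Rightarrow> nat \<Rightarrow> real" where
  "zeta f t u \<epsilon> i j = (if f (grid_point t \<epsilon> i j) \<ge> u then 1 else 0)"

text \<open>With \<open>M = grid_size t \<epsilon>\<close>, the half-open ranges below express the closed ranges with upper ends
  \<open>min (b + m - 1) (M - 1)\<close> and \<open>min (b + m - 1) (M - 2)\<close> without the artefacts of truncated
  subtraction.\<close>

definition N_h :: "(real \<times> real \<Rightarrow> real) \<Rightarrow> real \<Rightarrow> real \<Rightarrow> real \<Rightarrow> nat \<Rightarrow> nat \<Rightarrow> nat \<Rightarrow> real" where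
  "N_h f t u \<epsilon> m a b =
     (\<Sum>i = a..<min (a + m) (grid_size t \<epsilon>). \<Sum>j = b..<min (b + m) (grid_size t \<epsilon> - 1).
        \<bar>zeta f t u \<epsilon> i j - zeta f t u \<epsilon> i (j + 1)\<bar>)"

definition N_v :: "(real \<times> real \<Rightarrow> real) \<Rightarrow> real \<Rightarrow> real \<Rightarrow> real \<Rightarrow> nat \<Rightarrow> nat \<Rightarrow> nat \<Rightarrow> real" where
  "N_v f t u \<epsilon> m a b =
     (\<Sum>i = a..<min (a + m) (grid_size t \<epsilon> - 1). \<Sum>j = b..<min (b + m) (grid_size t \<epsilon>).
        \<bar>zeta f t u \<epsilon> i j - zeta f t u \<epsilon> (i + 1) j\<bar>)"

definition perimeter_estimator ::
  "(real \<times> real \<Rightarrow> real) \<Rightarrow> real \<Rightarrow> nat \<Rightarrow> real \<Rightarrow> real \<Rightarrow> real" where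
  "perimeter_estimator f \<epsilon> m t u =
     \<epsilon> * (\<Sum>a\<in>block_starts t \<epsilon> m. \<Sum>b\<in>block_starts t \<epsilon> m.
            norm (N_h f t u \<epsilon> m a b, N_v f t u \<epsilon> m a b))"

end

theory Submission
  imports Defs
begin

text \<open>The statement is deterministic: it holds for every sample path \<open>f\<close> that is regular at the level
  \<open>u\<close>. For such a path the part of the boundary of the excursion set inside \<open>T\<close> is the level set
  \<open>\<Gamma> = {s \<in> T. f s = u}\<close>, because the gradient does not vanish on \<open>\<Gamma>\<close>. Write \<open>\<delta> = m \<epsilon>\<close> for the side
  of a block.

  Consider a small block that meets \<open>\<Gamma>\<close>. By compactness one of the two first partial derivatives is
  bounded away from zero on it, say the vertical one, so that \<open>\<Gamma>\<close> is a graph over the horizontal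
  axis there. The third regularity condition makes all rows of the block strictly quasiconvex, or all
  of them strictly quasiconcave; hence a row meets \<open>\<Gamma>\<close> at most twice and the graph consists of at
  most two monotone arcs. Let \<open>h\<close> and \<open>v\<close> be the total horizontal and vertical extents of the arcs.
  Two facts are combined.

  First, the length of \<open>\<Gamma>\<close> in the block is \<open>\<parallel>(h, v)\<parallel> + O(\<delta>\<^sup>3)\<close>. Since the gradient is Lipschitz, any two
  chords of \<open>\<Gamma>\<close> in the block have slopes that differ by at most \<open>\<kappa> = O(\<delta>)\<close>, and the deficit in the
  triangle inequality is quadratic in the angle: replacing a chord by its projection to a fixed nearby
  direction costs only the factor \<open>1 + O(\<kappa>\<^sup>2)\<close>. This is \<open>chord_le_projection\<close>. It bounds the length of
  an arc by that of its chord (\<open>arc_hausdorff1_le\<close>), and it allows one to add up the chords of the two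
  arcs after reflecting them into the same quadrant.

  Second, \<open>\<epsilon> N_h\<close> and \<open>\<epsilon> N_v\<close> differ from \<open>h\<close> and \<open>v\<close> by \<open>O(\<epsilon>)\<close>, because they count the grid columns
  and grid rows that cross the arcs. A pair of crossings that falls between two neighbouring grid
  points is lost, but only for rows within \<open>O(\<epsilon>)\<close> of the extremum of the graph. Together this gives
  \<open>steep_box_estimate\<close>: the contribution of a block is correct up to \<open>O(\<epsilon> + \<delta>\<^sup>3)\<close>.

  Only \<open>O(1 / \<delta>)\<close> blocks meet \<open>\<Gamma>\<close> (\<open>card_met\<close>), and the others contribute nothing to either side. The
  total error is therefore \<open>O(\<epsilon> / \<delta> + \<delta>\<^sup>2) = O((1 + m\<^sup>3 \<epsilon>\<^sup>2) / m)\<close>. The scaling of \<open>m\<close> against \<open>\<epsilon>\<close> is the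
  one for which \<open>m\<^sup>3 \<epsilon>\<^sup>2\<close> converges, so that the error is \<open>O(1 / m)\<close>, which
  \<open>g = o(m)\<close> cannot compensate.

  Additivity of the Hausdorff measure is used in the two forms that are quick to prove for the outer
  measure: finite subadditivity for the upper bound, and superadditivity over disjoint compact sets for
  the lower bound. The latter is why every block estimate provides compact pieces of \<open>\<Gamma>\<close> inside the
  \<^emph>\<open>open\<close> block: the open blocks are disjoint.\<close>

section \<open>One-dimensional Hausdorff measure\<close>

lemma hausdorff1_delta_mono:
  assumes "A \<subseteq> B" shows "hausdorff1_delta d A \<le> hausdorff1_delta d B"
  unfolding hausdorff1_delta_def using assms by (intro INF_superset_mono) auto

lemma hausdorff1_mono:
  assumes "A \<subseteq> B" shows "hausdorff1 A \<le> hausdorff1 B"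
  unfolding hausdorff1_def by (intro SUP_mono' hausdorff1_delta_mono assms)

lemma hausdorff1_delta_le:
  assumes "A \<subseteq> (\<Union>i. U i)" "\<And>i. bounded (U i)" "\<And>i. diameter (U i) \<le> d"
  shows "hausdorff1_delta d A \<le> (\<Sum>i. ennreal (diameter (U i)))"
  unfolding hausdorff1_delta_def using assms by (intro INF_lower) auto

lemma hausdorff1_delta_ge:
  assumes "\<And>U :: nat \<Rightarrow> 'a::metric_space set. A \<subseteq> (\<Union>i. U i) \<Longrightarrow> (\<And>i. bounded (U i)) \<Longrightarrow>
      (\<And>i. diameter (U i) \<le> d) \<Longrightarrow> z \<le> (\<Sum>i. ennreal (diameter (U i)))"
  shows "z \<le> hausdorff1_delta d A"
  unfolding hausdorff1_delta_def using assms by (intro INF_greatest) auto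

lemma hausdorff1_delta_antimono:
  assumes "d \<le> d'" shows "hausdorff1_delta d' A \<le> hausdorff1_delta d A"
  unfolding hausdorff1_delta_def using assms by (intro INF_superset_mono) (auto intro: order_trans)

lemma hausdorff1_delta_le_hausdorff1: "0 < d \<Longrightarrow> hausdorff1_delta d A \<le> hausdorff1 A"
  unfolding hausdorff1_def by (intro SUP_upper) auto

text \<open>A cover is a sequence, so two covers have to be interleaved. They are put into the first two rows of
  a doubly indexed family of otherwise empty sets, which is enumerated by \<^const>\<open>prod_decode\<close>; the sum
  of diameters is then a double sum with two nonzero rows.\<close>
lemma hausdorff1_delta_cover_Un:
  fixes U V :: "nat \<Rightarrow> 'a::metric_space set"
  assumes "A \<subseteq> (\<Union>i. U i)" "\<And>i. bounded (U i)" "\<And>i. diameter (U i) \<le> d"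
    and "B \<subseteq> (\<Union>i. V i)" "\<And>i. bounded (V i)" "\<And>i. diameter (V i) \<le> d"
  shows "hausdorff1_delta d (A \<union> B) \<le> (\<Sum>i. ennreal (diameter (U i))) + (\<Sum>i. ennreal (diameter (V i)))"
proof -
  define W where "W = (\<lambda>(n::nat, k). if n = 0 then U k else if n = 1 then V k else {})"
  have d0: "0 \<le> d"
    using assms(2)[of 0] assms(3)[of 0] diameter_ge_0 order_trans by blast
  have "hausdorff1_delta d (A \<union> B) \<le> (\<Sum>i. ennreal (diameter (W (prod_decode i))))"
  proof (rule hausdorff1_delta_le)
    show "A \<union> B \<subseteq> (\<Union>i. W (prod_decode i))"
    proof
      fix x assume "x \<in> A \<union> B"
      then obtain k where "x \<in> W (0, k) \<or> x \<in> W (1, k)"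
        using assms(1,4) by (auto simp: W_def)
      then show "x \<in> (\<Union>i. W (prod_decode i))"
        by (metis UN_I UNIV_I prod_encode_inverse)
    qed
  qed (auto simp: W_def assms d0 split: prod.splits)
  also have "\<dots> = (\<Sum>n. \<Sum>k. ennreal (diameter (W (n, k))))"
    by (rule suminf_ennreal_2dimen[where g = "\<lambda>n. \<Sum>k. ennreal (diameter (W (n, k)))"]) auto
  also have "\<dots> = (\<Sum>n<2. \<Sum>k. ennreal (diameter (W (n, k))))"
    by (rule suminf_finite) (auto simp: W_def)
  also have "\<dots> = (\<Sum>i. ennreal (diameter (U i))) + (\<Sum>i. ennreal (diameter (V i)))"
    by (simp add: W_def numeral_2_eq_2)
  finally show ?thesis .
qed

lemma hausdorff1_delta_Un:
  "hausdorff1_delta d (A \<union> B) \<le> hausdorff1_delta d A + hausdorff1_delta d (B::'a::metric_space set)"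
proof -
  let ?C = "\<lambda>A. {U :: nat \<Rightarrow> 'a set. A \<subseteq> (\<Union>i. U i) \<and> (\<forall>i. bounded (U i) \<and> diameter (U i) \<le> d)}"
  let ?s = "\<lambda>U :: nat \<Rightarrow> 'a set. \<Sum>i. ennreal (diameter (U i))"
  have *: "hausdorff1_delta d (A \<union> B) \<le> ?s U + ?s V" if "U \<in> ?C A" "V \<in> ?C B" for U V
    using that by (intro hausdorff1_delta_cover_Un) auto
  show ?thesis
  proof (cases "?C A = {} \<or> ?C B = {}")
    case True
    then have "hausdorff1_delta d A = \<top> \<or> hausdorff1_delta d B = \<top>"
      unfolding hausdorff1_delta_def by (elim disjE) (simp_all only: INF_empty simp_thms)
    then show ?thesis by (auto simp: top_add)
  next
    case False
    show ?thesis
    proof (rule ennreal_le_epsilon)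
      fix e :: real assume fin: "hausdorff1_delta d A + hausdorff1_delta d B < \<top>" and "0 < e"
      have approx: "\<exists>U\<in>?C S. ?s U < hausdorff1_delta d S + ennreal (e / 2)" if "hausdorff1_delta d S < \<top>" for S
      proof -
        have "hausdorff1_delta d S < hausdorff1_delta d S + ennreal (e / 2)"
          using \<open>0 < e\<close> that by (cases "hausdorff1_delta d S") (auto simp flip: ennreal_plus intro!: ennreal_lessI)
        then show ?thesis unfolding hausdorff1_delta_def by (simp only: INF_less_iff)
      qed
      obtain U V where "U \<in> ?C A" "V \<in> ?C B" "?s U < hausdorff1_delta d A + ennreal (e / 2)"
          "?s V < hausdorff1_delta d B + ennreal (e / 2)"
        using approx[of A] approx[of B] fin by auto
      then have "hausdorff1_delta d (A \<union> B) \<le> 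
          (hausdorff1_delta d A + ennreal (e / 2)) + (hausdorff1_delta d B + ennreal (e / 2))"
        using * by (meson add_mono less_imp_le order_trans)
      also have "\<dots> = hausdorff1_delta d A + hausdorff1_delta d B + (ennreal (e / 2) + ennreal (e / 2))"
        by (simp add: ac_simps)
      also have "ennreal (e / 2) + ennreal (e / 2) = ennreal e"
        using \<open>0 < e\<close> by (subst ennreal_plus[symmetric]) auto
      finally show "hausdorff1_delta d (A \<union> B) \<le> hausdorff1_delta d A + hausdorff1_delta d B + ennreal e" .
    qed
  qed
qed

lemma hausdorff1_Un: "hausdorff1 (A \<union> B) \<le> hausdorff1 A + hausdorff1 B"
proof -
  have "hausdorff1_delta d (A \<union> B) \<le> hausdorff1 A + hausdorff1 B" if "d > 0" for d
    using hausdorff1_delta_Un[of d A B] add_mono[OF hausdorff1_delta_le_hausdorff1[OF that] 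
        hausdorff1_delta_le_hausdorff1[OF that]] order_trans by blast
  then show ?thesis
    by (subst hausdorff1_def) (auto intro!: SUP_least)
qed

lemma hausdorff1_singleton [simp]: "hausdorff1 {x} = 0"
proof -
  have "hausdorff1_delta d {x} \<le> (\<Sum>i. ennreal (diameter ((\<lambda>_. {x}) (i::nat))))" if "d > 0" for d
    using that by (intro hausdorff1_delta_le[of "{x}" "\<lambda>_. {x}"]) auto
  then show ?thesis by (simp add: hausdorff1_def)
qed

lemma hausdorff1_empty [simp]: "hausdorff1 {} = 0"
  using hausdorff1_mono[of "{}" "{undefined}"] by simp

lemma hausdorff1_UN_le:
  "finite I \<Longrightarrow> hausdorff1 (\<Union>i\<in>I. A i) \<le> (\<Sum>i\<in>I. hausdorff1 (A i))"
proof (induction I rule: finite_induct)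
  case (insert i I)
  then show ?case
    using hausdorff1_Un[of "A i" "\<Union>i\<in>I. A i"] add_left_mono order_trans by fastforce
qed simp

lemma hausdorff1_finite: assumes "finite A" shows "hausdorff1 A = 0"
  using hausdorff1_UN_le[OF assms, of "\<lambda>x. {x}"] by simp

lemma diameter_le_dist:
  assumes "\<And>x y. x \<in> A \<Longrightarrow> y \<in> A \<Longrightarrow> dist x y \<le> d" "0 \<le> d"
  shows "bounded A" "diameter A \<le> d"
proof -
  show "bounded A" using assms(1) unfolding bounded_def by blast
  show "diameter A \<le> d" using assms by (auto simp: diameter_def intro!: cSUP_least)
qed

lemma hausdorff1_image_le:
  fixes F :: "'a::metric_space \<Rightarrow> 'b::metric_space"
  assumes lip: "\<And>x y. dist (F x) (F y) \<le> dist x y"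
  shows "hausdorff1 (F ` A) \<le> hausdorff1 A"
proof -
  have "hausdorff1_delta d (F ` A) \<le> hausdorff1_delta d A" if "d > 0" for d
  proof (rule hausdorff1_delta_ge)
    fix U :: "nat \<Rightarrow> 'a set"
    assume U: "A \<subseteq> (\<Union>i. U i)" "\<And>i. bounded (U i)" "\<And>i. diameter (U i) \<le> d"
    have di: "bounded (F ` U i)" "diameter (F ` U i) \<le> diameter (U i)" for i
      using diameter_le_dist[of "F ` U i" "diameter (U i)"] U(2)[of i] lip
      by (auto intro: order_trans[OF lip] diameter_bounded_bound simp: diameter_ge_0)
    have "hausdorff1_delta d (F ` A) \<le> (\<Sum>i. ennreal (diameter (F ` U i)))"
      using U(1) by (intro hausdorff1_delta_le di(1) order_trans[OF di(2) U(3)]) blast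
    also have "\<dots> \<le> (\<Sum>i. ennreal (diameter (U i)))"
      by (intro suminf_le) (auto intro!: ennreal_leI di)
    finally show "hausdorff1_delta d (F ` A) \<le> (\<Sum>i. ennreal (diameter (U i)))" .
  qed
  then show ?thesis unfolding hausdorff1_def by (intro SUP_mono) auto
qed

text \<open>A covering set whose diameter is below the distance of \<open>A\<close> and \<open>B\<close> meets at most one of them, so a
  fine cover of the union splits into a cover of \<open>A\<close> and one of \<open>B\<close>.\<close>
lemma hausdorff1_separated:
  fixes A B :: "'a::metric_space set"
  assumes e: "e > 0" and sep: "\<And>x y. x \<in> A \<Longrightarrow> y \<in> B \<Longrightarrow> e \<le> dist x y"
  shows "hausdorff1 A + hausdorff1 B \<le> hausdorff1 (A \<union> B)"
proof -
  have le: "hausdorff1_delta d A + hausdorff1_delta d B \<le> hausdorff1_delta d (A \<union> B)" if d: "0 < d" "d < e" for d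
  proof (rule hausdorff1_delta_ge)
    fix U :: "nat \<Rightarrow> 'a set"
    assume U: "A \<union> B \<subseteq> (\<Union>i. U i)" "\<And>i. bounded (U i)" "\<And>i. diameter (U i) \<le> d"
    define V where "V = (\<lambda>C i. if U i \<inter> C = {} then {} else U i)"
    have V: "hausdorff1_delta d C \<le> (\<Sum>i. ennreal (diameter (V C i)))" if "C \<subseteq> A \<union> B" for C
      using U that d by (intro hausdorff1_delta_le) (auto simp: V_def, blast)
    have "ennreal (diameter (V A i)) + ennreal (diameter (V B i)) \<le> ennreal (diameter (U i))" for i
    proof -
      have "U i \<inter> A = {} \<or> U i \<inter> B = {}"
      proof (rule ccontr)
        assume "\<not> ?thesis"
        then obtain x y where xy: "x \<in> U i" "x \<in> A" "y \<in> U i" "y \<in> B" by auto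
        then have "dist x y \<le> diameter (U i)" using U(2) by (intro diameter_bounded_bound) auto
        then show False using U(3)[of i] sep[of x y] d xy by auto
      qed
      then show ?thesis by (auto simp: V_def)
    qed
    then have "(\<Sum>i. ennreal (diameter (V A i))) + (\<Sum>i. ennreal (diameter (V B i))) \<le> (\<Sum>i. ennreal (diameter (U i)))"
      by (subst suminf_add) (auto intro!: suminf_le)
    then show "hausdorff1_delta d A + hausdorff1_delta d B \<le> (\<Sum>i. ennreal (diameter (U i)))"
      using add_mono[OF V[of A] V[of B]] order_trans by blast
  qed
  \<comment> \<open>Only scales below the separation matter in the supremum.\<close>
  have ev: "\<exists>d'\<in>{0<..<e}. hausdorff1_delta d C \<le> hausdorff1_delta d' C" if "d > 0" for d and C :: "'a set"
    using that e by (intro bexI[of _ "min d (e/2)"] hausdorff1_delta_antimono) auto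
  have eq: "hausdorff1 C = (SUP d\<in>{0<..<e}. hausdorff1_delta d C)" for C :: "'a set"
    unfolding hausdorff1_def using ev by (intro antisym SUP_least SUP_mono) (auto intro: SUP_upper2)
  have "hausdorff1 A + hausdorff1 B = (SUP d\<in>{0<..<e}. hausdorff1_delta d A + hausdorff1_delta d B)"
    unfolding eq
  proof (rule SUP_add_directed_ennreal[symmetric])
    fix i j assume "i \<in> {0<..<e}" "j \<in> {0<..<e}"
    then show "\<exists>k\<in>{0<..<e}. hausdorff1_delta i A + hausdorff1_delta j B \<le> hausdorff1_delta k A + hausdorff1_delta k B"
      by (intro bexI[of _ "min i j"] add_mono hausdorff1_delta_antimono) auto
  qed
  also have "\<dots> \<le> hausdorff1 (A \<union> B)"
    unfolding eq by (intro SUP_mono) (auto intro: le)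
  finally show ?thesis .
qed

lemma hausdorff1_disjoint_compact:
  fixes A B :: "'a::heine_borel set"
  assumes "compact A" "compact B" "A \<inter> B = {}"
  shows "hausdorff1 A + hausdorff1 B \<le> hausdorff1 (A \<union> B)"
proof -
  obtain e where "e > 0" "\<And>x y. x \<in> A \<Longrightarrow> y \<in> B \<Longrightarrow> e \<le> dist x y"
    using separate_compact_closed[OF assms(1) compact_imp_closed[OF assms(2)] assms(3)] by blast
  then show ?thesis by (rule hausdorff1_separated)
qed

lemma hausdorff1_disjoint_compact_UN:
  fixes A :: "'i \<Rightarrow> 'a::heine_borel set"
  assumes "finite I" "\<And>i. i \<in> I \<Longrightarrow> compact (A i)" "disjoint_family_on A I"
  shows "(\<Sum>i\<in>I. hausdorff1 (A i)) \<le> hausdorff1 (\<Union>i\<in>I. A i)"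
  using assms
proof (induction I rule: finite_induct)
  case (insert i I)
  have "A i \<inter> (\<Union>i\<in>I. A i) = {}" using insert by (auto simp: disjoint_family_on_def)
  then have "hausdorff1 (A i) + hausdorff1 (\<Union>i\<in>I. A i) \<le> hausdorff1 (\<Union>i\<in>insert i I. A i)"
    using hausdorff1_disjoint_compact[of "A i" "\<Union>i\<in>I. A i"] insert by (auto intro!: compact_UN)
  moreover have "(\<Sum>i\<in>I. hausdorff1 (A i)) \<le> hausdorff1 (\<Union>i\<in>I. A i)"
    using insert by (auto simp: disjoint_family_on_def)
  ultimately show ?case using insert(1,2) by (simp add: add_left_mono order_trans[OF add_left_mono])
qed simp

text \<open>The map \<^term>\<open>dist p\<close> does not increase distances, and by connectedness it maps \<open>A\<close> onto a set that
  contains the interval from \<open>0\<close> to \<^term>\<open>dist p q\<close>. Any cover of \<open>A\<close> thus yields a cover of that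
  interval by intervals of the same diameters, and Lebesgue measure is countably subadditive.\<close>
lemma hausdorff1_connected_ge_dist:
  fixes A :: "'a::metric_space set"
  assumes "connected A" "p \<in> A" "q \<in> A"
  shows "ennreal (dist p q) \<le> hausdorff1 A"
proof -
  have "ennreal (dist p q) \<le> hausdorff1_delta 1 A"
  proof (rule hausdorff1_delta_ge)
    fix U :: "nat \<Rightarrow> 'a set"
    assume U: "A \<subseteq> (\<Union>i. U i)" "\<And>i. bounded (U i)"
    define I where "I = (\<lambda>i. cball (Inf (dist p ` U i) + diameter (U i) / 2) (diameter (U i) / 2))"
    have cov: "{0..dist p q} \<subseteq> (\<Union>i\<in>{i. U i \<noteq> {}}. I i)"
    proof
      fix z assume z: "z \<in> {0..dist p q}"
      have "connected (dist p ` A)"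
        by (intro connected_continuous_image continuous_intros assms)
      then have "z \<in> dist p ` A"
        using connectedD_interval[of "dist p ` A" "dist p p" "dist p q" z] assms z by auto
      then obtain x where x: "x \<in> A" "z = dist p x" by auto
      then obtain i where i: "x \<in> U i" using U by auto
      have bb: "bdd_below (dist p ` U i)" by (auto intro!: bdd_belowI[of _ 0])
      have 1: "Inf (dist p ` U i) \<le> z" using x i bb by (auto intro: cInf_lower)
      have "z - diameter (U i) \<le> Inf (dist p ` U i)"
      proof (rule cInf_greatest)
        fix w assume "w \<in> dist p ` U i"
        then obtain y where y: "y \<in> U i" "w = dist p y" by auto
        have "dist x y \<le> diameter (U i)" using U(2) i y by (intro diameter_bounded_bound) auto
        then show "z - diameter (U i) \<le> w" using x y dist_triangle[of p x y] by (simp add: dist_commute)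
      qed (use i in auto)
      then have "z \<in> I i" using 1 by (auto simp: I_def dist_real_def abs_le_iff field_simps)
      then show "z \<in> (\<Union>i\<in>{i. U i \<noteq> {}}. I i)" using i by auto
    qed
    have "ennreal (dist p q) = emeasure lborel {0..dist p q}" by simp
    also have "\<dots> \<le> emeasure lborel (\<Union>i. I i)" 
      using cov by (intro emeasure_mono) (auto simp: I_def)
    also have "\<dots> \<le> (\<Sum>i. emeasure lborel (I i))"
      by (intro emeasure_subadditive_countably) (auto simp: I_def)
    also have "\<dots> = (\<Sum>i. ennreal (diameter (U i)))"
      using U(2) by (intro suminf_cong) (auto simp: I_def cball_eq_atLeastAtMost diameter_ge_0)
    finally show "ennreal (dist p q) \<le> (\<Sum>i. ennreal (diameter (U i)))" .
  qed
  then show ?thesis using hausdorff1_delta_le_hausdorff1[of 1 A] by simp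
qed

text \<open>The function \<open>S\<close> plays the role of an arc length that is allowed to run too fast. The increments of
  \<open>S\<close> bound all chords, not only those between nearby points, so cutting the parameter interval into
  equal pieces gives a cover whose diameters telescope to the increment of \<open>S\<close>; its Lipschitz bound
  makes the pieces small.\<close>
lemma hausdorff1_curve_le:
  fixes \<gamma> :: "real \<Rightarrow> 'a::metric_space"
  assumes pq: "p \<le> q"
    and dS: "\<And>x x'. p \<le> x \<Longrightarrow> x \<le> x' \<Longrightarrow> x' \<le> q \<Longrightarrow> dist (\<gamma> x) (\<gamma> x') \<le> S x' - S x"
    and lip: "\<And>x x'. p \<le> x \<Longrightarrow> x \<le> x' \<Longrightarrow> x' \<le> q \<Longrightarrow> S x' - S x \<le> \<Lambda> * (x' - x)"
  shows "hausdorff1 (\<gamma> ` {p..q}) \<le> ennreal (S q - S p)"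
proof -
  have mono: "S x \<le> S x'" if "p \<le> x" "x \<le> x'" "x' \<le> q" for x x'
    using dS[OF that] by (meson diff_ge_0_iff_ge dual_order.trans zero_le_dist)
  have "hausdorff1_delta d (\<gamma> ` {p..q}) \<le> ennreal (S q - S p)" if d: "d > 0" for d
  proof -
    obtain N :: nat where N: "\<bar>\<Lambda>\<bar> * (q - p) / d < real N" using reals_Archimedean2 by blast
    then have N0: "N > 0" using pq d
      by (metis abs_ge_zero diff_ge_0_iff_ge divide_nonneg_pos gr0I mult_nonneg_nonneg not_le of_nat_0)
    define h where "h = (q - p) / N"
    define z where "z = (\<lambda>i::nat. p + i * h)"
    have h0: "h \<ge> 0" using pq by (simp add: h_def)
    have z0: "z 0 = p" and zN: "z N = q" using N0 by (auto simp: z_def h_def)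
    have zm: "z i \<le> z j" if "i \<le> j" for i j
      using that h0 by (auto simp: z_def intro!: mult_right_mono)
    have zr: "p \<le> z i" "i \<le> N \<Longrightarrow> z i \<le> q" for i
      using zm[of 0 i] zm[of i N] z0 zN by auto
    have hd: "\<bar>\<Lambda>\<bar> * h \<le> d" using N N0 d by (simp add: h_def field_simps)
    define U where "U = (\<lambda>i. if i < N then \<gamma> ` {z i..z (Suc i)} else {})"
    have D: "bounded (U i)" "diameter (U i) \<le> (if i < N then S (z (Suc i)) - S (z i) else 0)" for i
    proof -
      have ge: "0 \<le> (if i < N then S (z (Suc i)) - S (z i) else 0)"
        using zr zm by (auto intro!: mono)
      have *: "dist (\<gamma> x) (\<gamma> x') \<le> S (z (Suc i)) - S (z i)"
        if "i < N" "z i \<le> x" "x \<le> x'" "x' \<le> z (Suc i)" for x x'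
      proof -
        have "dist (\<gamma> x) (\<gamma> x') \<le> S x' - S x"
          using that zr[of i] zr[of "Suc i"] by (intro dS) auto
        moreover have "S x' \<le> S (z (Suc i))" "S (z i) \<le> S x"
          using that zr[of i] zr[of "Suc i"] by (auto intro!: mono)
        ultimately show ?thesis by simp
      qed
      have "dist x y \<le> (if i < N then S (z (Suc i)) - S (z i) else 0)" if "x \<in> U i" "y \<in> U i" for x y
      proof -
        have "i < N" using that by (auto simp: U_def split: if_splits)
        then have "x \<in> \<gamma> ` {z i..z (Suc i)}" "y \<in> \<gamma> ` {z i..z (Suc i)}"
          using that by (auto simp: U_def)
        then obtain a b where ab: "x = \<gamma> a" "y = \<gamma> b" "a \<in> {z i..z (Suc i)}" "b \<in> {z i..z (Suc i)}"
          by blast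
        then show ?thesis using *[of a b] *[of b a] \<open>i < N\<close>
          by (cases "a \<le> b") (auto simp: dist_commute)
      qed
      then show "bounded (U i)" "diameter (U i) \<le> (if i < N then S (z (Suc i)) - S (z i) else 0)"
        using diameter_le_dist[OF _ ge] by blast+
    qed
    have "hausdorff1_delta d (\<gamma> ` {p..q}) \<le> (\<Sum>i. ennreal (diameter (U i)))"
    proof (rule hausdorff1_delta_le)
      show "\<gamma> ` {p..q} \<subseteq> (\<Union>i. U i)"
      proof
        fix y assume "y \<in> \<gamma> ` {p..q}"
        then obtain x where x: "y = \<gamma> x" "p \<le> x" "x \<le> q" by auto
        have "\<exists>i<N. x \<in> {z i..z (Suc i)}"
        proof (rule ccontr)
          assume no: "\<not> ?thesis"
          have "i \<le> N \<Longrightarrow> z i \<le> x" for i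
          proof (induction i)
            case (Suc i)
            then have "z i \<le> x" "x < z i \<or> z (Suc i) < x" using no by auto
            then show ?case by simp
          qed (use x z0 in auto)
          then have "x = z N" using x zN by force
          moreover have "z (N - 1) \<le> z N" by (intro zm) auto
          ultimately have "N - 1 < N \<and> x \<in> {z (N-1)..z (Suc (N-1))}" using N0 by simp
          then show False using no by blast
        qed
        then show "y \<in> (\<Union>i. U i)" using x by (auto simp: U_def)
      qed
      show "diameter (U i) \<le> d" for i
      proof (cases "i < N")
        case True
        have "diameter (U i) \<le> \<Lambda> * (z (Suc i) - z i)"
          using D(2)[of i] lip[of "z i" "z (Suc i)"] zr[of i] zr[of "Suc i"] zm[of i "Suc i"] True by simp
        also have "\<dots> = \<Lambda> * h" by (simp add: z_def algebra_simps)
        also have "\<dots> \<le> \<bar>\<Lambda>\<bar> * h" using h0 by (intro mult_right_mono) auto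
        finally show ?thesis using hd by simp
      qed (use D(2)[of i] d in auto)
    qed (rule D(1))
    also have "\<dots> = (\<Sum>i<N. ennreal (diameter (U i)))"
      by (rule suminf_finite) (auto simp: U_def)
    also have "\<dots> = ennreal (\<Sum>i<N. diameter (U i))"
      using D(1) by (intro sum_ennreal diameter_ge_0)
    also have "\<dots> \<le> ennreal (\<Sum>i<N. S (z (Suc i)) - S (z i))"
    proof (intro ennreal_leI sum_mono)
      fix i assume "i \<in> {..<N}" then show "diameter (U i) \<le> S (z (Suc i)) - S (z i)" using D(2)[of i] by simp
    qed
    also have "(\<Sum>i<N. S (z (Suc i)) - S (z i)) = S q - S p"
      using sum_lessThan_telescope[of "\<lambda>i. S (z i)" N] by (simp add: z0 zN)
    finally show ?thesis .
  qed
  then show ?thesis unfolding hausdorff1_def by (auto intro!: SUP_least)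
qed

section \<open>Changes of binary sequences and counts of grid points\<close>

lemma sum_changes_valley:
  fixes q :: "nat \<Rightarrow> real"
  assumes "p \<le> n" "\<And>i. i < p \<Longrightarrow> q (Suc i) \<le> q i" "\<And>i. p \<le> i \<Longrightarrow> i < n \<Longrightarrow> q i \<le> q (Suc i)"
  shows "(\<Sum>i<n. \<bar>q i - q (Suc i)\<bar>) = q 0 + q n - 2 * q p"
  using assms
proof (induction "n - p" arbitrary: n)
  case 0
  have "m \<le> p \<Longrightarrow> (\<Sum>i<m. \<bar>q i - q (Suc i)\<bar>) = q 0 - q m" for m
  proof (induction m)
    case (Suc m)
    then show ?case using "0.prems"(2)[of m] by auto
  qed simp
  then show ?case using 0 by auto
next
  case (Suc d)
  then obtain n' where n': "n = Suc n'" by (cases n) auto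
  then show ?case using Suc.hyps(1)[of n'] Suc.hyps(2) Suc.prems(1,2) Suc.prems(3)[of n'] Suc.prems(3) by auto
qed

lemma sum_changes_mono:
  fixes q :: "nat \<Rightarrow> real"
  assumes "\<And>i. i < n \<Longrightarrow> q i \<le> q (Suc i)"
  shows "(\<Sum>i<n. \<bar>q i - q (Suc i)\<bar>) = q n - q 0"
  using sum_changes_valley[of 0 n q] assms by simp

text \<open>The zeros of such a sequence are consecutive, so there is a change on each side of them exactly where
  the sequence ends with a one.\<close>
lemma sum_changes_quasiconvex_binary:
  fixes q :: "nat \<Rightarrow> real"
  assumes bin: "\<And>i. i \<le> n \<Longrightarrow> q i \<in> {0, 1}"
    and qc: "\<And>i l i'. i \<le> l \<Longrightarrow> l \<le> i' \<Longrightarrow> i' \<le> n \<Longrightarrow> q l \<le> max (q i) (q i')"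
  shows "(\<Sum>i<n. \<bar>q i - q (Suc i)\<bar>) = (if \<exists>i\<le>n. q i = 0 then q 0 + q n else 0)"
proof (cases "\<exists>i\<le>n. q i = 0")
  case True
  then obtain p where p: "p \<le> n" "q p = 0" by auto
  have nn: "0 \<le> q i" if "i \<le> n" for i using bin[OF that] by auto
  have "(\<Sum>i<n. \<bar>q i - q (Suc i)\<bar>) = q 0 + q n - 2 * q p"
  proof (rule sum_changes_valley[OF p(1)])
    show "q (Suc i) \<le> q i" if "i < p" for i
      using qc[of i "Suc i" p] that p nn[of i] by (auto simp: max_def)
    show "q i \<le> q (Suc i)" if "p \<le> i" "i < n" for i
      using qc[of p i "Suc i"] that p nn[of "Suc i"] by (auto simp: max_def)
  qed
  then show ?thesis using True p by simp
next
  case False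
  then have "q i = 1" if "i \<le> n" for i using bin[OF that] that by auto
  then show ?thesis using False by simp
qed

lemma card_grid_le:
  fixes x0 \<epsilon> a b :: real
  assumes "\<epsilon> > 0" "x0 \<le> a" "a \<le> b"
  shows "real (card {i. i \<le> n \<and> a \<le> x0 + real i * \<epsilon> \<and> x0 + real i * \<epsilon> \<le> b}) \<le> (b - a) / \<epsilon> + 1"
proof -
  define p where "p = (a - x0) / \<epsilon>"
  define q where "q = (b - x0) / \<epsilon>"
  have pq: "0 \<le> p" "p \<le> q" using assms by (auto simp: p_def q_def divide_right_mono)
  have iff: "a \<le> x0 + real i * \<epsilon> \<longleftrightarrow> p \<le> i" "x0 + real i * \<epsilon> \<le> b \<longleftrightarrow> i \<le> q" for i
    using assms by (auto simp: p_def q_def field_simps)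
  have "card {i. i \<le> n \<and> a \<le> x0 + real i * \<epsilon> \<and> x0 + real i * \<epsilon> \<le> b} \<le> card {nat \<lceil>p\<rceil>..nat \<lfloor>q\<rfloor>}"
    unfolding iff by (intro card_mono) (auto simp: nat_le_iff ceiling_le_iff le_nat_iff le_floor_iff pq)
  also have "real \<dots> \<le> q - p + 1"
  proof (cases "nat \<lceil>p\<rceil> \<le> Suc (nat \<lfloor>q\<rfloor>)")
    case True
    then have "real (card {nat \<lceil>p\<rceil>..nat \<lfloor>q\<rfloor>}) = real (nat \<lfloor>q\<rfloor>) + 1 - real (nat \<lceil>p\<rceil>)" by (simp add: of_nat_diff)
    moreover have "real (nat \<lfloor>q\<rfloor>) \<le> q" "p \<le> real (nat \<lceil>p\<rceil>)" using pq by auto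
    ultimately show ?thesis by linarith
  qed (use pq in auto)
  also have "q - p = (b - a) / \<epsilon>" by (simp add: p_def q_def diff_divide_distrib)
  finally show ?thesis by simp
qed

lemma card_grid_ge:
  fixes x0 \<epsilon> a b :: real
  assumes "\<epsilon> > 0" "x0 \<le> a" "b \<le> x0 + real n * \<epsilon>"
  shows "(b - a) / \<epsilon> - 1 \<le> real (card {i. i \<le> n \<and> a < x0 + real i * \<epsilon> \<and> x0 + real i * \<epsilon> < b})"
proof -
  define p where "p = (a - x0) / \<epsilon>"
  define q where "q = (b - x0) / \<epsilon>"
  have pq: "0 \<le> p" "q \<le> n" using assms by (auto simp: p_def q_def field_simps)
  have iff: "a < x0 + real i * \<epsilon> \<longleftrightarrow> p < i" "x0 + real i * \<epsilon> < b \<longleftrightarrow> i < q" for i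
    using assms by (auto simp: p_def q_def field_simps)
  have "(b - a) / \<epsilon> - 1 = q - p - 1" by (simp add: p_def q_def diff_divide_distrib)
  also have "\<dots> \<le> real (card {Suc (nat \<lfloor>p\<rfloor>)..<nat \<lceil>q\<rceil>})"
  proof -
    have "real (nat \<lfloor>p\<rfloor>) \<le> p" "q \<le> real (nat \<lceil>q\<rceil>)" using pq real_nat_ceiling_ge[of q] by auto
    then show ?thesis by simp
  qed
  also have "card {Suc (nat \<lfloor>p\<rfloor>)..<nat \<lceil>q\<rceil>} \<le> card {i. i \<le> n \<and> a < x0 + real i * \<epsilon> \<and> x0 + real i * \<epsilon> < b}"
  proof (unfold iff, intro card_mono subsetI CollectI conjI)
    fix i assume i: "i \<in> {Suc (nat \<lfloor>p\<rfloor>)..<nat \<lceil>q\<rceil>}"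
    then have "int i < \<lceil>q\<rceil>" by auto
    then show "i < q" by linarith
    then show "i \<le> n" using pq by linarith
    have "\<lfloor>p\<rfloor> < int i" using i pq by auto
    then show "p < i" by linarith
  qed auto
  finally show ?thesis by simp
qed

section \<open>Chords of nearly constant slope\<close>

text \<open>The vector \<open>(h, w)\<close> has a slope within \<open>\<kappa>\<close> of \<open>P\<close>. Its projection to the direction of slope \<open>P\<close> is
  shorter than the vector itself, but only by a term quadratic in \<open>\<kappa>\<close>: for \<open>w = \<sigma> h\<close> the arithmetic and
  geometric mean of \<open>1 + \<sigma>\<^sup>2\<close> and \<open>1 + P\<^sup>2\<close> differ from \<open>1 + P \<sigma>\<close> by at most \<open>(\<sigma> - P)\<^sup>2 / 2\<close>. Unlike
  lengths, projections are additive along a curve.\<close>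
lemma chord_le_projection:
  fixes h w P \<kappa> :: real
  assumes "0 \<le> h" "\<bar>w - P * h\<bar> \<le> \<kappa> * h"
  shows "sqrt (h\<^sup>2 + w\<^sup>2) \<le> (h + P * w) / sqrt (1 + P\<^sup>2) + \<kappa>\<^sup>2 / 2 * h"
proof (cases "h = 0")
  case False
  define \<sigma> where "\<sigma> = w / h"
  have h: "h > 0" and w: "w = \<sigma> * h" using assms False by (auto simp: \<sigma>_def)
  have "\<bar>\<sigma> - P\<bar> * h \<le> \<kappa> * h"
    using assms h unfolding w by (simp add: abs_mult flip: left_diff_distrib)
  then have "\<bar>\<sigma> - P\<bar> \<le> \<kappa>" using h by simp
  then have k: "(\<sigma> - P)\<^sup>2 \<le> \<kappa>\<^sup>2" by (metis abs_le_square_iff abs_of_nonneg abs_ge_zero order_trans)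
  have r: "1 \<le> sqrt (1 + P\<^sup>2)" by simp
  have "sqrt (1 + \<sigma>\<^sup>2) * sqrt (1 + P\<^sup>2) \<le> ((1 + \<sigma>\<^sup>2) + (1 + P\<^sup>2)) / 2"
    using arith_geo_mean_sqrt[of "1 + \<sigma>\<^sup>2" "1 + P\<^sup>2"] by (simp add: real_sqrt_mult)
  also have "\<dots> = 1 + P * \<sigma> + (\<sigma> - P)\<^sup>2 / 2" by (simp add: power2_eq_square field_simps)
  also have "\<dots> \<le> 1 + P * \<sigma> + \<kappa>\<^sup>2 / 2" using k by simp
  finally have "sqrt (1 + \<sigma>\<^sup>2) \<le> (1 + P * \<sigma> + \<kappa>\<^sup>2 / 2) / sqrt (1 + P\<^sup>2)"
    by (subst pos_le_divide_eq) (auto simp: add_pos_nonneg)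
  also have "\<dots> = (1 + P * \<sigma>) / sqrt (1 + P\<^sup>2) + \<kappa>\<^sup>2 / 2 / sqrt (1 + P\<^sup>2)" by (simp add: add_divide_distrib)
  also have "\<kappa>\<^sup>2 / 2 / sqrt (1 + P\<^sup>2) \<le> \<kappa>\<^sup>2 / 2"
    using r by (intro divide_left_mono[where b = 1, simplified]) (auto intro: add_pos_nonneg)
  finally have "h * sqrt (1 + \<sigma>\<^sup>2) \<le> h * ((1 + P * \<sigma>) / sqrt (1 + P\<^sup>2) + \<kappa>\<^sup>2 / 2)" using h by simp
  moreover have "sqrt (h\<^sup>2 + w\<^sup>2) = h * sqrt (1 + \<sigma>\<^sup>2)"
  proof -
    have "h\<^sup>2 + w\<^sup>2 = h\<^sup>2 * (1 + \<sigma>\<^sup>2)" by (simp add: w power_mult_distrib algebra_simps)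
    then show ?thesis using h by (simp add: real_sqrt_mult)
  qed
  ultimately show ?thesis by (simp add: w algebra_simps add_divide_distrib)
qed (use assms in auto)

lemma projection_le_chord:
  fixes h w P :: real
  shows "(h + P * w) / sqrt (1 + P\<^sup>2) \<le> sqrt (h\<^sup>2 + w\<^sup>2)"
proof -
  have pos: "sqrt (1 + P\<^sup>2) > 0" by (simp add: add_pos_nonneg)
  have "(h + P * w)\<^sup>2 \<le> (h\<^sup>2 + w\<^sup>2) * (1 + P\<^sup>2)"
    using zero_le_power2[of "w - P * h"] by (simp add: power2_eq_square algebra_simps)
  then have "h + P * w \<le> sqrt ((h\<^sup>2 + w\<^sup>2) * (1 + P\<^sup>2))" by (rule real_le_rsqrt)
  then show ?thesis using pos by (simp add: real_sqrt_mult pos_divide_le_eq)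
qed

section \<open>The zero set in a box with steep columns\<close>

text \<open>The situation in a small block that meets the level set, after subtracting the level and up to the
  symmetries of the square. The differentiability of the field enters only through these difference
  estimates; in particular \<open>slope\<close> says that all chords of the zero set have nearly the same slope \<open>P\<close>.
  The weak quasiconvexity of the rows shapes the graph, and the bound on \<open>row_zeros\<close> limits the isolated
  zeros outside the arcs.\<close>
locale steep_box =
  fixes f :: "real \<times> real \<Rightarrow> real" and x0 x1 y0 y1 c L P \<kappa> :: real
  assumes x01: "x0 \<le> x1" and y01: "y0 \<le> y1" and c0: "c > 0" and L0: "L \<ge> 0"
    and cont: "continuous_on ({x0..x1} \<times> {y0..y1}) f"
    and steep: "\<And>x y y'. x \<in> {x0..x1} \<Longrightarrow> y0 \<le> y \<Longrightarrow> y \<le> y' \<Longrightarrow> y' \<le> y1 \<Longrightarrow>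
        c * (y' - y) \<le> f (x, y') - f (x, y)"
    and lipx: "\<And>x x' y. x \<in> {x0..x1} \<Longrightarrow> x' \<in> {x0..x1} \<Longrightarrow> y \<in> {y0..y1} \<Longrightarrow>
        \<bar>f (x, y) - f (x', y)\<bar> \<le> L * \<bar>x - x'\<bar>"
    and quasiconvex: "\<And>x x' x'' y. x0 \<le> x \<Longrightarrow> x \<le> x' \<Longrightarrow> x' \<le> x'' \<Longrightarrow> x'' \<le> x1 \<Longrightarrow> y \<in> {y0..y1} \<Longrightarrow>
        f (x', y) \<le> max (f (x, y)) (f (x'', y))"
    and row_zeros: "\<And>y. y \<in> {y0..y1} \<Longrightarrow> finite {x\<in>{x0..x1}. f (x, y) = 0} \<and> card {x\<in>{x0..x1}. f (x, y) = 0} \<le> 2"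
    and slope: "\<And>x y x' y'. (x, y) \<in> {x0..x1} \<times> {y0..y1} \<Longrightarrow> (x', y') \<in> {x0..x1} \<times> {y0..y1} \<Longrightarrow>
        f (x, y) = 0 \<Longrightarrow> f (x', y') = 0 \<Longrightarrow> \<bar>(y' - y) - P * (x' - x)\<bar> \<le> \<kappa> * \<bar>x' - x\<bar>"
begin

text \<open>The zero of the column at \<open>x\<close>, clamped to the box: where the column has no zero, the value is the
  bottom or the top of the box according to the sign of \<open>f\<close>. In contrast to the zero set itself, whose
  projection may have several components, this graph is defined over the whole box.\<close>
definition \<psi> :: "real \<Rightarrow> real" where
  "\<psi> x = Sup (insert y0 {y\<in>{y0..y1}. f (x, y) \<le> 0})"

lemma bdd: "bdd_above (insert y0 {y\<in>{y0..y1}. f (x, y) \<le> 0})"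
  using y01 by (intro bdd_aboveI[of _ y1]) auto

lemma psi_range: "\<psi> x \<in> {y0..y1}"
  unfolding \<psi>_def using y01 by (auto intro!: cSup_upper bdd cSup_least)

lemma psi_ge: "y0 \<le> \<psi> x" and psi_le: "\<psi> x \<le> y1"
  using psi_range[of x] by auto

lemma neg_below_psi:
  assumes "x \<in> {x0..x1}" "y0 \<le> y" "y < \<psi> x" shows "f (x, y) < 0"
proof -
  obtain y' where "y' \<in> insert y0 {y\<in>{y0..y1}. f (x, y) \<le> 0}" "y < y'"
    using assms(3) unfolding \<psi>_def by (subst (asm) less_cSup_iff[OF _ bdd]) auto
  then have y': "y' \<le> y1" "f (x, y') \<le> 0" "y < y'" using assms(2) by auto
  then have "c * (y' - y) \<le> f (x, y') - f (x, y)" using assms by (intro steep) auto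
  moreover have "c * (y' - y) > 0" using y' c0 by simp
  ultimately show ?thesis using y' by simp
qed

lemma pos_above_psi:
  assumes "x \<in> {x0..x1}" "\<psi> x < y" "y \<le> y1" shows "0 < f (x, y)"
proof (rule ccontr)
  assume "\<not> 0 < f (x, y)"
  then have "y \<le> \<psi> x" unfolding \<psi>_def using assms psi_ge[of x] by (intro cSup_upper bdd) auto
  then show False using assms by simp
qed

lemma psi_eq: assumes "x \<in> {x0..x1}" "y \<in> {y0..y1}" "f (x, y) = 0" shows "\<psi> x = y"
  using neg_below_psi[of x y] pos_above_psi[of x y] assms by (cases y "\<psi> x" rule: linorder_cases) auto

lemma cont_col: "x \<in> {x0..x1} \<Longrightarrow> continuous_on {y0..y1} (\<lambda>y. f (x, y))"
  by (rule continuous_on_compose2[OF cont]) (auto intro!: continuous_intros)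

lemma zero_psi:
  assumes x: "x \<in> {x0..x1}" and "f (x, y0) \<le> 0" "0 \<le> f (x, y1)" shows "f (x, \<psi> x) = 0"
proof -
  obtain y where "y0 \<le> y" "y \<le> y1" "f (x, y) = 0"
    using IVT'[of "\<lambda>y. f (x, y)" y0 0 y1] assms y01 cont_col[OF x] by auto
  then show ?thesis using psi_eq[OF x, of y] by simp
qed

text \<open>If \<open>\<psi>\<close> rose faster than \<open>L / c\<close>, there would be heights just above \<open>\<psi> x\<close> and just below \<open>\<psi> x'\<close> at which
  the growth along the column exceeds what the change of column can compensate.\<close>
lemma psi_lip:
  assumes "x \<in> {x0..x1}" "x' \<in> {x0..x1}" shows "\<bar>\<psi> x' - \<psi> x\<bar> \<le> L / c * \<bar>x' - x\<bar>"
proof -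
  have *: "c * (\<psi> x' - \<psi> x) \<le> L * \<bar>x' - x\<bar>" if "x \<in> {x0..x1}" "x' \<in> {x0..x1}" for x x'
  proof (rule ccontr)
    assume H: "\<not> ?thesis"
    define d where "d = \<psi> x' - \<psi> x"
    have d: "c * d > L * \<bar>x' - x\<bar>" using H by (simp add: d_def)
    then have "c * d > 0" using L0 by (smt (verit) mult_nonneg_nonneg abs_ge_zero)
    then have d0: "d > 0" using c0 by (simp add: zero_less_mult_iff)
    \<comment> \<open>Half of the room that is left, so that the two heights still violate the bound.\<close>
    define \<tau> where "\<tau> = (d - L * \<bar>x' - x\<bar> / c) / 2"
    have t: "0 < \<tau>" "\<tau> \<le> d / 2" "c * (d - 2 * \<tau>) = L * \<bar>x' - x\<bar>"
      using d c0 L0 by (auto simp: \<tau>_def field_simps)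
    have b: "y0 \<le> \<psi> x" "\<psi> x' \<le> y1" using psi_ge psi_le by auto
    have 1: "0 < f (x, \<psi> x + \<tau>)" using that t d0 b by (intro pos_above_psi) (auto simp: d_def)
    have 2: "f (x', \<psi> x' - \<tau>) < 0" using that t d0 b by (intro neg_below_psi) (auto simp: d_def)
    have "c * ((\<psi> x' - \<tau>) - (\<psi> x + \<tau>)) \<le> f (x, \<psi> x' - \<tau>) - f (x, \<psi> x + \<tau>)"
      using that t d0 b by (intro steep) (auto simp: d_def)
    moreover have "\<bar>f (x, \<psi> x' - \<tau>) - f (x', \<psi> x' - \<tau>)\<bar> \<le> L * \<bar>x - x'\<bar>"
      using that t d0 b by (intro lipx) (auto simp: d_def)
    moreover have "c * ((\<psi> x' - \<tau>) - (\<psi> x + \<tau>)) = L * \<bar>x' - x\<bar>" using t(3) by (simp add: d_def algebra_simps)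
    ultimately show False using 1 2 by (simp add: abs_minus_commute)
  qed
  show ?thesis using *[OF assms] *[OF assms(2,1)] c0
    by (simp add: pos_le_divide_eq abs_le_iff abs_minus_commute[of x x'] mult.commute[of _ c])
qed

lemma psi_cont: "continuous_on {x0..x1} \<psi>"
proof -
  have "(L / c)-lipschitz_on {x0..x1} \<psi>"
    using psi_lip L0 c0 by (intro lipschitz_onI) (auto simp: dist_real_def abs_minus_commute)
  then show ?thesis by (rule lipschitz_on_continuous_on)
qed

lemma psi_quasiconcave:
  assumes "x0 \<le> x" "x \<le> x'" "x' \<le> x''" "x'' \<le> x1"
  shows "min (\<psi> x) (\<psi> x'') \<le> \<psi> x'"
proof (rule ccontr)
  assume H: "\<not> ?thesis"
  define y where "y = (\<psi> x' + min (\<psi> x) (\<psi> x'')) / 2"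
  have y: "\<psi> x' < y" "y < \<psi> x" "y < \<psi> x''" using H by (auto simp: y_def)
  then have "y0 \<le> y" "y \<le> y1" using psi_ge[of x'] psi_le[of x] by linarith+
  moreover from this have "0 < f (x', y)" "f (x, y) < 0" "f (x'', y) < 0"
    using y assms by (auto intro!: neg_below_psi pos_above_psi)
  ultimately show False using quasiconvex[of x x' x'' y] assms by auto
qed

text \<open>Strictly inside the box the clamped graph consists of zeros; continuity adds the end points.\<close>
lemma arc_zero:
  assumes "x0 \<le> \<alpha>" "\<alpha> < \<beta>" "\<beta> \<le> x1" "\<And>x. \<alpha> < x \<Longrightarrow> x < \<beta> \<Longrightarrow> y0 < \<psi> x \<and> \<psi> x < y1" "x \<in> {\<alpha>..\<beta>}"
  shows "f (x, \<psi> x) = 0"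
proof -
  have "continuous_on {\<alpha>..\<beta>} (\<lambda>x. f (x, \<psi> x))"
    using assms(1-3) psi_range
    by (intro continuous_on_compose2[OF cont] continuous_on_Pair continuous_on_id continuous_on_subset[OF psi_cont]) auto
  then have "continuous_on (closure {\<alpha><..<\<beta>}) (\<lambda>x. f (x, \<psi> x))" using assms(2) by simp
  moreover have "f (z, \<psi> z) = 0" if "z \<in> {\<alpha><..<\<beta>}" for z
    using that assms(1-4) y01
    by (intro zero_psi) (auto intro!: less_imp_le neg_below_psi pos_above_psi)
  ultimately show ?thesis
    using continuous_constant_on_closure[of "{\<alpha><..<\<beta>}" "\<lambda>x. f (x, \<psi> x)" 0 x] assms(2,5) by auto
qed

lemma arc_slope:
  assumes "x0 \<le> \<alpha>" "\<alpha> \<le> \<beta>" "\<beta> \<le> x1" "\<And>x. \<alpha> < x \<Longrightarrow> x < \<beta> \<Longrightarrow> y0 < \<psi> x \<and> \<psi> x < y1"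
    and "\<alpha> \<le> x" "x \<le> x'" "x' \<le> \<beta>"
  shows "\<bar>(\<psi> x' - \<psi> x) - P * (x' - x)\<bar> \<le> \<kappa> * (x' - x)"
proof (cases "x = x'")
  case False
  then have "f (x, \<psi> x) = 0" "f (x', \<psi> x') = 0" using assms by (auto intro!: arc_zero[of \<alpha> \<beta>])
  then show ?thesis using slope[of x "\<psi> x" x' "\<psi> x'"] assms psi_range by auto
qed auto

text \<open>The projection to the direction of slope \<open>P\<close>, corrected by the quadratic error term, dominates all
  chords by \<open>chord_le_projection\<close>, so it serves as the arc length bound in \<open>hausdorff1_curve_le\<close>. Its
  total increment is at most the chord of the whole arc plus the accumulated error.\<close>
lemma arc_hausdorff1_le:
  assumes "x0 \<le> \<alpha>" "\<alpha> \<le> \<beta>" "\<beta> \<le> x1" "\<And>x. \<alpha> < x \<Longrightarrow> x < \<beta> \<Longrightarrow> y0 < \<psi> x \<and> \<psi> x < y1"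
  shows "hausdorff1 ((\<lambda>x. (x, \<psi> x)) ` {\<alpha>..\<beta>})
     \<le> ennreal (sqrt ((\<beta> - \<alpha>)\<^sup>2 + (\<psi> \<beta> - \<psi> \<alpha>)\<^sup>2) + \<kappa>\<^sup>2 / 2 * (\<beta> - \<alpha>))"
proof -
  define S where "S = (\<lambda>x. (x + P * \<psi> x) / sqrt (1 + P\<^sup>2) + \<kappa>\<^sup>2 / 2 * x)"
  have S: "S x' - S x = ((x' - x) + P * (\<psi> x' - \<psi> x)) / sqrt (1 + P\<^sup>2) + \<kappa>\<^sup>2 / 2 * (x' - x)" for x x'
    by (simp add: S_def algebra_simps add_divide_distrib diff_divide_distrib)
  have "hausdorff1 ((\<lambda>x. (x, \<psi> x)) ` {\<alpha>..\<beta>}) \<le> ennreal (S \<beta> - S \<alpha>)"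
  proof (rule hausdorff1_curve_le[OF assms(2)])
    fix x x' assume x: "\<alpha> \<le> x" "x \<le> x'" "x' \<le> \<beta>"
    have "dist (x, \<psi> x) (x', \<psi> x') = sqrt ((x' - x)\<^sup>2 + (\<psi> x' - \<psi> x)\<^sup>2)"
      by (simp add: dist_Pair_Pair dist_real_def power2_commute)
    also have "\<dots> \<le> S x' - S x" unfolding S
      by (rule chord_le_projection) (use x arc_slope[OF assms x] in auto)
    finally show "dist (x, \<psi> x) (x', \<psi> x') \<le> S x' - S x" .
    have r: "1 \<le> sqrt (1 + P\<^sup>2)" by simp
    have "((x' - x) + P * (\<psi> x' - \<psi> x)) / sqrt (1 + P\<^sup>2) \<le> sqrt ((x' - x)\<^sup>2 + (\<psi> x' - \<psi> x)\<^sup>2)"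
      by (rule projection_le_chord)
    also have "\<dots> \<le> \<bar>x' - x\<bar> + \<bar>\<psi> x' - \<psi> x\<bar>" by (rule sqrt_sum_squares_le_sum_abs)
    also have "\<dots> \<le> (x' - x) + L / c * (x' - x)" using psi_lip[of x x'] x assms by auto
    finally show "S x' - S x \<le> (1 + L / c + \<kappa>\<^sup>2 / 2) * (x' - x)"
      unfolding S by (simp add: algebra_simps)
  qed
  also have "\<dots> \<le> ennreal (sqrt ((\<beta> - \<alpha>)\<^sup>2 + (\<psi> \<beta> - \<psi> \<alpha>)\<^sup>2) + \<kappa>\<^sup>2 / 2 * (\<beta> - \<alpha>))"
    unfolding S using projection_le_chord by (intro ennreal_leI add_right_mono)
  finally show ?thesis .
qed

text \<open>An arc may begin and end on the boundary of the box, but it stays inside in between. Cutting off short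
  pieces at both ends leaves a compact connected set in the open box whose end points are almost as far
  apart as those of the arc.\<close>
lemma arc_compact_part:
  assumes "x0 \<le> \<alpha>" "\<alpha> \<le> \<beta>" "\<beta> \<le> x1" "\<And>x. \<alpha> < x \<Longrightarrow> x < \<beta> \<Longrightarrow> y0 < \<psi> x \<and> \<psi> x < y1" "e > 0"
  shows "\<exists>K. compact K \<and> K \<subseteq> {\<alpha><..<\<beta>} \<times> {y0<..<y1} \<and> (\<forall>s\<in>K. f s = 0) \<and>
     ennreal (sqrt ((\<beta> - \<alpha>)\<^sup>2 + (\<psi> \<beta> - \<psi> \<alpha>)\<^sup>2) - e) \<le> hausdorff1 K"
proof (cases "\<alpha> = \<beta>")
  case True
  then show ?thesis using assms by (intro exI[of _ "{}"]) (auto simp: ennreal_neg)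
next
  case False
  define \<Lambda> where "\<Lambda> = 1 + L / c"
  have L1: "\<Lambda> > 0" using c0 L0 by (simp add: \<Lambda>_def add_pos_nonneg)
  define \<tau> where "\<tau> = min ((\<beta> - \<alpha>) / 3) (e / (2 * \<Lambda>))"
  have t: "0 < \<tau>" "2 * \<tau> < \<beta> - \<alpha>" "2 * \<Lambda> * \<tau> \<le> e"
    using False assms L1 by (auto simp: \<tau>_def min_def field_simps)
  define \<gamma> where "\<gamma> = (\<lambda>x. (x, \<psi> x))"
  define K where "K = \<gamma> ` {\<alpha> + \<tau>..\<beta> - \<tau>}"
  have cg: "continuous_on {\<alpha> + \<tau>..\<beta> - \<tau>} \<gamma>" unfolding \<gamma>_def
    using assms t by (intro continuous_on_Pair continuous_on_id continuous_on_subset[OF psi_cont]) auto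
  have lip: "dist (\<gamma> x) (\<gamma> x') \<le> \<Lambda> * \<bar>x' - x\<bar>" if "x \<in> {x0..x1}" "x' \<in> {x0..x1}" for x x'
  proof -
    have "dist (\<gamma> x) (\<gamma> x') \<le> \<bar>x' - x\<bar> + \<bar>\<psi> x' - \<psi> x\<bar>"
      unfolding \<gamma>_def dist_Pair_Pair dist_real_def
      using sqrt_sum_squares_le_sum_abs[of "\<bar>x - x'\<bar>" "\<bar>\<psi> x - \<psi> x'\<bar>"] by (simp add: abs_minus_commute)
    then show ?thesis using psi_lip[OF that] by (simp add: \<Lambda>_def algebra_simps)
  qed
  have "dist (\<gamma> \<alpha>) (\<gamma> \<beta>) \<le> dist (\<gamma> \<alpha>) (\<gamma> (\<alpha> + \<tau>)) + dist (\<gamma> (\<alpha> + \<tau>)) (\<gamma> (\<beta> - \<tau>)) + dist (\<gamma> (\<beta> - \<tau>)) (\<gamma> \<beta>)"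
    by (smt (verit) dist_triangle)
  moreover have "dist (\<gamma> \<alpha>) (\<gamma> (\<alpha> + \<tau>)) \<le> \<Lambda> * \<tau>" "dist (\<gamma> (\<beta> - \<tau>)) (\<gamma> \<beta>) \<le> \<Lambda> * \<tau>"
    using lip[of \<alpha> "\<alpha> + \<tau>"] lip[of "\<beta> - \<tau>" \<beta>] assms t by auto
  moreover have "dist (\<gamma> \<alpha>) (\<gamma> \<beta>) = sqrt ((\<beta> - \<alpha>)\<^sup>2 + (\<psi> \<beta> - \<psi> \<alpha>)\<^sup>2)"
    by (simp add: \<gamma>_def dist_Pair_Pair dist_real_def power2_commute)
  ultimately have "ennreal (sqrt ((\<beta> - \<alpha>)\<^sup>2 + (\<psi> \<beta> - \<psi> \<alpha>)\<^sup>2) - e) \<le> ennreal (dist (\<gamma> (\<alpha> + \<tau>)) (\<gamma> (\<beta> - \<tau>)))"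
    using t by (intro ennreal_leI) auto
  also have "\<dots> \<le> hausdorff1 K" unfolding K_def
    by (intro hausdorff1_connected_ge_dist connected_continuous_image cg) (use t in auto)
  finally have "ennreal (sqrt ((\<beta> - \<alpha>)\<^sup>2 + (\<psi> \<beta> - \<psi> \<alpha>)\<^sup>2) - e) \<le> hausdorff1 K" .
  moreover have "compact K" unfolding K_def by (intro compact_continuous_image cg) simp
  moreover have "K \<subseteq> {\<alpha><..<\<beta>} \<times> {y0<..<y1}" using assms(4) t by (auto simp: K_def \<gamma>_def)
  moreover have "\<forall>s\<in>K. f s = 0"
    using arc_zero[of \<alpha> \<beta>] assms t by (auto simp: K_def \<gamma>_def)
  ultimately show ?thesis by blast
qed

text \<open>On an interval on which the clamped graph is monotone, the arc is what lies between the last point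
  with the initial value and the first point with the final value. Outside of it the graph is constant,
  which covers both the clamped parts and possible isolated zeros.\<close>
lemma monotone_arc:
  assumes pq: "x0 \<le> p" "p \<le> q" "q \<le> x1"
    and mono: "(\<forall>x x'. p \<le> x \<longrightarrow> x \<le> x' \<longrightarrow> x' \<le> q \<longrightarrow> \<psi> x \<le> \<psi> x') \<or> (\<forall>x x'. p \<le> x \<longrightarrow> x \<le> x' \<longrightarrow> x' \<le> q \<longrightarrow> \<psi> x' \<le> \<psi> x)"
  obtains \<alpha> \<beta> where "p \<le> \<alpha>" "\<alpha> \<le> \<beta>" "\<beta> \<le> q" "\<psi> \<alpha> = \<psi> p" "\<psi> \<beta> = \<psi> q"
    "\<And>x. \<alpha> < x \<Longrightarrow> x < \<beta> \<Longrightarrow> y0 < \<psi> x \<and> \<psi> x < y1"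
    "\<And>x. p \<le> x \<Longrightarrow> x \<le> q \<Longrightarrow> x \<notin> {\<alpha>..\<beta>} \<Longrightarrow> \<psi> x = \<psi> p \<or> \<psi> x = \<psi> q"
proof -
  have cont': "continuous_on {a..b} \<psi>" if "p \<le> a" "b \<le> q" for a b
    using that pq by (intro continuous_on_subset[OF psi_cont]) auto
  have "compact {x\<in>{p..q}. \<psi> x = \<psi> p}"
    by (intro compact_eq_bounded_closed[THEN iffD2] conjI continuous_closed_preimage_constant cont'
        bounded_subset[OF bounded_closed_interval[of p q]]) (use pq in auto)
  then obtain \<alpha> where a: "\<alpha> \<in> {p..q}" "\<psi> \<alpha> = \<psi> p" "\<And>x. x \<in> {p..q} \<Longrightarrow> \<psi> x = \<psi> p \<Longrightarrow> x \<le> \<alpha>"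
    using compact_attains_sup[of "{x\<in>{p..q}. \<psi> x = \<psi> p}"] pq by auto
  have "compact {x\<in>{\<alpha>..q}. \<psi> x = \<psi> q}"
    by (intro compact_eq_bounded_closed[THEN iffD2] conjI continuous_closed_preimage_constant cont'
        bounded_subset[OF bounded_closed_interval[of \<alpha> q]]) (use a pq in auto)
  then obtain \<beta> where b: "\<beta> \<in> {\<alpha>..q}" "\<psi> \<beta> = \<psi> q" "\<And>x. x \<in> {\<alpha>..q} \<Longrightarrow> \<psi> x = \<psi> q \<Longrightarrow> \<beta> \<le> x"
    using compact_attains_inf[of "{x\<in>{\<alpha>..q}. \<psi> x = \<psi> q}"] pq a by auto
  show thesis
  proof (rule that[of \<alpha> \<beta>])
    fix x assume x: "\<alpha> < x" "x < \<beta>"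
    have "\<psi> x \<noteq> \<psi> p" "\<psi> x \<noteq> \<psi> q" using a(3)[of x] b(3)[of x] x a(1) b(1) by auto
    moreover have "(\<psi> p \<le> \<psi> x \<and> \<psi> x \<le> \<psi> q) \<or> (\<psi> q \<le> \<psi> x \<and> \<psi> x \<le> \<psi> p)" 
      using mono
    proof (elim disjE)
      assume M: "\<forall>x x'. p \<le> x \<longrightarrow> x \<le> x' \<longrightarrow> x' \<le> q \<longrightarrow> \<psi> x \<le> \<psi> x'"
      then show ?thesis using M[rule_format, of p x] M[rule_format, of x q] x a(1) b(1) by auto
    next
      assume M: "\<forall>x x'. p \<le> x \<longrightarrow> x \<le> x' \<longrightarrow> x' \<le> q \<longrightarrow> \<psi> x' \<le> \<psi> x"
      then show ?thesis using M[rule_format, of p x] M[rule_format, of x q] x a(1) b(1) by auto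
    qed
    ultimately show "y0 < \<psi> x \<and> \<psi> x < y1"
      using psi_ge[of p] psi_le[of p] psi_ge[of q] psi_le[of q] by auto
  next
    fix x assume x: "p \<le> x" "x \<le> q" "x \<notin> {\<alpha>..\<beta>}"
    then consider "x \<le> \<alpha>" | "\<beta> \<le> x" by fastforce
    then show "\<psi> x = \<psi> p \<or> \<psi> x = \<psi> q"
    proof cases
      case 1
      then have "\<psi> x = \<psi> p" using mono
      proof (elim disjE)
        assume M: "\<forall>x x'. p \<le> x \<longrightarrow> x \<le> x' \<longrightarrow> x' \<le> q \<longrightarrow> \<psi> x \<le> \<psi> x'"
        then show ?thesis using M[rule_format, of p x] M[rule_format, of x \<alpha>] 1 x(1,2) a(1,2) by (intro antisym) auto
      next
        assume M: "\<forall>x x'. p \<le> x \<longrightarrow> x \<le> x' \<longrightarrow> x' \<le> q \<longrightarrow> \<psi> x' \<le> \<psi> x"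
        then show ?thesis using M[rule_format, of p x] M[rule_format, of x \<alpha>] 1 x(1,2) a(1,2) by (intro antisym) auto
      qed
      then show ?thesis ..
    next
      case 2
      then have "\<psi> x = \<psi> q" using mono
      proof (elim disjE)
        assume M: "\<forall>x x'. p \<le> x \<longrightarrow> x \<le> x' \<longrightarrow> x' \<le> q \<longrightarrow> \<psi> x \<le> \<psi> x'"
        then show ?thesis using M[rule_format, of \<beta> x] M[rule_format, of x q] 2 x(1,2) a(1) b(1,2) by (intro antisym) auto
      next
        assume M: "\<forall>x x'. p \<le> x \<longrightarrow> x \<le> x' \<longrightarrow> x' \<le> q \<longrightarrow> \<psi> x' \<le> \<psi> x"
        then show ?thesis using M[rule_format, of \<beta> x] M[rule_format, of x q] 2 x(1,2) a(1) b(1,2) by (intro antisym) auto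
      qed
      then show ?thesis ..
    qed
  qed (use a b in auto)
qed

text \<open>A quasiconcave function increases up to any of its maximum points and decreases afterwards.\<close>
lemma psi_argmax:
  obtains z where "z \<in> {x0..x1}" "\<And>x. x \<in> {x0..x1} \<Longrightarrow> \<psi> x \<le> \<psi> z"
    "\<And>x x'. x0 \<le> x \<Longrightarrow> x \<le> x' \<Longrightarrow> x' \<le> z \<Longrightarrow> \<psi> x \<le> \<psi> x'"
    "\<And>x x'. z \<le> x \<Longrightarrow> x \<le> x' \<Longrightarrow> x' \<le> x1 \<Longrightarrow> \<psi> x' \<le> \<psi> x"
proof -
  obtain z where z: "z \<in> {x0..x1}" "\<And>x. x \<in> {x0..x1} \<Longrightarrow> \<psi> x \<le> \<psi> z"
    using continuous_attains_sup[OF compact_Icc _ psi_cont] x01 by auto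
  show thesis
  proof (rule that[OF z])
    show "\<psi> x \<le> \<psi> x'" if "x0 \<le> x" "x \<le> x'" "x' \<le> z" for x x'
      using psi_quasiconcave[of x x' z] z(2)[of x] z(1) that by auto
    show "\<psi> x' \<le> \<psi> x" if "z \<le> x" "x \<le> x'" "x' \<le> x1" for x x'
      using psi_quasiconcave[of z x x'] z(2)[of x'] z(1) that by auto
  qed
qed

end

section \<open>The estimate for a single box\<close>

text \<open>The excursion set is sampled by the indicator of \<open>f \<ge> u\<close>. Negating the field turns it into the
  indicator of \<open>f > u\<close>, so the estimate is formulated for both conventions at once: the value at zero is
  left open.\<close>
definition threshold :: "(real \<Rightarrow> real) \<Rightarrow> bool" where
  "threshold \<theta> \<longleftrightarrow> mono \<theta> \<and> (\<forall>v. \<theta> v \<in> {0, 1}) \<and> (\<forall>v>0. \<theta> v = 1) \<and> (\<forall>v<0. \<theta> v = 0)"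

lemma threshold_monoD: "threshold \<theta> \<Longrightarrow> a \<le> b \<Longrightarrow> \<theta> a \<le> \<theta> b"
  and threshold_bin: "threshold \<theta> \<Longrightarrow> \<theta> v = 0 \<or> \<theta> v = 1"
  and threshold_pos: "threshold \<theta> \<Longrightarrow> 0 < v \<Longrightarrow> \<theta> v = 1"
  and threshold_neg: "threshold \<theta> \<Longrightarrow> v < 0 \<Longrightarrow> \<theta> v = 0"
  by (auto simp: threshold_def mono_def)

lemma threshold_0D: "threshold \<theta> \<Longrightarrow> \<theta> v = 0 \<Longrightarrow> v \<le> 0"
  and threshold_1D: "threshold \<theta> \<Longrightarrow> \<theta> v = 1 \<Longrightarrow> 0 \<le> v"
  using threshold_pos[of \<theta> v] threshold_neg[of \<theta> v] by fastforce+

definition sample :: "(real \<Rightarrow> real) \<Rightarrow> (real \<times> real \<Rightarrow> real) \<Rightarrow> real \<Rightarrow> real \<Rightarrow> real \<Rightarrow> nat \<Rightarrow> nat \<Rightarrow> real" where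
  "sample \<theta> f x0 y0 \<epsilon> i j = \<theta> (f (x0 + real i * \<epsilon>, y0 + real j * \<epsilon>))"

definition column_changes :: "(nat \<Rightarrow> nat \<Rightarrow> real) \<Rightarrow> nat \<Rightarrow> nat \<Rightarrow> real" where
  "column_changes Z k i = (\<Sum>j<k. \<bar>Z i j - Z i (Suc j)\<bar>)"

definition row_changes :: "(nat \<Rightarrow> nat \<Rightarrow> real) \<Rightarrow> nat \<Rightarrow> nat \<Rightarrow> real" where
  "row_changes Z n j = (\<Sum>i<n. \<bar>Z i j - Z (Suc i) j\<bar>)"

abbreviation change_norm :: "(nat \<Rightarrow> nat \<Rightarrow> real) \<Rightarrow> nat \<Rightarrow> nat \<Rightarrow> real" where
  "change_norm Z n k \<equiv> norm (\<Sum>i\<le>n. column_changes Z k i, \<Sum>j\<le>k. row_changes Z n j)"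

abbreviation few_changes :: "(nat \<Rightarrow> nat \<Rightarrow> real) \<Rightarrow> nat \<Rightarrow> nat \<Rightarrow> bool" where
  "few_changes Z n k \<equiv> (\<forall>i\<le>n. column_changes Z k i \<le> 2) \<and> (\<forall>j\<le>k. row_changes Z n j \<le> 2)"

definition grid_box :: "real \<Rightarrow> real \<Rightarrow> nat \<Rightarrow> nat \<Rightarrow> real \<Rightarrow> (real \<times> real) set" where
  "grid_box x0 y0 n k \<epsilon> = {x0..x0 + real n * \<epsilon>} \<times> {y0..y0 + real k * \<epsilon>}"

definition open_grid_box :: "real \<Rightarrow> real \<Rightarrow> nat \<Rightarrow> nat \<Rightarrow> real \<Rightarrow> (real \<times> real) set" where
  "open_grid_box x0 y0 n k \<epsilon> = {x0<..<x0 + real n * \<epsilon>} \<times> {y0<..<y0 + real k * \<epsilon>}"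

text \<open>The number \<open>len\<close> is an approximate length of the zero set in the box, to which both the measure and
  the grid count are compared. The measure is bounded from below through compact parts in the open box,
  because those of different boxes are disjoint. The counts extend over all rows and columns of the box
  including its last ones, which makes the notion symmetric under reflections; the bound on the changes
  in a single row or column pays for the difference to the half-open ranges of the estimator.\<close>
definition box_estimate :: "(real \<times> real \<Rightarrow> real) \<Rightarrow> real \<Rightarrow> real \<Rightarrow> nat \<Rightarrow> nat \<Rightarrow> real \<Rightarrow> real \<Rightarrow> bool" where
  "box_estimate f x0 y0 n k \<epsilon> \<eta> \<longleftrightarrow> (\<exists>len\<ge>0.
     hausdorff1 {s\<in>grid_box x0 y0 n k \<epsilon>. f s = 0} \<le> ennreal (len + \<eta>) \<and>
     (\<forall>e>0. \<exists>K. compact K \<and> K \<subseteq> {s\<in>open_grid_box x0 y0 n k \<epsilon>. f s = 0} \<and> ennreal (len - e) \<le> hausdorff1 K) \<and>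
     (\<forall>\<theta>. threshold \<theta> \<longrightarrow>
        few_changes (sample \<theta> f x0 y0 \<epsilon>) n k \<and>
        \<bar>\<epsilon> * change_norm (sample \<theta> f x0 y0 \<epsilon>) n k - len\<bar> \<le> \<eta>))"

lemma norm_Pair_diff_le: "\<bar>norm (a, b) - norm (a', b')\<bar> \<le> \<bar>a - a'\<bar> + \<bar>b - b' :: real\<bar>" for a a' :: real
proof -
  have "\<bar>norm (a, b) - norm (a', b')\<bar> \<le> norm ((a, b) - (a', b'))" by (rule norm_triangle_ineq3)
  also have "\<dots> \<le> \<bar>a - a'\<bar> + \<bar>b - b'\<bar>"
    using norm_Pair_le[of "a - a'" "b - b'"] by simp
  finally show ?thesis .
qed

lemma abs_diff_scale:
  fixes \<epsilon> :: real
  assumes "\<epsilon> > 0" "\<bar>H - a / \<epsilon>\<bar> \<le> b" shows "\<bar>\<epsilon> * H - a\<bar> \<le> \<epsilon> * b"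
proof -
  have "\<epsilon> * H - a = \<epsilon> * (H - a / \<epsilon>)" using assms(1) by (simp add: right_diff_distrib)
  then show ?thesis using assms by (simp add: abs_mult)
qed

lemma ennreal_add_le: "ennreal (a + b) \<le> ennreal a + ennreal b"
proof -
  have "ennreal (a + b) \<le> ennreal (max 0 a + max 0 b)" by (intro ennreal_leI) auto
  also have "\<dots> = ennreal a + ennreal b" by (subst ennreal_plus) auto
  finally show ?thesis .
qed

text \<open>Outside the two arcs the graph takes one of only three values, and each row contains at most two zeros.
  This leaves at most six isolated zeros.\<close>
lemma (in steep_box) box_zero_set:
  assumes z: "z \<in> {x0..x1}" "\<And>x x'. x0 \<le> x \<Longrightarrow> x \<le> x' \<Longrightarrow> x' \<le> z \<Longrightarrow> \<psi> x \<le> \<psi> x'"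
    "\<And>x x'. z \<le> x \<Longrightarrow> x \<le> x' \<Longrightarrow> x' \<le> x1 \<Longrightarrow> \<psi> x' \<le> \<psi> x"
  obtains \<alpha> \<beta> \<alpha>' \<beta>' F where "x0 \<le> \<alpha>" "\<alpha> \<le> \<beta>" "\<beta> \<le> \<alpha>'" "\<alpha>' \<le> \<beta>'" "\<beta>' \<le> x1"
    "\<psi> \<alpha> = \<psi> x0" "\<psi> \<beta> = \<psi> z" "\<psi> \<alpha>' = \<psi> z" "\<psi> \<beta>' = \<psi> x1"
    "\<And>x. \<alpha> < x \<Longrightarrow> x < \<beta> \<Longrightarrow> y0 < \<psi> x \<and> \<psi> x < y1"
    "\<And>x. \<alpha>' < x \<Longrightarrow> x < \<beta>' \<Longrightarrow> y0 < \<psi> x \<and> \<psi> x < y1"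
    "finite F" "card F \<le> 6"
    "\<And>x y. (x, y) \<in> {x0..x1} \<times> {y0..y1} \<Longrightarrow> f (x, y) = 0 \<Longrightarrow> y = \<psi> x \<and> x \<in> {\<alpha>..\<beta>} \<union> {\<alpha>'..\<beta>'} \<union> F"
proof -
  have m: "(\<forall>x x'. x0 \<le> x \<longrightarrow> x \<le> x' \<longrightarrow> x' \<le> z \<longrightarrow> \<psi> x \<le> \<psi> x') \<or> (\<forall>x x'. x0 \<le> x \<longrightarrow> x \<le> x' \<longrightarrow> x' \<le> z \<longrightarrow> \<psi> x' \<le> \<psi> x)"
      "(\<forall>x x'. z \<le> x \<longrightarrow> x \<le> x' \<longrightarrow> x' \<le> x1 \<longrightarrow> \<psi> x \<le> \<psi> x') \<or> (\<forall>x x'. z \<le> x \<longrightarrow> x \<le> x' \<longrightarrow> x' \<le> x1 \<longrightarrow> \<psi> x' \<le> \<psi> x)"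
      and zz: "x0 \<le> z" "z \<le> x1"
    using z by auto
  obtain \<alpha> \<beta> where A: "x0 \<le> \<alpha>" "\<alpha> \<le> \<beta>" "\<beta> \<le> z" "\<psi> \<alpha> = \<psi> x0" "\<psi> \<beta> = \<psi> z"
    "\<And>x. \<alpha> < x \<Longrightarrow> x < \<beta> \<Longrightarrow> y0 < \<psi> x \<and> \<psi> x < y1"
    "\<And>x. x0 \<le> x \<Longrightarrow> x \<le> z \<Longrightarrow> x \<notin> {\<alpha>..\<beta>} \<Longrightarrow> \<psi> x = \<psi> x0 \<or> \<psi> x = \<psi> z"
    by (rule monotone_arc[OF order_refl zz m(1)]) (rule that, blast+)
  obtain \<alpha>' \<beta>' where B: "z \<le> \<alpha>'" "\<alpha>' \<le> \<beta>'" "\<beta>' \<le> x1" "\<psi> \<alpha>' = \<psi> z" "\<psi> \<beta>' = \<psi> x1"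
    "\<And>x. \<alpha>' < x \<Longrightarrow> x < \<beta>' \<Longrightarrow> y0 < \<psi> x \<and> \<psi> x < y1"
    "\<And>x. z \<le> x \<Longrightarrow> x \<le> x1 \<Longrightarrow> x \<notin> {\<alpha>'..\<beta>'} \<Longrightarrow> \<psi> x = \<psi> z \<or> \<psi> x = \<psi> x1"
    by (rule monotone_arc[OF zz order_refl m(2)]) (rule that, blast+)
  define R where "R = (\<lambda>y. {x\<in>{x0..x1}. f (x, y) = 0})"
  define F where "F = R (\<psi> x0) \<union> R (\<psi> z) \<union> R (\<psi> x1)"
  have R: "finite (R (\<psi> x)) \<and> card (R (\<psi> x)) \<le> 2" for x
    unfolding R_def by (rule row_zeros[OF psi_range])
  have "card F \<le> card (R (\<psi> x0)) + card (R (\<psi> z)) + card (R (\<psi> x1))"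
    unfolding F_def by (meson card_Un_le add_mono_thms_linordered_semiring(3) order_trans)
  then have F: "finite F" "card F \<le> 6" using R[of x0] R[of z] R[of x1] by (auto simp: F_def)
  show thesis
  proof (rule that[OF A(1,2) order_trans[OF A(3) B(1)] B(2,3) A(4,5) B(4,5) A(6) B(6) F])
    fix x y assume xy: "(x, y) \<in> {x0..x1} \<times> {y0..y1}" "f (x, y) = 0"
    then have y: "\<psi> x = y" by (intro psi_eq) auto
    have "x \<in> F" if "\<psi> x = \<psi> x0 \<or> \<psi> x = \<psi> z \<or> \<psi> x = \<psi> x1"
      using that xy y by (auto simp: F_def R_def)
    then show "y = \<psi> x \<and> x \<in> {\<alpha>..\<beta>} \<union> {\<alpha>'..\<beta>'} \<union> F"
      using A(7)[of x] B(7)[of x] xy y by (cases "x \<le> z") auto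
  qed auto
qed

text \<open>With the notation of the proof, a column is counted if and only if it crosses one of the two arcs, up
  to the isolated zeros and the end points. In the row at height \<open>y\<close> there is a change on the left of the
  sampled zeros exactly if the left end of the row is sampled as one, that is, for \<open>y\<close> between \<open>\<psi> x0\<close> and
  the maximum of \<open>\<psi>\<close>; likewise on the right. The maximum over the sampled columns is smaller than the
  true one by at most \<open>L / c\<close> times the mesh.\<close>
lemma (in steep_box) steep_box_estimate:
  assumes e0: "\<epsilon> > 0" and x1: "x1 = x0 + real n * \<epsilon>" and y1: "y1 = y0 + real k * \<epsilon>"
  shows "box_estimate f x0 y0 n k \<epsilon> (\<epsilon> * (10 + 2 * L / c) + \<kappa>\<^sup>2 / 2 * (x1 - x0))"
proof -
  obtain z where z: "z \<in> {x0..x1}" "\<And>x. x \<in> {x0..x1} \<Longrightarrow> \<psi> x \<le> \<psi> z"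
    "\<And>x x'. x0 \<le> x \<Longrightarrow> x \<le> x' \<Longrightarrow> x' \<le> z \<Longrightarrow> \<psi> x \<le> \<psi> x'"
    "\<And>x x'. z \<le> x \<Longrightarrow> x \<le> x' \<Longrightarrow> x' \<le> x1 \<Longrightarrow> \<psi> x' \<le> \<psi> x"
    by (rule psi_argmax) (rule that, blast+)
  obtain \<alpha> \<beta> \<alpha>' \<beta>' F where A: "x0 \<le> \<alpha>" "\<alpha> \<le> \<beta>" "\<beta> \<le> \<alpha>'" "\<alpha>' \<le> \<beta>'" "\<beta>' \<le> x1"
    "\<psi> \<alpha> = \<psi> x0" "\<psi> \<beta> = \<psi> z" "\<psi> \<alpha>' = \<psi> z" "\<psi> \<beta>' = \<psi> x1"
    "\<And>x. \<alpha> < x \<Longrightarrow> x < \<beta> \<Longrightarrow> y0 < \<psi> x \<and> \<psi> x < y1"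
    "\<And>x. \<alpha>' < x \<Longrightarrow> x < \<beta>' \<Longrightarrow> y0 < \<psi> x \<and> \<psi> x < y1"
    and F: "finite F" "card F \<le> 6"
    and cover: "\<And>x y. (x, y) \<in> {x0..x1} \<times> {y0..y1} \<Longrightarrow> f (x, y) = 0 \<Longrightarrow> y = \<psi> x \<and> x \<in> {\<alpha>..\<beta>} \<union> {\<alpha>'..\<beta>'} \<union> F"
    by (rule box_zero_set[OF z(1,3,4)], assumption+, rule that, blast+)
  define h where "h = \<beta> - \<alpha>" define h' where "h' = \<beta>' - \<alpha>'"
  define v where "v = \<psi> z - \<psi> x0" define v' where "v' = \<psi> z - \<psi> x1"
  define len where "len = sqrt (h\<^sup>2 + v\<^sup>2) + sqrt (h'\<^sup>2 + v'\<^sup>2)"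
  have nn: "0 \<le> h" "0 \<le> h'" "0 \<le> v" "0 \<le> v'" and hh: "h + h' \<le> x1 - x0" and l0: "0 \<le> len"
    using A z x01 by (auto simp: h_def h'_def v_def v'_def len_def)
  have kk: "\<kappa>\<^sup>2 / 2 * h + \<kappa>\<^sup>2 / 2 * h' \<le> \<kappa>\<^sup>2 / 2 * (x1 - x0)"
    unfolding distrib_left[symmetric] by (intro mult_left_mono hh) simp
  have B: "grid_box x0 y0 n k \<epsilon> = {x0..x1} \<times> {y0..y1}" "open_grid_box x0 y0 n k \<epsilon> = {x0<..<x1} \<times> {y0<..<y1}"
    by (simp_all add: grid_box_def open_grid_box_def x1 y1)
  let ?G = "\<lambda>a b. (\<lambda>x. (x, \<psi> x)) ` {a..b}"
  have sq: "sqrt ((\<beta> - \<alpha>)\<^sup>2 + (\<psi> \<beta> - \<psi> \<alpha>)\<^sup>2) = sqrt (h\<^sup>2 + v\<^sup>2)"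
      "sqrt ((\<beta>' - \<alpha>')\<^sup>2 + (\<psi> \<beta>' - \<psi> \<alpha>')\<^sup>2) = sqrt (h'\<^sup>2 + v'\<^sup>2)"
    by (simp_all add: h_def h'_def v_def v'_def A power2_commute)
  have upper: "hausdorff1 {s\<in>grid_box x0 y0 n k \<epsilon>. f s = 0} \<le> ennreal (len + \<kappa>\<^sup>2 / 2 * (x1 - x0))"
  proof -
    have "{s\<in>grid_box x0 y0 n k \<epsilon>. f s = 0} \<subseteq> (?G \<alpha> \<beta> \<union> ?G \<alpha>' \<beta>') \<union> (\<lambda>x. (x, \<psi> x)) ` F"
      using cover unfolding B by fastforce
    then have "hausdorff1 {s\<in>grid_box x0 y0 n k \<epsilon>. f s = 0} \<le> hausdorff1 ((?G \<alpha> \<beta> \<union> ?G \<alpha>' \<beta>') \<union> (\<lambda>x. (x, \<psi> x)) ` F)"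
      by (rule hausdorff1_mono)
    also have "\<dots> \<le> hausdorff1 (?G \<alpha> \<beta> \<union> ?G \<alpha>' \<beta>') + hausdorff1 ((\<lambda>x. (x, \<psi> x)) ` F)" by (rule hausdorff1_Un)
    also have "\<dots> \<le> hausdorff1 (?G \<alpha> \<beta>) + hausdorff1 (?G \<alpha>' \<beta>')"
      using hausdorff1_Un F(1) by (simp add: hausdorff1_finite)
    also have "\<dots> \<le> ennreal (sqrt (h\<^sup>2 + v\<^sup>2) + \<kappa>\<^sup>2 / 2 * h) + ennreal (sqrt (h'\<^sup>2 + v'\<^sup>2) + \<kappa>\<^sup>2 / 2 * h')"
    proof (rule add_mono)
      have "hausdorff1 (?G \<alpha> \<beta>) \<le> ennreal (sqrt ((\<beta> - \<alpha>)\<^sup>2 + (\<psi> \<beta> - \<psi> \<alpha>)\<^sup>2) + \<kappa>\<^sup>2 / 2 * (\<beta> - \<alpha>))"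
        using A by (intro arc_hausdorff1_le) auto
      then show "hausdorff1 (?G \<alpha> \<beta>) \<le> ennreal (sqrt (h\<^sup>2 + v\<^sup>2) + \<kappa>\<^sup>2 / 2 * h)"
        unfolding sq unfolding h_def[symmetric] .
      have "hausdorff1 (?G \<alpha>' \<beta>') \<le> ennreal (sqrt ((\<beta>' - \<alpha>')\<^sup>2 + (\<psi> \<beta>' - \<psi> \<alpha>')\<^sup>2) + \<kappa>\<^sup>2 / 2 * (\<beta>' - \<alpha>'))"
        using A by (intro arc_hausdorff1_le) auto
      then show "hausdorff1 (?G \<alpha>' \<beta>') \<le> ennreal (sqrt (h'\<^sup>2 + v'\<^sup>2) + \<kappa>\<^sup>2 / 2 * h')"
        unfolding sq unfolding h'_def[symmetric] .
    qed
    also have "\<dots> = ennreal ((sqrt (h\<^sup>2 + v\<^sup>2) + \<kappa>\<^sup>2 / 2 * h) + (sqrt (h'\<^sup>2 + v'\<^sup>2) + \<kappa>\<^sup>2 / 2 * h'))"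
      using nn by (intro ennreal_plus[symmetric]) auto
    also have "\<dots> \<le> ennreal (len + \<kappa>\<^sup>2 / 2 * (x1 - x0))"
      using kk unfolding len_def by (intro ennreal_leI) linarith
    finally show ?thesis .
  qed
  have lower: "\<exists>K. compact K \<and> K \<subseteq> {s\<in>open_grid_box x0 y0 n k \<epsilon>. f s = 0} \<and> ennreal (len - e) \<le> hausdorff1 K" if "e > 0" for e
  proof -
    have exK: "\<exists>K. compact K \<and> K \<subseteq> {\<alpha><..<\<beta>} \<times> {y0<..<y1} \<and> (\<forall>s\<in>K. f s = 0) \<and> ennreal (sqrt (h\<^sup>2 + v\<^sup>2) - e / 2) \<le> hausdorff1 K"
      by (rule arc_compact_part[of \<alpha> \<beta> "e / 2", unfolded sq]) (use A that in auto)
    have exK': "\<exists>K. compact K \<and> K \<subseteq> {\<alpha>'<..<\<beta>'} \<times> {y0<..<y1} \<and> (\<forall>s\<in>K. f s = 0) \<and> ennreal (sqrt (h'\<^sup>2 + v'\<^sup>2) - e / 2) \<le> hausdorff1 K"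
      by (rule arc_compact_part[of \<alpha>' \<beta>' "e / 2", unfolded sq]) (use A that in auto)
    obtain K where K: "compact K" "K \<subseteq> {\<alpha><..<\<beta>} \<times> {y0<..<y1}" "\<forall>s\<in>K. f s = 0" "ennreal (sqrt (h\<^sup>2 + v\<^sup>2) - e / 2) \<le> hausdorff1 K"
      using exK by blast
    obtain K' where K': "compact K'" "K' \<subseteq> {\<alpha>'<..<\<beta>'} \<times> {y0<..<y1}" "\<forall>s\<in>K'. f s = 0" "ennreal (sqrt (h'\<^sup>2 + v'\<^sup>2) - e / 2) \<le> hausdorff1 K'"
      using exK' by blast
    have "ennreal (len - e) \<le> ennreal (sqrt (h\<^sup>2 + v\<^sup>2) - e / 2) + ennreal (sqrt (h'\<^sup>2 + v'\<^sup>2) - e / 2)"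
      using ennreal_add_le[of "sqrt (h\<^sup>2 + v\<^sup>2) - e / 2" "sqrt (h'\<^sup>2 + v'\<^sup>2) - e / 2"]
      by (simp add: len_def)
    also have "\<dots> \<le> hausdorff1 K + hausdorff1 K'" by (intro add_mono K K')
    also have "\<dots> \<le> hausdorff1 (K \<union> K')"
      using K(2) K'(2) A by (intro hausdorff1_disjoint_compact K K') fastforce
    finally have "ennreal (len - e) \<le> hausdorff1 (K \<union> K')" .
    moreover have "K \<union> K' \<subseteq> {s\<in>open_grid_box x0 y0 n k \<epsilon>. f s = 0}"
      using K(2,3) K'(2,3) A unfolding B by fastforce
    ultimately show ?thesis using K(1) K'(1) by (intro exI[of _ "K \<union> K'"]) (auto intro: compact_Un)
  qed
  have counts: "few_changes (sample \<theta> f x0 y0 \<epsilon>) n k \<and>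
        \<bar>\<epsilon> * change_norm (sample \<theta> f x0 y0 \<epsilon>) n k - len\<bar>
          \<le> \<epsilon> * (10 + 2 * L / c) + \<kappa>\<^sup>2 / 2 * (x1 - x0)" if th: "threshold \<theta>" for \<theta>
  proof -
    define X where "X = (\<lambda>i::nat. x0 + real i * \<epsilon>)"
    define Y where "Y = (\<lambda>j::nat. y0 + real j * \<epsilon>)"
    have X: "X i \<in> {x0..x1}" if "i \<le> n" for i using that e0 by (auto simp: X_def x1)
    have Y: "Y j \<in> {y0..y1}" if "j \<le> k" for j using that e0 by (auto simp: Y_def y1)
    have Xm: "X i \<le> X i'" if "i \<le> i'" for i i' using that e0 by (auto simp: X_def)
    have Ym: "Y i \<le> Y i'" if "i \<le> i'" for i i' using that e0 by (auto simp: Y_def)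
    have X0: "X 0 = x0" "X n = x1" and Y0: "Y 0 = y0" "Y k = y1" by (auto simp: X_def Y_def x1 y1)
    define Z where "Z = sample \<theta> f x0 y0 \<epsilon>"
    have Z: "Z i j = \<theta> (f (X i, Y j))" for i j by (simp add: Z_def sample_def X_def Y_def)
    have Zbin: "Z i j = 0 \<or> Z i j = 1" for i j unfolding Z using threshold_bin[OF th] .
    have Zcol: "Z i j \<le> Z i j'" if "i \<le> n" "j \<le> j'" "j' \<le> k" for i j j'
    proof -
      have "c * (Y j' - Y j) \<le> f (X i, Y j') - f (X i, Y j)"
        using X[of i] Y[of j] Y[of j'] Ym[of j j'] that by (intro steep) auto
      moreover have "0 \<le> c * (Y j' - Y j)" using c0 Ym[of j j'] that by simp
      ultimately show ?thesis unfolding Z by (intro threshold_monoD[OF th]) linarith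
    qed
    have col: "column_changes Z k i = (if Z i 0 = 0 \<and> Z i k = 1 then 1 else 0)" if "i \<le> n" for i
    proof -
      have "column_changes Z k i = Z i k - Z i 0"
        unfolding column_changes_def using that by (intro sum_changes_mono Zcol) auto
      then show ?thesis using Zbin[of i 0] Zbin[of i k] Zcol[of i 0 k] that by auto
    qed
    have row: "row_changes Z n j = (if \<exists>i\<le>n. Z i j = 0 then Z 0 j + Z n j else 0)" if "j \<le> k" for j
      unfolding row_changes_def
    proof (rule sum_changes_quasiconvex_binary)
      fix i l i' assume i: "i \<le> l" "l \<le> i'" "i' \<le> n"
      have "f (X l, Y j) \<le> max (f (X i, Y j)) (f (X i', Y j))"
        using i that X[of i] X[of i'] Xm[of i l] Xm[of l i'] Y[of j] by (intro quasiconvex) auto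
      then have "Z l j \<le> Z i j \<or> Z l j \<le> Z i' j"
        unfolding Z using threshold_monoD[OF th] by (metis le_max_iff_disj)
      then show "Z l j \<le> max (Z i j) (Z i' j)" by auto
    qed (use Zbin in auto)
    define C where "C = {i. i \<le> n \<and> Z i 0 = 0 \<and> Z i k = 1}"
    define D where "D = (\<lambda>m. {j. j \<le> k \<and> (\<exists>i\<le>n. Z i j = 0) \<and> Z m j = 1})"
    have fin: "finite C" "finite (D m)" for m by (auto simp: C_def D_def)
    have NC: "(\<Sum>i\<le>n. column_changes Z k i) = real (card C)"
    proof -
      have "(\<Sum>i\<le>n. column_changes Z k i) = (\<Sum>i\<in>{..n}. if i \<in> C then 1 else 0)"
        by (intro sum.cong) (auto simp: col C_def)
      also have "\<dots> = real (card C)" 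
        by (subst sum.If_cases) (auto simp: C_def intro!: arg_cong[where f = card])
      finally show ?thesis .
    qed
    have NR: "(\<Sum>j\<le>k. row_changes Z n j) = real (card (D 0)) + real (card (D n))"
    proof -
      have "(\<Sum>j\<le>k. row_changes Z n j) = (\<Sum>j\<in>{..k}. (if j \<in> D 0 then 1 else 0) + (if j \<in> D n then 1 else 0))"
      proof (intro sum.cong refl)
        fix j assume "j \<in> {..k}"
        then show "row_changes Z n j = (if j \<in> D 0 then 1 else 0) + (if j \<in> D n then 1 else 0)"
          using Zbin[of 0 j] Zbin[of n j] by (auto simp: row D_def)
      qed
      also have "\<dots> = real (card (D 0)) + real (card (D n))"
        by (subst sum.distrib, subst (1 2) sum.If_cases) (auto simp: D_def intro!: arg_cong2[where f = "(+)"] arg_cong[where f = card])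
      finally show ?thesis .
    qed
    \<comment> \<open>One extra grid point for each arc and six isolated zeros.\<close>
    have C_le: "real (card C) \<le> (h + h') / \<epsilon> + 8"
    proof -
      let ?I = "\<lambda>a b. {i. i \<le> n \<and> a \<le> x0 + real i * \<epsilon> \<and> x0 + real i * \<epsilon> \<le> b}"
      let ?F = "{i. i \<le> n \<and> X i \<in> F}"
      have "C \<subseteq> ?I \<alpha> \<beta> \<union> ?I \<alpha>' \<beta>' \<union> ?F"
      proof
        fix i assume "i \<in> C"
        then have i: "i \<le> n" "Z i 0 = 0" "Z i k = 1" by (auto simp: C_def)
        then have "f (X i, \<psi> (X i)) = 0"
          using threshold_0D[OF th] threshold_1D[OF th] X[of i] by (intro zero_psi) (auto simp: Z Y0)
        then show "i \<in> ?I \<alpha> \<beta> \<union> ?I \<alpha>' \<beta>' \<union> ?F"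
          using cover[of "X i" "\<psi> (X i)"] X[of i] psi_range[of "X i"] i by (auto simp: X_def)
      qed
      then have "card C \<le> card (?I \<alpha> \<beta> \<union> ?I \<alpha>' \<beta>' \<union> ?F)" by (intro card_mono) auto
      also have "\<dots> \<le> card (?I \<alpha> \<beta>) + card (?I \<alpha>' \<beta>') + card ?F"
        by (meson card_Un_le add_mono_thms_linordered_semiring(3) order_trans)
      finally have "real (card C) \<le> real (card (?I \<alpha> \<beta>)) + real (card (?I \<alpha>' \<beta>')) + real (card ?F)" by linarith
      moreover have "real (card (?I \<alpha> \<beta>)) \<le> h / \<epsilon> + 1" "real (card (?I \<alpha>' \<beta>')) \<le> h' / \<epsilon> + 1"
        unfolding h_def h'_def using A e0 by (auto intro!: card_grid_le)
      moreover have "card ?F \<le> card F"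
        using e0 by (intro card_inj_on_le[of X] F) (auto simp: inj_on_def X_def)
      ultimately show ?thesis using F(2) by (simp add: add_divide_distrib)
    qed
    have C_ge: "(h + h') / \<epsilon> - 2 \<le> real (card C)"
    proof -
      let ?J = "\<lambda>a b. {i. i \<le> n \<and> a < x0 + real i * \<epsilon> \<and> x0 + real i * \<epsilon> < b}"
      have "?J \<alpha> \<beta> \<union> ?J \<alpha>' \<beta>' \<subseteq> C"
      proof
        fix i assume "i \<in> ?J \<alpha> \<beta> \<union> ?J \<alpha>' \<beta>'"
        then have i: "i \<le> n" "y0 < \<psi> (X i)" "\<psi> (X i) < y1" using A(10,11) by (auto simp: X_def)
        then have "f (X i, y0) < 0" "0 < f (X i, y1)" using X[of i] y01 by (auto intro!: neg_below_psi pos_above_psi)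
        then show "i \<in> C" using i th by (auto simp: C_def Z Y0 threshold_pos threshold_neg)
      qed
      then have "card (?J \<alpha> \<beta> \<union> ?J \<alpha>' \<beta>') \<le> card C" by (intro card_mono fin)
      moreover have "card (?J \<alpha> \<beta> \<union> ?J \<alpha>' \<beta>') = card (?J \<alpha> \<beta>) + card (?J \<alpha>' \<beta>')"
        using A(3) by (intro card_Un_disjoint) auto
      moreover have "h / \<epsilon> - 1 \<le> real (card (?J \<alpha> \<beta>))" "h' / \<epsilon> - 1 \<le> real (card (?J \<alpha>' \<beta>'))"
        unfolding h_def h'_def using A e0 by (auto intro!: card_grid_ge simp: x1)
      ultimately show ?thesis by (simp add: add_divide_distrib)
    qed
    have D_le: "real (card (D m)) \<le> (\<psi> z - \<psi> (X m)) / \<epsilon> + 1" if m: "m \<le> n" for m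
    proof -
      have "D m \<subseteq> {j. j \<le> k \<and> \<psi> (X m) \<le> y0 + real j * \<epsilon> \<and> y0 + real j * \<epsilon> \<le> \<psi> z}"
      proof
        fix j assume "j \<in> D m"
        then obtain i where j: "j \<le> k" "i \<le> n" "Z i j = 0" "Z m j = 1" by (auto simp: D_def)
        have "Y j \<le> \<psi> (X i)"
          using pos_above_psi[of "X i" "Y j"] threshold_pos[OF th] j X[of i] Y[of j] by (force simp: Z)
        moreover have "\<psi> (X m) \<le> Y j"
          using neg_below_psi[of "X m" "Y j"] threshold_neg[OF th] j X[of m] m Y[of j] by (force simp: Z)
        ultimately show "j \<in> {j. j \<le> k \<and> \<psi> (X m) \<le> y0 + real j * \<epsilon> \<and> y0 + real j * \<epsilon> \<le> \<psi> z}"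
          using z(2)[OF X[OF j(2)]] j(1) by (auto simp: Y_def)
      qed
      then have "card (D m) \<le> card {j. j \<le> k \<and> \<psi> (X m) \<le> y0 + real j * \<epsilon> \<and> y0 + real j * \<epsilon> \<le> \<psi> z}"
        by (intro card_mono) auto
      also have "real \<dots> \<le> (\<psi> z - \<psi> (X m)) / \<epsilon> + 1"
        using e0 psi_ge[of "X m"] z(2)[OF X[OF m]] by (intro card_grid_le) auto
      finally show ?thesis by simp
    qed
    have D_ge: "(\<psi> z - \<psi> (X m)) / \<epsilon> - L / c - 1 \<le> real (card (D m))" if m: "m \<le> n" for m
    proof -
      \<comment> \<open>The sampled column just left of the maximum point.\<close>
      define i where "i = nat \<lfloor>(z - x0) / \<epsilon>\<rfloor>"
      have zx: "0 \<le> (z - x0) / \<epsilon>" "(z - x0) / \<epsilon> \<le> n" using z(1) e0 by (auto simp: x1 field_simps)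
      then have "real i \<le> (z - x0) / \<epsilon>" "(z - x0) / \<epsilon> < real i + 1" "i \<le> n"
        by (auto simp: i_def nat_le_iff floor_le_iff)
      then have i: "i \<le> n" "X i \<le> z" "z \<le> X i + \<epsilon>" using e0 by (auto simp: X_def field_simps)
      have "\<psi> z - \<psi> (X i) \<le> L / c * (z - X i)"
        using psi_lip[of "X i" z] X[OF i(1)] z(1) i(2) by auto
      also have "\<dots> \<le> L / c * \<epsilon>" using i L0 c0 by (intro mult_left_mono) auto
      finally have pz: "\<psi> z - L / c * \<epsilon> \<le> \<psi> (X i)" by simp
      let ?J = "{j. j \<le> k \<and> \<psi> (X m) < y0 + real j * \<epsilon> \<and> y0 + real j * \<epsilon> < \<psi> z - L / c * \<epsilon>}"
      have "?J \<subseteq> D m"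
      proof
        fix j assume "j \<in> ?J"
        then have j: "j \<le> k" "\<psi> (X m) < Y j" "Y j < \<psi> (X i)" using pz by (auto simp: Y_def)
        then have "0 < f (X m, Y j)" "f (X i, Y j) < 0"
          using X[of m] X[of i] m i Y[of j] by (auto intro!: neg_below_psi pos_above_psi)
        then show "j \<in> D m" using j i th by (auto simp: D_def Z threshold_pos threshold_neg)
      qed
      then have "card ?J \<le> card (D m)" by (intro card_mono fin)
      moreover have "(\<psi> z - L / c * \<epsilon> - \<psi> (X m)) / \<epsilon> - 1 \<le> real (card ?J)"
      proof (rule card_grid_ge)
        have "0 \<le> L / c * \<epsilon>" using L0 c0 e0 by simp
        then show "\<psi> z - L / c * \<epsilon> \<le> y0 + real k * \<epsilon>" using psi_le[of z] y1 by linarith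
      qed (use e0 psi_ge in auto)
      moreover have "(\<psi> z - L / c * \<epsilon> - \<psi> (X m)) / \<epsilon> = (\<psi> z - \<psi> (X m)) / \<epsilon> - L / c"
        using e0 by (simp add: field_simps)
      ultimately show ?thesis by linarith
    qed
    define H where "H = real (card C)" define V where "V = real (card (D 0)) + real (card (D n))"
    have "\<bar>H - (h + h') / \<epsilon>\<bar> \<le> 8" using C_le C_ge by (auto simp: H_def)
    then have 1: "\<bar>\<epsilon> * H - (h + h')\<bar> \<le> \<epsilon> * 8" by (rule abs_diff_scale[OF e0])
    have "\<bar>V - (v + v') / \<epsilon>\<bar> \<le> 2 + 2 * L / c"
    proof -
      have "0 \<le> L / c" "2 * L / c = 2 * (L / c)" using L0 c0 by auto
      then show ?thesis
        using D_le[OF le0] D_ge[OF le0] D_le[OF order_refl] D_ge[OF order_refl]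
        unfolding V_def v_def[symmetric] v'_def[symmetric] X0 add_divide_distrib abs_le_iff by linarith
    qed
    then have 2: "\<bar>\<epsilon> * V - (v + v')\<bar> \<le> \<epsilon> * (2 + 2 * L / c)" by (rule abs_diff_scale[OF e0])
    have "\<epsilon> * norm (H, V) = norm (\<epsilon> *\<^sub>R (H, V))" using e0 by (simp only: norm_scaleR)
    then have "\<bar>\<epsilon> * norm (H, V) - norm (h + h', v + v')\<bar> \<le> \<epsilon> * 8 + \<epsilon> * (2 + 2 * L / c)"
      using norm_Pair_diff_le[of "\<epsilon> * H" "\<epsilon> * V" "h + h'" "v + v'"] 1 2 by simp
    moreover have "norm (h + h', v + v') \<le> len"
      using norm_triangle_ineq[of "(h, v)" "(h', v')"] by (simp add: len_def norm_Pair)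
    moreover have "len \<le> norm (h + h', v + v') + \<kappa>\<^sup>2 / 2 * (x1 - x0)"
    proof -
      \<comment> \<open>After reflection into the first quadrant both chords have slope close to \<open>\<bar>P\<bar>\<close>.\<close>
      have s: "\<bar>v - \<bar>P\<bar> * h\<bar> \<le> \<kappa> * h" "\<bar>v' - \<bar>P\<bar> * h'\<bar> \<le> \<kappa> * h'"
      proof -
        have *: "\<bar>\<bar>w\<bar> - \<bar>P\<bar> * a\<bar> \<le> \<kappa> * a" if "\<bar>w - P * a\<bar> \<le> \<kappa> * a" "0 \<le> a" for w a
        proof -
          have "\<bar>\<bar>w\<bar> - \<bar>P * a\<bar>\<bar> \<le> \<bar>w - P * a\<bar>" by (rule abs_triangle_ineq3)
          then show ?thesis using that by (simp add: abs_mult)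
        qed
        show "\<bar>v - \<bar>P\<bar> * h\<bar> \<le> \<kappa> * h"
          using *[of "\<psi> \<beta> - \<psi> \<alpha>" h] arc_slope[of \<alpha> \<beta> \<alpha> \<beta>] A nn by (simp add: v_def h_def)
        show "\<bar>v' - \<bar>P\<bar> * h'\<bar> \<le> \<kappa> * h'"
          using *[of "\<psi> \<beta>' - \<psi> \<alpha>'" h'] arc_slope[of \<alpha>' \<beta>' \<alpha>' \<beta>'] A nn by (simp add: v'_def h'_def abs_minus_commute)
      qed
      have "len \<le> ((h + \<bar>P\<bar> * v) / sqrt (1 + P\<^sup>2) + \<kappa>\<^sup>2 / 2 * h) + ((h' + \<bar>P\<bar> * v') / sqrt (1 + P\<^sup>2) + \<kappa>\<^sup>2 / 2 * h')"
        using chord_le_projection[OF nn(1) s(1)] chord_le_projection[OF nn(2) s(2)] by (simp add: len_def)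
      also have "\<dots> = ((h + h') + \<bar>P\<bar> * (v + v')) / sqrt (1 + P\<^sup>2) + \<kappa>\<^sup>2 / 2 * (h + h')"
        by (simp add: algebra_simps add_divide_distrib)
      also have "\<dots> \<le> norm (h + h', v + v') + \<kappa>\<^sup>2 / 2 * (x1 - x0)"
        using projection_le_chord[of "h + h'" "\<bar>P\<bar>" "v + v'"] kk
        by (simp add: norm_Pair distrib_left)
      finally show ?thesis .
    qed
    moreover have "0 \<le> \<kappa>\<^sup>2 / 2 * (x1 - x0)" using x01 by simp
    ultimately have "\<bar>\<epsilon> * norm (H, V) - len\<bar> \<le> \<epsilon> * (10 + 2 * L / c) + \<kappa>\<^sup>2 / 2 * (x1 - x0)"
      by (simp add: algebra_simps abs_le_iff)
    moreover have "column_changes Z k i \<le> 2" if "i \<le> n" for i using col[OF that] by simp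
    moreover have "row_changes Z n j \<le> 2" if "j \<le> k" for j
      using row[OF that] Zbin[of 0 j] Zbin[of n j] by auto
    ultimately show ?thesis
      unfolding Z_def[symmetric] NC NR H_def V_def by blast
  qed
  have "len + \<kappa>\<^sup>2 / 2 * (x1 - x0) \<le> len + (\<epsilon> * (10 + 2 * L / c) + \<kappa>\<^sup>2 / 2 * (x1 - x0))"
    using e0 L0 c0 by simp
  then have "hausdorff1 {s\<in>grid_box x0 y0 n k \<epsilon>. f s = 0} \<le> ennreal (len + (\<epsilon> * (10 + 2 * L / c) + \<kappa>\<^sup>2 / 2 * (x1 - x0)))"
    by (rule order_trans[OF upper ennreal_leI])
  then show ?thesis
    unfolding box_estimate_def using l0 lower counts by blast
qed

text \<open>An isometric involution that carries one zero set to the other and preserves the counts preserves the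
  estimate. It is applied to the negation of the field, to the reflection of a coordinate and to the
  exchange of the coordinates.\<close>
lemma box_estimate_transform:
  assumes est: "box_estimate g x0' y0' n' k' \<epsilon> \<eta>"
    and R: "\<And>s. R (R s) = s" "\<And>s s'. dist (R s) (R s') \<le> dist s s'"
    and f: "\<And>s. f s = 0 \<longleftrightarrow> g (R s) = 0"
    and B: "\<And>s. s \<in> grid_box x0 y0 n k \<epsilon> \<longleftrightarrow> R s \<in> grid_box x0' y0' n' k' \<epsilon>"
           "\<And>s. s \<in> open_grid_box x0 y0 n k \<epsilon> \<longleftrightarrow> R s \<in> open_grid_box x0' y0' n' k' \<epsilon>"
    and counts: "\<And>\<theta>. threshold \<theta> \<Longrightarrow> \<exists>\<theta>'. threshold \<theta>' \<and> 
       (few_changes (sample \<theta>' g x0' y0' \<epsilon>) n' k' \<longrightarrow>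
        few_changes (sample \<theta> f x0 y0 \<epsilon>) n k) \<and>
        change_norm (sample \<theta> f x0 y0 \<epsilon>) n k
        = change_norm (sample \<theta>' g x0' y0' \<epsilon>) n' k'"
  shows "box_estimate f x0 y0 n k \<epsilon> \<eta>"
proof -
  obtain len where l: "len \<ge> 0"
    "hausdorff1 {s\<in>grid_box x0' y0' n' k' \<epsilon>. g s = 0} \<le> ennreal (len + \<eta>)"
    "\<And>e. e > 0 \<Longrightarrow> \<exists>K. compact K \<and> K \<subseteq> {s\<in>open_grid_box x0' y0' n' k' \<epsilon>. g s = 0} \<and> ennreal (len - e) \<le> hausdorff1 K"
    "\<And>\<theta>. threshold \<theta> \<Longrightarrow>
        few_changes (sample \<theta> g x0' y0' \<epsilon>) n' k' \<and>
        \<bar>\<epsilon> * change_norm (sample \<theta> g x0' y0' \<epsilon>) n' k' - len\<bar> \<le> \<eta>"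
    using est unfolding box_estimate_def by blast
  have cont: "continuous_on A R" for A
    unfolding continuous_on_iff using R(2) by (meson le_less_trans)
  show ?thesis
    unfolding box_estimate_def
  proof (intro exI[of _ len] conjI allI impI)
    have "{s\<in>grid_box x0 y0 n k \<epsilon>. f s = 0} \<subseteq> R ` {s\<in>grid_box x0' y0' n' k' \<epsilon>. g s = 0}"
    proof
      fix s assume "s \<in> {s\<in>grid_box x0 y0 n k \<epsilon>. f s = 0}"
      then show "s \<in> R ` {s\<in>grid_box x0' y0' n' k' \<epsilon>. g s = 0}"
        using B(1)[of s] f[of s] R(1)[of s] by (intro image_eqI[of _ _ "R s"]) auto
    qed
    then show "hausdorff1 {s\<in>grid_box x0 y0 n k \<epsilon>. f s = 0} \<le> ennreal (len + \<eta>)"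
      by (rule order_trans[OF hausdorff1_mono order_trans[OF hausdorff1_image_le[OF R(2)] l(2)]])
  next
    fix e :: real assume "e > 0"
    then obtain K where K: "compact K" "K \<subseteq> {s\<in>open_grid_box x0' y0' n' k' \<epsilon>. g s = 0}" "ennreal (len - e) \<le> hausdorff1 K"
      using l(3) by blast
    have "K = R ` R ` K" using R(1) by (simp add: image_image)
    then have "hausdorff1 K \<le> hausdorff1 (R ` K)" using hausdorff1_image_le[of R "R ` K", OF R(2)] by simp
    then have "ennreal (len - e) \<le> hausdorff1 (R ` K)" using K(3) by (rule order_trans[rotated])
    moreover have "compact (R ` K)" by (intro compact_continuous_image cont K)
    moreover have "R ` K \<subseteq> {s\<in>open_grid_box x0 y0 n k \<epsilon>. f s = 0}" using K(2) f B(2) R(1) by auto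
    ultimately show "\<exists>K. compact K \<and> K \<subseteq> {s\<in>open_grid_box x0 y0 n k \<epsilon>. f s = 0} \<and> ennreal (len - e) \<le> hausdorff1 K"
      by blast
  next
    fix \<theta> assume "threshold \<theta>"
    from counts[OF this] obtain \<theta>' where t: "threshold \<theta>'"
       "(few_changes (sample \<theta>' g x0' y0' \<epsilon>) n' k' \<longrightarrow>
        few_changes (sample \<theta> f x0 y0 \<epsilon>) n k)"
        "change_norm (sample \<theta> f x0 y0 \<epsilon>) n k
        = change_norm (sample \<theta>' g x0' y0' \<epsilon>) n' k'"
      by blast
    show "column_changes (sample \<theta> f x0 y0 \<epsilon>) k i \<le> 2" if "i \<le> n" for i using l(4)[OF t(1)] t(2) that by blast
    show "row_changes (sample \<theta> f x0 y0 \<epsilon>) n j \<le> 2" if "j \<le> k" for j using l(4)[OF t(1)] t(2) that by blast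
    show "\<bar>\<epsilon> * change_norm (sample \<theta> f x0 y0 \<epsilon>) n k - len\<bar> \<le> \<eta>"
      unfolding t(3) using l(4)[OF t(1)] by blast
  qed (rule l(1))
qed

lemma box_estimate_uminus:
  assumes "box_estimate (\<lambda>s. - f s) x0 y0 n k \<epsilon> \<eta>" shows "box_estimate f x0 y0 n k \<epsilon> \<eta>"
proof (rule box_estimate_transform[OF assms, where R = "\<lambda>s. s"])
  fix \<theta> assume th: "threshold \<theta>"
  define \<theta>' where "\<theta>' = (\<lambda>v. 1 - \<theta> (- v))"
  have th': "threshold \<theta>'" using th unfolding threshold_def \<theta>'_def mono_def by force
  have eq: "sample \<theta> f x0 y0 \<epsilon> i j = 1 - sample \<theta>' (\<lambda>s. - f s) x0 y0 \<epsilon> i j" for i j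
    by (simp add: sample_def \<theta>'_def)
  have changes: "column_changes (sample \<theta> f x0 y0 \<epsilon>) k = column_changes (sample \<theta>' (\<lambda>s. - f s) x0 y0 \<epsilon>) k"
    "row_changes (sample \<theta> f x0 y0 \<epsilon>) n = row_changes (sample \<theta>' (\<lambda>s. - f s) x0 y0 \<epsilon>) n"
    unfolding column_changes_def row_changes_def eq by (simp_all add: abs_minus_commute)
  show "\<exists>\<theta>'. threshold \<theta>' \<and> 
       (few_changes (sample \<theta>' (\<lambda>s. - f s) x0 y0 \<epsilon>) n k \<longrightarrow>
        few_changes (sample \<theta> f x0 y0 \<epsilon>) n k) \<and>
        change_norm (sample \<theta> f x0 y0 \<epsilon>) n k
        = change_norm (sample \<theta>' (\<lambda>s. - f s) x0 y0 \<epsilon>) n k"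
    unfolding changes using th' by (intro exI[of _ \<theta>'] conjI impI refl) blast+
qed auto

lemma box_estimate_reflect:
  assumes "box_estimate (\<lambda>(x, y). f (x, - y)) x0 (- (y0 + real k * \<epsilon>)) n k \<epsilon> \<eta>"
  shows "box_estimate f x0 y0 n k \<epsilon> \<eta>"
proof (rule box_estimate_transform[OF assms, where R = "\<lambda>(x, y). (x, - y)"])
  fix \<theta> assume th: "threshold \<theta>"
  define Z where "Z = sample \<theta> f x0 y0 \<epsilon>"
  define Z' where "Z' = sample \<theta> (\<lambda>(x, y). f (x, - y)) x0 (- (y0 + real k * \<epsilon>)) \<epsilon>"
  have eq: "Z' i j = Z i (k - j)" if "j \<le> k" for i j
    using that by (simp add: Z_def Z'_def sample_def of_nat_diff algebra_simps)
  have row: "row_changes Z' n j = row_changes Z n (k - j)" if "j \<le> k" for j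
    using that by (simp add: row_changes_def eq)
  have col: "column_changes Z' k i = column_changes Z k i" for i
  proof -
    have "column_changes Z k i = (\<Sum>j<k. \<bar>Z i (k - Suc j) - Z i (Suc (k - Suc j))\<bar>)"
      unfolding column_changes_def by (rule sum.nat_diff_reindex[symmetric])
    also have "\<dots> = column_changes Z' k i"
      unfolding column_changes_def by (intro sum.cong) (auto simp: eq Suc_diff_Suc abs_minus_commute)
    finally show ?thesis by simp
  qed
  have rows: "(\<Sum>j\<le>k. row_changes Z n j) = (\<Sum>j\<le>k. row_changes Z' n j)"
  proof -
    have "(\<Sum>j\<le>k. row_changes Z n j) = (\<Sum>j\<le>k. row_changes Z n (k - j))"
      by (rule sum.reindex_bij_witness[of _ "\<lambda>j. k - j" "\<lambda>j. k - j"]) auto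
    then show ?thesis by (simp add: row)
  qed
  have "row_changes Z n j \<le> 2" if "\<forall>j\<le>k. row_changes Z' n j \<le> 2" "j \<le> k" for j
    using that(1)[rule_format, of "k - j"] that(2) row[of "k - j"] by simp
  then show "\<exists>\<theta>'. threshold \<theta>' \<and> 
       (few_changes (sample \<theta>' (\<lambda>(x, y). f (x, - y)) x0 (- (y0 + real k * \<epsilon>)) \<epsilon>) n k \<longrightarrow>
        few_changes (sample \<theta> f x0 y0 \<epsilon>) n k) \<and>
        change_norm (sample \<theta> f x0 y0 \<epsilon>) n k
        = change_norm (sample \<theta>' (\<lambda>(x, y). f (x, - y)) x0 (- (y0 + real k * \<epsilon>)) \<epsilon>) n k"
    unfolding Z_def[symmetric]
    using th by (intro exI[of _ \<theta>]) (simp only: rows col Z'_def[symmetric], blast)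
qed (auto simp: grid_box_def open_grid_box_def dist_Pair_Pair dist_real_def abs_minus_commute split: prod.splits)

lemma box_estimate_swap:
  assumes "box_estimate (\<lambda>(x, y). f (y, x)) y0 x0 k n \<epsilon> \<eta>"
  shows "box_estimate f x0 y0 n k \<epsilon> \<eta>"
proof (rule box_estimate_transform[OF assms, where R = "\<lambda>(x, y). (y, x)"])
  fix \<theta> assume th: "threshold \<theta>"
  have "column_changes (sample \<theta> (\<lambda>(x, y). f (y, x)) y0 x0 \<epsilon>) n i = row_changes (sample \<theta> f x0 y0 \<epsilon>) n i"
     "row_changes (sample \<theta> (\<lambda>(x, y). f (y, x)) y0 x0 \<epsilon>) k i = column_changes (sample \<theta> f x0 y0 \<epsilon>) k i" for i
    by (simp_all add: column_changes_def row_changes_def sample_def)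
  then show "\<exists>\<theta>'. threshold \<theta>' \<and> 
       (few_changes (sample \<theta>' (\<lambda>(x, y). f (y, x)) y0 x0 \<epsilon>) k n \<longrightarrow>
        few_changes (sample \<theta> f x0 y0 \<epsilon>) n k) \<and>
        change_norm (sample \<theta> f x0 y0 \<epsilon>) n k
        = change_norm (sample \<theta>' (\<lambda>(x, y). f (y, x)) y0 x0 \<epsilon>) k n"
    using th by (intro exI[of _ \<theta>]) (auto simp: norm_Pair add.commute)
qed (auto simp: grid_box_def open_grid_box_def dist_Pair_Pair add.commute split: prod.splits)

lemma box_estimate_mono:
  assumes "box_estimate f x0 y0 n k \<epsilon> \<eta>" "\<eta> \<le> \<eta>'" shows "box_estimate f x0 y0 n k \<epsilon> \<eta>'"
proof -
  have "ennreal (len + \<eta>) \<le> ennreal (len + \<eta>')" for len using assms(2) by (intro ennreal_leI) auto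
  moreover obtain len where "0 \<le> len"
    "hausdorff1 {s\<in>grid_box x0 y0 n k \<epsilon>. f s = 0} \<le> ennreal (len + \<eta>)"
    "\<forall>e>0. \<exists>K. compact K \<and> K \<subseteq> {s\<in>open_grid_box x0 y0 n k \<epsilon>. f s = 0} \<and> ennreal (len - e) \<le> hausdorff1 K"
    "\<forall>\<theta>. threshold \<theta> \<longrightarrow>
        few_changes (sample \<theta> f x0 y0 \<epsilon>) n k \<and>
        \<bar>\<epsilon> * change_norm (sample \<theta> f x0 y0 \<epsilon>) n k - len\<bar> \<le> \<eta>"
    using assms(1) unfolding box_estimate_def by blast
  ultimately show ?thesis
    unfolding box_estimate_def using assms(2)
    by (intro exI[of _ len] conjI) (assumption | blast intro: order_trans)+
qed

section \<open>From derivatives to steep boxes\<close>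

text \<open>A differentiable function that first increases and then decreases weakly has a point with nonnegative
  derivative followed by one with nonpositive derivative. Each of the three alternatives excludes this.\<close>
lemma row_strictly_quasiconvex:
  fixes r r1 r2 :: "real \<Rightarrow> real"
  assumes r: "\<And>x. x \<in> {a..b} \<Longrightarrow> (r has_real_derivative r1 x) (at x)"
    and r1: "\<And>x. x \<in> {a..b} \<Longrightarrow> (r1 has_real_derivative r2 x) (at x)"
    and alt: "(\<forall>x\<in>{a..b}. 0 < r1 x) \<or> (\<forall>x\<in>{a..b}. r1 x < 0) \<or> (\<forall>x\<in>{a..b}. 0 < r2 x)"
    and x: "a \<le> x" "x < x'" "x' < x''" "x'' \<le> b"
  shows "r x' < max (r x) (r x'')"
proof -
  have m1: "\<exists>\<xi>. x < \<xi> \<and> \<xi> < x' \<and> r x' - r x = (x' - x) * r1 \<xi>"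
    using x by (intro MVT2 r) auto
  have m2: "\<exists>\<xi>. x' < \<xi> \<and> \<xi> < x'' \<and> r x'' - r x' = (x'' - x') * r1 \<xi>"
    using x by (intro MVT2 r) auto
  from m1 obtain \<xi> where 1: "x < \<xi>" "\<xi> < x'" "r x' - r x = (x' - x) * r1 \<xi>" by blast
  from m2 obtain \<zeta> where 2: "x' < \<zeta>" "\<zeta> < x''" "r x'' - r x' = (x'' - x') * r1 \<zeta>" by blast
  consider "r1 \<xi> < 0" | "r1 \<zeta> > 0"
  proof -
    have in': "\<xi> \<in> {a..b}" "\<zeta> \<in> {a..b}" using 1 2 x by auto
    show thesis using alt
    proof (elim disjE)
      assume pos: "\<forall>x\<in>{a..b}. 0 < r2 x"
      have "\<exists>w. \<xi> < w \<and> w < \<zeta> \<and> r1 \<zeta> - r1 \<xi> = (\<zeta> - \<xi>) * r2 w"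
        using 1(1,2) 2(1,2) x by (intro MVT2 r1) auto
      then obtain w where w: "\<xi> < w" "w < \<zeta>" "r1 \<zeta> - r1 \<xi> = (\<zeta> - \<xi>) * r2 w" by blast
      then have "0 < r2 w" using pos in' by auto
      then have "0 < (\<zeta> - \<xi>) * r2 w" using w by simp
      then have "r1 \<xi> < r1 \<zeta>" using w(3) by linarith
      then show thesis using that by linarith
    qed (use that in' in auto)
  qed
  then show ?thesis
  proof cases
    case 1
    then have "r x' - r x < 0" using \<open>r x' - r x = _\<close> x by (simp add: mult_pos_neg)
    then show ?thesis by simp
  next
    case 2
    then have "r x'' - r x' > 0" using \<open>r x'' - r x' = _\<close> x by simp
    then show ?thesis by simp
  qed
qed

lemma strictly_quasiconvex_two_zeros:
  fixes r :: "real \<Rightarrow> real"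
  assumes "\<And>x x' x''. a \<le> x \<Longrightarrow> x < x' \<Longrightarrow> x' < x'' \<Longrightarrow> x'' \<le> b \<Longrightarrow> r x' < max (r x) (r x'')"
  shows "finite {x\<in>{a..b}. r x = 0} \<and> card {x\<in>{a..b}. r x = 0} \<le> 2"
proof (rule ccontr)
  let ?S = "{x\<in>{a..b}. r x = 0}"
  assume notle: "\<not> (finite ?S \<and> card ?S \<le> 2)"
  obtain B where B: "B \<subseteq> ?S" "card B = 3"
  proof (cases "finite ?S")
    case True
    then have "3 \<le> card ?S" using notle by linarith
    then obtain B where "B \<subseteq> ?S" "card B = 3" by (rule obtain_subset_with_card_n)
    then show thesis by (rule that)
  next
    case False
    then show thesis using infinite_arbitrarily_large[OF False, of 3] that by blast
  qed
  then obtain x y z where xyz: "B = {x, y, z}" "x \<noteq> y" "x \<noteq> z" "y \<noteq> z" by (auto simp: card_3_iff)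
  have no: False if "u \<in> ?S" "v \<in> ?S" "w \<in> ?S" "u < v" "v < w" for u v w
    using assms[of u v w] that by auto
  have S: "x \<in> ?S" "y \<in> ?S" "z \<in> ?S" using B xyz by auto
  consider "x < y" "y < z" | "x < z" "z < y" | "y < x" "x < z" | "y < z" "z < x" | "z < x" "x < y" | "z < y" "y < x"
    using xyz(2-4) by linarith
  then show False using no S by cases blast+
qed

text \<open>Derivatives are supplied as functions of their own, so that the condition can be transported along
  reflections without differentiating the reflected field again. The bound \<open>w\<close> controls the oscillation
  of the gradient on the box.\<close>
definition regular_box :: "real \<Rightarrow> real \<Rightarrow> (real \<times> real \<Rightarrow> real) \<Rightarrow> (real \<times> real \<Rightarrow> real) \<Rightarrow>
    (real \<times> real \<Rightarrow> real) \<Rightarrow> (real \<times> real \<Rightarrow> real) \<Rightarrow> (real \<times> real) set \<Rightarrow> bool" where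
  "regular_box L w g g1 g2 g11 B \<longleftrightarrow>
     continuous_on B g \<and>
     (\<forall>x y. (x, y) \<in> B \<longrightarrow> ((\<lambda>x. g (x, y)) has_real_derivative g1 (x, y)) (at x) \<and>
        ((\<lambda>y. g (x, y)) has_real_derivative g2 (x, y)) (at y) \<and>
        ((\<lambda>x. g1 (x, y)) has_real_derivative g11 (x, y)) (at x) \<and> \<bar>g1 (x, y)\<bar> \<le> L) \<and>
     (\<forall>s\<in>B. \<forall>s'\<in>B. \<bar>g1 s - g1 s'\<bar> \<le> w \<and> \<bar>g2 s - g2 s'\<bar> \<le> w)"

lemma mean_value_any_order:
  fixes r r1 :: "real \<Rightarrow> real"
  assumes "\<And>x. x \<in> {a..b} \<Longrightarrow> (r has_real_derivative r1 x) (at x)" "x \<in> {a..b}" "x' \<in> {a..b}"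
  obtains \<xi> where "\<xi> \<in> {a..b}" "r x' - r x = r1 \<xi> * (x' - x)"
proof -
  consider "x = x'" | "x < x'" | "x' < x" by linarith
  then show thesis
  proof cases
    case 1 then show thesis using that[of x] assms by auto
  next
    case 2
    have "\<exists>z. x < z \<and> z < x' \<and> r x' - r x = (x' - x) * r1 z" using 2 assms by (intro MVT2) auto
    then obtain z where "x < z" "z < x'" "r x' - r x = (x' - x) * r1 z" by blast
    then show thesis using that[of z] assms by (auto simp: mult.commute)
  next
    case 3
    have "\<exists>z. x' < z \<and> z < x \<and> r x - r x' = (x - x') * r1 z" using 3 assms by (intro MVT2) auto
    then obtain z where "x' < z" "z < x" "r x - r x' = (x - x') * r1 z" by blast
    then show thesis using that[of z] assms by (auto simp: algebra_simps)
  qed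
qed

text \<open>Going from one zero to another first horizontally and then vertically, the mean value theorem gives
  \<open>a dx + b dy = 0\<close> for values \<open>a\<close>, \<open>b\<close> of the partial derivatives in the box. Replacing them by the
  values at a corner changes the left side by at most \<open>w (\<bar>dx\<bar> + \<bar>dy\<bar>)\<close>, and \<open>\<bar>dy\<bar> \<le> L / c \<bar>dx\<bar>\<close>.\<close>
lemma regular_box_steep:
  assumes reg: "regular_box L w g g1 g2 g11 ({x0..x1} \<times> {y0..y1})" and c: "c > 0" and xy: "x0 \<le> x1" "y0 \<le> y1"
    and g2: "\<And>s. s \<in> {x0..x1} \<times> {y0..y1} \<Longrightarrow> c \<le> g2 s"
    and alt: "(\<forall>s\<in>{x0..x1} \<times> {y0..y1}. 0 < g1 s) \<or> (\<forall>s\<in>{x0..x1} \<times> {y0..y1}. g1 s < 0) \<or> (\<forall>s\<in>{x0..x1} \<times> {y0..y1}. 0 < g11 s)"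
  shows "steep_box g x0 x1 y0 y1 c L (- g1 (x0, y0) / g2 (x0, y0)) (w / c * (1 + L / c))"
proof
  let ?B = "{x0..x1} \<times> {y0..y1}"
  let ?P = "- g1 (x0, y0) / g2 (x0, y0)"
  have d: "((\<lambda>x. g (x, y)) has_real_derivative g1 (x, y)) (at x)"
      "((\<lambda>y. g (x, y)) has_real_derivative g2 (x, y)) (at y)"
      "((\<lambda>x. g1 (x, y)) has_real_derivative g11 (x, y)) (at x)" "\<bar>g1 (x, y)\<bar> \<le> L"
    if "x \<in> {x0..x1}" "y \<in> {y0..y1}" for x y
    using reg that unfolding regular_box_def by auto
  have w: "\<bar>g1 s - g1 s'\<bar> \<le> w" "\<bar>g2 s - g2 s'\<bar> \<le> w" if "s \<in> ?B" "s' \<in> ?B" for s s'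
    using reg that unfolding regular_box_def by auto
  have corner: "(x0, y0) \<in> ?B" using xy by auto
  show L0: "0 \<le> L" using d(4)[of x0 y0] xy by auto
  have w0: "0 \<le> w" using w(1)[OF corner corner] by simp
  show "x0 \<le> x1" "y0 \<le> y1" "0 < c" by fact+
  show "continuous_on ?B g" using reg unfolding regular_box_def by blast
  show "c * (y' - y) \<le> g (x, y') - g (x, y)" if "x \<in> {x0..x1}" "y0 \<le> y" "y \<le> y'" "y' \<le> y1" for x y y'
  proof -
    have "y \<in> {y0..y1}" "y' \<in> {y0..y1}" using that by auto
    with d(2)[OF that(1)] obtain \<xi> where "\<xi> \<in> {y0..y1}" "g (x, y') - g (x, y) = g2 (x, \<xi>) * (y' - y)"
      by (rule mean_value_any_order)
    then show ?thesis using g2[of "(x, \<xi>)"] that by (auto intro!: mult_right_mono)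
  qed
  show "\<bar>g (x, y) - g (x', y)\<bar> \<le> L * \<bar>x - x'\<bar>" if m: "x \<in> {x0..x1}" "x' \<in> {x0..x1}" "y \<in> {y0..y1}" for x x' y
  proof -
    obtain \<xi> where "\<xi> \<in> {x0..x1}" "g (x, y) - g (x', y) = g1 (\<xi>, y) * (x - x')"
      by (rule mean_value_any_order[OF d(1)[OF _ m(3)] m(2,1)])
    then show ?thesis using d(4)[of \<xi> y] m by (auto simp: abs_mult intro!: mult_right_mono)
  qed
  have sqc: "g (x', y) < max (g (x, y)) (g (x'', y))"
    if "x0 \<le> x" "x < x'" "x' < x''" "x'' \<le> x1" "y \<in> {y0..y1}" for x x' x'' y
    by (rule row_strictly_quasiconvex[of x0 x1 "\<lambda>x. g (x, y)" "\<lambda>x. g1 (x, y)" "\<lambda>x. g11 (x, y)"])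
       (use d that alt in auto)
  show "g (x', y) \<le> max (g (x, y)) (g (x'', y))" 
    if "x0 \<le> x" "x \<le> x'" "x' \<le> x''" "x'' \<le> x1" "y \<in> {y0..y1}" for x x' x'' y
    using sqc[of x x' x'' y] that by (cases "x = x' \<or> x' = x''") auto
  show "finite {x \<in> {x0..x1}. g (x, y) = 0} \<and> card {x \<in> {x0..x1}. g (x, y) = 0} \<le> 2" if "y \<in> {y0..y1}" for y
    using sqc that by (intro strictly_quasiconvex_two_zeros) auto
  show "\<bar>y' - y - ?P * (x' - x)\<bar> \<le> w / c * (1 + L / c) * \<bar>x' - x\<bar>"
    if m: "(x, y) \<in> ?B" "(x', y') \<in> ?B" and z: "g (x, y) = 0" "g (x', y') = 0" for x y x' y'
  proof -
    have mm: "x \<in> {x0..x1}" "y \<in> {y0..y1}" "x' \<in> {x0..x1}" "y' \<in> {y0..y1}" using m by auto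
    obtain \<xi> where xi: "\<xi> \<in> {x0..x1}" "g (x', y) - g (x, y) = g1 (\<xi>, y) * (x' - x)"
      by (rule mean_value_any_order[OF d(1)[OF _ mm(2)] mm(1,3)])
    obtain \<zeta> where ze: "\<zeta> \<in> {y0..y1}" "g (x', y') - g (x', y) = g2 (x', \<zeta>) * (y' - y)"
      by (rule mean_value_any_order[OF d(2)[OF mm(3)] mm(2,4)])
    define a where "a = g1 (\<xi>, y)" define b where "b = g2 (x', \<zeta>)"
    define a0 where "a0 = g1 (x0, y0)" define b0 where "b0 = g2 (x0, y0)"
    define dx where "dx = x' - x" define dy where "dy = y' - y"
    have eq: "a * dx + b * dy = 0" using xi(2) ze(2) z by (simp add: a_def b_def dx_def dy_def)
    have ab: "\<bar>a\<bar> \<le> L" "c \<le> b" "c \<le> b0" "\<bar>a0 - a\<bar> \<le> w" "\<bar>b0 - b\<bar> \<le> w"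
      using d(4)[of \<xi> y] g2[of "(x', \<zeta>)"] g2[OF corner] w(1)[OF corner, of "(\<xi>, y)"] w(2)[OF corner, of "(x', \<zeta>)"] xi ze m
      by (auto simp: a_def b_def a0_def b0_def)
    have "b * \<bar>dy\<bar> = \<bar>b * dy\<bar>" using ab(2) c by (simp add: abs_mult)
    also have "\<dots> = \<bar>a * dx\<bar>" using eq by (simp add: eq_neg_iff_add_eq_0[symmetric] add.commute abs_minus_cancel add_eq_0_iff)
    also have "\<dots> \<le> L * \<bar>dx\<bar>" using ab(1) by (auto simp: abs_mult intro!: mult_right_mono)
    finally have "c * \<bar>dy\<bar> \<le> L * \<bar>dx\<bar>" using mult_right_mono[OF ab(2), of "\<bar>dy\<bar>"] by simp
    then have dy: "\<bar>dy\<bar> \<le> L / c * \<bar>dx\<bar>" using c by (simp add: field_simps)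
    have "a0 * dx + b0 * dy = (a0 - a) * dx + (b0 - b) * dy" using eq by (simp add: algebra_simps)
    also have "\<bar>\<dots>\<bar> \<le> w * \<bar>dx\<bar> + w * \<bar>dy\<bar>"
      using ab(4,5) by (intro order_trans[OF abs_triangle_ineq] add_mono) (auto simp: abs_mult intro!: mult_right_mono)
    also have "\<dots> \<le> w * \<bar>dx\<bar> + w * (L / c * \<bar>dx\<bar>)" using dy w0 by (intro add_left_mono mult_left_mono) auto
    finally have n: "\<bar>a0 * dx + b0 * dy\<bar> \<le> w * (1 + L / c) * \<bar>dx\<bar>" by (simp add: algebra_simps)
    have "dy - (- a0 / b0) * dx = (a0 * dx + b0 * dy) / b0" using ab(3) c by (simp add: field_simps)
    then have "\<bar>dy - (- a0 / b0) * dx\<bar> = \<bar>a0 * dx + b0 * dy\<bar> / b0" using ab(3) c by (simp add: abs_divide)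
    also have "\<dots> \<le> \<bar>a0 * dx + b0 * dy\<bar> / c" using ab(3) c by (intro divide_left_mono) auto
    also have "\<dots> \<le> (w * (1 + L / c) * \<bar>dx\<bar>) / c" using n c by (intro divide_right_mono) auto
    finally show ?thesis by (simp add: a0_def b0_def dx_def dy_def)
  qed
qed

lemma regular_box_uminus:
  assumes "regular_box L w g g1 g2 g11 B"
  shows "regular_box L w (\<lambda>s. - g s) (\<lambda>s. - g1 s) (\<lambda>s. - g2 s) (\<lambda>s. - g11 s) B"
  using assms unfolding regular_box_def
  by (auto intro!: continuous_intros derivative_eq_intros simp: abs_minus_commute)

lemma regular_box_reflect:
  assumes "regular_box L w g g1 g2 g11 B"
    and B: "\<And>x y. (x, y) \<in> B' \<Longrightarrow> (x, - y) \<in> B"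
  shows "regular_box L w (\<lambda>(x, y). g (x, - y)) (\<lambda>(x, y). g1 (x, - y)) (\<lambda>(x, y). - g2 (x, - y)) (\<lambda>(x, y). g11 (x, - y)) B'"
proof -
  have d: "((\<lambda>x. g (x, y)) has_real_derivative g1 (x, y)) (at x)"
      "((\<lambda>y. g (x, y)) has_real_derivative g2 (x, y)) (at y)"
      "((\<lambda>x. g1 (x, y)) has_real_derivative g11 (x, y)) (at x)" "\<bar>g1 (x, y)\<bar> \<le> L"
    if "(x, y) \<in> B" for x y
    using assms that unfolding regular_box_def by auto
  have "continuous_on B g" using assms unfolding regular_box_def by blast
  then have c: "continuous_on B' (\<lambda>(x, y). g (x, - y))"
    unfolding case_prod_beta by (rule continuous_on_compose2) (auto intro!: continuous_intros B)
  have d2: "((\<lambda>y. g (x, - y)) has_real_derivative - g2 (x, - y)) (at y)" if "(x, y) \<in> B'" for x y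
    using DERIV_chain2[OF d(2)[OF B[OF that]] DERIV_minus[OF DERIV_ident]] by simp
  show ?thesis
    using assms(1) unfolding regular_box_def
    by (auto simp: c d B d2 abs_minus_commute)
qed

lemma regular_box_estimate_convex:
  assumes reg: "regular_box L w g g1 g2 g11 (grid_box x0 y0 n k \<epsilon>)" and c: "c > 0" and e: "\<epsilon> > 0"
    and g2: "\<And>s. s \<in> grid_box x0 y0 n k \<epsilon> \<Longrightarrow> c \<le> g2 s"
    and alt: "(\<forall>s\<in>grid_box x0 y0 n k \<epsilon>. 0 < g1 s) \<or> (\<forall>s\<in>grid_box x0 y0 n k \<epsilon>. g1 s < 0) \<or>
       (\<forall>s\<in>grid_box x0 y0 n k \<epsilon>. 0 < g11 s)"
  shows "box_estimate g x0 y0 n k \<epsilon> (\<epsilon> * (10 + 2 * L / c) + (w / c * (1 + L / c))\<^sup>2 / 2 * (real n * \<epsilon>))"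
proof -
  interpret steep_box g x0 "x0 + real n * \<epsilon>" y0 "y0 + real k * \<epsilon>" c L "- g1 (x0, y0) / g2 (x0, y0)" "w / c * (1 + L / c)"
    by (rule regular_box_steep) (use assms in \<open>auto simp: grid_box_def\<close>)
  show ?thesis using steep_box_estimate[OF e refl refl] by simp
qed

text \<open>Strictly concave rows become strictly convex ones under \<open>g (x, y) \<mapsto> - g (x, - y)\<close>, which keeps the
  columns increasing.\<close>
lemma regular_box_estimate_increasing:
  assumes reg: "regular_box L w g g1 g2 g11 (grid_box x0 y0 n k \<epsilon>)" and c: "c > 0" and e: "\<epsilon> > 0"
    and g2: "\<And>s. s \<in> grid_box x0 y0 n k \<epsilon> \<Longrightarrow> c \<le> g2 s"
    and alt: "(\<forall>s\<in>grid_box x0 y0 n k \<epsilon>. 0 < g1 s) \<or> (\<forall>s\<in>grid_box x0 y0 n k \<epsilon>. g1 s < 0) \<or>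
       (\<forall>s\<in>grid_box x0 y0 n k \<epsilon>. 0 < g11 s) \<or> (\<forall>s\<in>grid_box x0 y0 n k \<epsilon>. g11 s < 0)"
  shows "box_estimate g x0 y0 n k \<epsilon> (\<epsilon> * (10 + 2 * L / c) + (w / c * (1 + L / c))\<^sup>2 / 2 * (real n * \<epsilon>))"
proof (cases "\<forall>s\<in>grid_box x0 y0 n k \<epsilon>. g11 s < 0")
  case False
  then show ?thesis using alt by (intro regular_box_estimate_convex[OF reg c e g2]) auto
next
  case True
  let ?B' = "grid_box x0 (- (y0 + real k * \<epsilon>)) n k \<epsilon>"
  have B: "(x, - y) \<in> grid_box x0 y0 n k \<epsilon>" if "(x, y) \<in> ?B'" for x y
    using that by (auto simp: grid_box_def)
  show ?thesis
    by (rule box_estimate_reflect, rule box_estimate_uminus,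
        rule regular_box_estimate_convex[OF regular_box_uminus[OF regular_box_reflect[OF reg B]] c e])
       (use True g2 B in auto)
qed

lemma regular_box_estimate_vertical:
  assumes reg: "regular_box L w g g1 g2 g11 (grid_box x0 y0 n k \<epsilon>)" and c: "c > 0" and e: "\<epsilon> > 0"
    and g2: "(\<forall>s\<in>grid_box x0 y0 n k \<epsilon>. c \<le> g2 s) \<or> (\<forall>s\<in>grid_box x0 y0 n k \<epsilon>. g2 s \<le> - c)"
    and alt: "(\<forall>s\<in>grid_box x0 y0 n k \<epsilon>. 0 < g1 s) \<or> (\<forall>s\<in>grid_box x0 y0 n k \<epsilon>. g1 s < 0) \<or>
       (\<forall>s\<in>grid_box x0 y0 n k \<epsilon>. 0 < g11 s) \<or> (\<forall>s\<in>grid_box x0 y0 n k \<epsilon>. g11 s < 0)"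
  shows "box_estimate g x0 y0 n k \<epsilon> (\<epsilon> * (10 + 2 * L / c) + (w / c * (1 + L / c))\<^sup>2 / 2 * (real n * \<epsilon>))"
  using g2
proof (elim disjE)
  assume "\<forall>s\<in>grid_box x0 y0 n k \<epsilon>. c \<le> g2 s"
  then show ?thesis by (intro regular_box_estimate_increasing[OF reg c e _ alt]) auto
next
  assume neg: "\<forall>s\<in>grid_box x0 y0 n k \<epsilon>. g2 s \<le> - c"
  show ?thesis
    by (rule box_estimate_uminus, rule regular_box_estimate_increasing[OF regular_box_uminus[OF reg] c e])
       (use neg alt in auto)
qed

section \<open>Continuously differentiable fields on the square\<close>

abbreviation D1 :: "(real \<times> real \<Rightarrow> real) \<Rightarrow> real \<times> real \<Rightarrow> real" where "D1 \<equiv> partial (1, 0)"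
abbreviation D2 :: "(real \<times> real \<Rightarrow> real) \<Rightarrow> real \<times> real \<Rightarrow> real" where "D2 \<equiv> partial (0, 1)"

lemma Basis_plane: "(Basis :: (real \<times> real) set) = {(1, 0), (0, 1)}"
  by (auto simp: Basis_prod_def)

lemma C1_iff: "C1 f \<longleftrightarrow> (\<forall>s. (\<lambda>h. f (s + h *\<^sub>R (1, 0))) field_differentiable at 0) \<and> continuous_on UNIV (D1 f) \<and>
    (\<forall>s. (\<lambda>h. f (s + h *\<^sub>R (0, 1))) field_differentiable at 0) \<and> continuous_on UNIV (D2 f)"
  by (auto simp: C1_def Basis_plane)

lemma C1_DERIV:
  assumes "C1 f"
  shows "((\<lambda>x. f (x, y)) has_real_derivative D1 f (x, y)) (at x)"
    and "((\<lambda>y. f (x, y)) has_real_derivative D2 f (x, y)) (at y)"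
proof -
  have "((\<lambda>h. f ((x, y) + h *\<^sub>R (1, 0))) has_real_derivative D1 f (x, y)) (at 0)"
    using assms unfolding C1_iff partial_def DERIV_deriv_iff_field_differentiable by blast
  then show "((\<lambda>x. f (x, y)) has_real_derivative D1 f (x, y)) (at x)"
    using DERIV_shift[of "\<lambda>x. f (x, y)" "D1 f (x, y)" 0 x] by (simp add: add.commute)
  have "((\<lambda>h. f ((x, y) + h *\<^sub>R (0, 1))) has_real_derivative D2 f (x, y)) (at 0)"
    using assms unfolding C1_iff partial_def DERIV_deriv_iff_field_differentiable by blast
  then show "((\<lambda>y. f (x, y)) has_real_derivative D2 f (x, y)) (at y)"
    using DERIV_shift[of "\<lambda>y. f (x, y)" "D2 f (x, y)" 0 y] by (simp add: add.commute)
qed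

lemma square_iff: "(x, y) \<in> square t \<longleftrightarrow> x \<in> {-t..t} \<and> y \<in> {-t..t}"
  by (simp add: square_def)

lemma compact_square: "compact (square t)"
  unfolding square_def by (intro compact_Times compact_Icc)

lemma continuous_on_square_bounded:
  assumes "continuous_on UNIV h"
  shows "\<exists>L\<ge>0. \<forall>s\<in>square t. \<bar>h s :: real\<bar> \<le> L"
proof -
  have "bounded (h ` square t)"
    by (intro compact_imp_bounded compact_continuous_image compact_square continuous_on_subset[OF assms]) auto
  then obtain b where "b > 0" "\<forall>x\<in>h ` square t. norm x \<le> b" by (auto simp: bounded_pos)
  then show ?thesis by (intro exI[of _ b]) auto
qed

text \<open>The two points are joined by a horizontal and a vertical segment inside the square, so only partial
  derivatives are needed.\<close>
lemma increment_le:
  assumes C: "C1 f" and L: "\<And>s. s \<in> square t \<Longrightarrow> \<bar>D1 f s\<bar> \<le> L" "\<And>s. s \<in> square t \<Longrightarrow> \<bar>D2 f s\<bar> \<le> L"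
    and "(x, y) \<in> square t" "(x', y') \<in> square t"
  shows "\<bar>f (x, y) - f (x', y')\<bar> \<le> L * (\<bar>x - x'\<bar> + \<bar>y - y'\<bar>)"
proof -
  have m: "x \<in> {-t..t}" "y \<in> {-t..t}" "x' \<in> {-t..t}" "y' \<in> {-t..t}" using assms(4,5) by (auto simp: square_iff)
  obtain \<xi> where xi: "\<xi> \<in> {-t..t}" "f (x, y) - f (x', y) = D1 f (\<xi>, y) * (x - x')"
    by (rule mean_value_any_order[OF C1_DERIV(1)[OF C] m(3,1)])
  obtain \<zeta> where ze: "\<zeta> \<in> {-t..t}" "f (x', y) - f (x', y') = D2 f (x', \<zeta>) * (y - y')"
    by (rule mean_value_any_order[OF C1_DERIV(2)[OF C] m(4,2)])
  have "\<bar>f (x, y) - f (x', y)\<bar> \<le> L * \<bar>x - x'\<bar>"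
    unfolding xi(2) abs_mult using xi m by (intro mult_right_mono L) (auto simp: square_iff)
  moreover have "\<bar>f (x', y) - f (x', y')\<bar> \<le> L * \<bar>y - y'\<bar>"
    unfolding ze(2) abs_mult using ze m by (intro mult_right_mono L) (auto simp: square_iff)
  ultimately show ?thesis by (simp add: distrib_left)
qed

lemma C1_lipschitz_on_square:
  assumes "C1 f"
  shows "\<exists>K\<ge>0. \<forall>x y x' y'. (x, y) \<in> square t \<longrightarrow> (x', y') \<in> square t \<longrightarrow>
    \<bar>f (x, y) - f (x', y')\<bar> \<le> K * (\<bar>x - x'\<bar> + \<bar>y - y'\<bar>)"
proof -
  have c: "continuous_on UNIV (D1 f)" "continuous_on UNIV (D2 f)" using assms unfolding C1_iff by auto
  obtain L1 where "L1 \<ge> 0" "\<And>s. s \<in> square t \<Longrightarrow> \<bar>D1 f s\<bar> \<le> L1" using continuous_on_square_bounded[OF c(1)] by blast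
  moreover obtain L2 where "L2 \<ge> 0" "\<And>s. s \<in> square t \<Longrightarrow> \<bar>D2 f s\<bar> \<le> L2" using continuous_on_square_bounded[OF c(2)] by blast
  ultimately show ?thesis
    using increment_le[OF assms, of t "max L1 L2"] by (intro exI[of _ "max L1 L2"]) (auto simp: le_max_iff_disj)
qed

lemma C1_continuous:
  assumes "C1 f" shows "continuous_on UNIV f"
proof -
  have "isCont f s" for s
  proof -
    obtain a b where s: "s = (a, b)" by fastforce
    define r where "r = \<bar>a\<bar> + \<bar>b\<bar> + 1"
    obtain K where K: "K \<ge> 0" "\<And>x y x' y'. (x, y) \<in> square r \<Longrightarrow> (x', y') \<in> square r \<Longrightarrow>
       \<bar>f (x, y) - f (x', y')\<bar> \<le> K * (\<bar>x - x'\<bar> + \<bar>y - y'\<bar>)"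
      using C1_lipschitz_on_square[OF assms] by blast
    have "(2 * K)-lipschitz_on (square r) f"
    proof (rule lipschitz_onI)
      fix s s' assume ss: "s \<in> square r" "s' \<in> square r"
      obtain x y x' y' where e: "s = (x, y)" "s' = (x', y')" by fastforce
      have "\<bar>x - x'\<bar> \<le> dist s s'" "\<bar>y - y'\<bar> \<le> dist s s'"
        using dist_fst_le[of s s'] dist_snd_le[of s s'] by (auto simp: e dist_real_def)
      then have "K * (\<bar>x - x'\<bar> + \<bar>y - y'\<bar>) \<le> K * (2 * dist s s')" using K(1) by (intro mult_left_mono) auto
      then show "dist (f s) (f s') \<le> 2 * K * dist s s'"
        using K(2)[of x y x' y'] ss by (simp add: e dist_real_def)
    qed (use K in auto)
    then have "continuous_on (square r) f" by (rule lipschitz_on_continuous_on)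
    moreover have "s \<in> interior (square r)"
      by (auto simp: square_def s r_def interior_Times interior_atLeastAtMost_real)
    ultimately show ?thesis by (rule continuous_on_interior)
  qed
  then show ?thesis by (simp add: continuous_on_eq_continuous_at)
qed

section \<open>Uniform constants at a regular level\<close>

text \<open>The quantitative form of regularity that compactness provides. At a point of the level set
  one derivative out of each pair is at least \<open>3 * c\<close> in absolute value, and the derivatives vary by less than \<open>c\<close> over distances below
  \<open>\<rho>\<close>; the margin allows one to pass from a point of the level set to the corner of its block
  (\<open>2 * c\<close>) and from there to other points of the same column (\<open>c\<close>).\<close>
locale regular_level =
  fixes f :: "real \<times> real \<Rightarrow> real" and t u c \<rho> L K :: real
  assumes t0: "t > 0" and C2: "C2 f" and c0: "c > 0" and \<rho>0: "\<rho> > 0" and L0: "L \<ge> 0" and K0: "K \<ge> 0"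
    and bound: "\<And>s. s \<in> square t \<Longrightarrow> \<bar>D1 f s\<bar> \<le> L" "\<And>s. s \<in> square t \<Longrightarrow> \<bar>D2 f s\<bar> \<le> L"
    and lip1: "\<And>x y x' y'. (x, y) \<in> square t \<Longrightarrow> (x', y') \<in> square t \<Longrightarrow> \<bar>D1 f (x, y) - D1 f (x', y')\<bar> \<le> K * (\<bar>x - x'\<bar> + \<bar>y - y'\<bar>)"
    and lip2: "\<And>x y x' y'. (x, y) \<in> square t \<Longrightarrow> (x', y') \<in> square t \<Longrightarrow> \<bar>D2 f (x, y) - D2 f (x', y')\<bar> \<le> K * (\<bar>x - x'\<bar> + \<bar>y - y'\<bar>)"
    and unif: "\<And>s s'. s \<in> square t \<Longrightarrow> s' \<in> square t \<Longrightarrow> dist s s' < \<rho> \<Longrightarrow>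
       \<bar>D1 f s - D1 f s'\<bar> < c \<and> \<bar>D2 f s - D2 f s'\<bar> < c \<and> \<bar>D1 (D1 f) s - D1 (D1 f) s'\<bar> < c \<and> \<bar>D2 (D2 f) s - D2 (D2 f) s'\<bar> < c"
    and nondegenerate: "\<And>s. s \<in> square t \<Longrightarrow> f s = u \<Longrightarrow>
       (3 * c \<le> \<bar>D1 f s\<bar> \<or> 3 * c \<le> \<bar>D2 f s\<bar>) \<and> (3 * c \<le> \<bar>D1 f s\<bar> \<or> 3 * c \<le> \<bar>D1 (D1 f) s\<bar>) \<and>
       (3 * c \<le> \<bar>D2 f s\<bar> \<or> 3 * c \<le> \<bar>D2 (D2 f) s\<bar>)"

lemma C2_imp_C1: assumes "C2 f" shows "C1 f" "C1 (D1 f)" "C1 (D2 f)"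
  using assms by (auto simp: C2_def Basis_plane)

text \<open>Absence of critical points, and the condition on second derivatives in both directions, say that the
  continuous function \<open>m\<close> of the proof is positive on the compact level set.\<close>
lemma regular_level_exists:
  assumes t0: "t > 0" and C2: "C2 f" and reg: "regular_at_level (square t) f u"
  obtains c \<rho> L K where "regular_level f t u c \<rho> L K"
proof -
  note C = C2_imp_C1[OF C2]
  have cont: "continuous_on UNIV f" "continuous_on UNIV (D1 f)" "continuous_on UNIV (D2 f)"
      "continuous_on UNIV (D1 (D1 f))" "continuous_on UNIV (D2 (D2 f))"
    using C1_continuous[OF C(1)] C1_continuous[OF C(2)] C1_continuous[OF C(3)] C(2,3)[unfolded C1_iff] by auto
  obtain L1 where L1: "L1 \<ge> 0" "\<And>s. s \<in> square t \<Longrightarrow> \<bar>D1 f s\<bar> \<le> L1" using continuous_on_square_bounded[OF cont(2)] by blast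
  obtain L2 where L2: "L2 \<ge> 0" "\<And>s. s \<in> square t \<Longrightarrow> \<bar>D2 f s\<bar> \<le> L2" using continuous_on_square_bounded[OF cont(3)] by blast
  obtain K1 where K1: "K1 \<ge> 0" "\<And>x y x' y'. (x, y) \<in> square t \<Longrightarrow> (x', y') \<in> square t \<Longrightarrow>
    \<bar>D1 f (x, y) - D1 f (x', y')\<bar> \<le> K1 * (\<bar>x - x'\<bar> + \<bar>y - y'\<bar>)" using C1_lipschitz_on_square[OF C(2)] by blast
  obtain K2 where K2: "K2 \<ge> 0" "\<And>x y x' y'. (x, y) \<in> square t \<Longrightarrow> (x', y') \<in> square t \<Longrightarrow>
    \<bar>D2 f (x, y) - D2 f (x', y')\<bar> \<le> K2 * (\<bar>x - x'\<bar> + \<bar>y - y'\<bar>)" using C1_lipschitz_on_square[OF C(3)] by blast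
  define G where "G = {s\<in>square t. f s = u}"
  \<comment> \<open>The factor \<open>6\<close> below is \<open>2 * 3\<close>: one of two summands is at least half of the sum.\<close>
  define m where "m = (\<lambda>s. min (\<bar>D1 f s\<bar> + \<bar>D2 f s\<bar>) (min (\<bar>D1 f s\<bar> + \<bar>D1 (D1 f) s\<bar>) (\<bar>D2 f s\<bar> + \<bar>D2 (D2 f) s\<bar>)))"
  have mpos: "m s > 0" if "s \<in> G" for s
  proof -
    have "D1 f s \<noteq> 0 \<or> D2 f s \<noteq> 0" "D1 f s \<noteq> 0 \<or> D1 (D1 f) s \<noteq> 0" "D2 f s \<noteq> 0 \<or> D2 (D2 f) s \<noteq> 0"
      using reg that unfolding regular_at_level_def Basis_plane G_def by auto
    then show ?thesis by (auto simp: m_def add_pos_nonneg add_nonneg_pos)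
  qed
  have cG: "compact G"
  proof -
    have "closed {s\<in>square t. f s = u}"
      by (intro continuous_closed_preimage_constant compact_imp_closed compact_square continuous_on_subset[OF cont(1)]) auto
    then show ?thesis unfolding G_def
      by (intro compact_eq_bounded_closed[THEN iffD2] conjI bounded_subset[OF compact_imp_bounded[OF compact_square]]) auto
  qed
  have cm: "continuous_on G m" unfolding m_def
    by (intro continuous_intros continuous_on_subset[OF cont(2)] continuous_on_subset[OF cont(3)]
        continuous_on_subset[OF cont(4)] continuous_on_subset[OF cont(5)]) auto
  obtain c where c: "c > 0" "\<And>s. s \<in> G \<Longrightarrow> 6 * c \<le> m s"
  proof (cases "G = {}")
    case True then show thesis using that[of 1] by auto
  next
    case False
    then obtain s where s: "s \<in> G" "\<forall>s'\<in>G. m s \<le> m s'" using continuous_attains_inf[OF cG _ cm] by auto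
    then show thesis using that[of "m s / 6"] mpos[OF s(1)] by auto
  qed
  define F where "F = (\<lambda>s. (D1 f s, D2 f s, D1 (D1 f) s, D2 (D2 f) s))"
  have "uniformly_continuous_on (square t) F"
    unfolding F_def by (intro compact_uniformly_continuous compact_square continuous_on_Pair)
      (rule continuous_on_subset[OF cont(2)] continuous_on_subset[OF cont(3)] continuous_on_subset[OF cont(4)] continuous_on_subset[OF cont(5)], simp)+
  then obtain \<rho> where r: "\<rho> > 0" "\<And>s s'. s \<in> square t \<Longrightarrow> s' \<in> square t \<Longrightarrow> dist s s' < \<rho> \<Longrightarrow> dist (F s) (F s') < c"
    using c(1) unfolding uniformly_continuous_on_def by (metis dist_commute)
  have "regular_level f t u c \<rho> (max L1 L2) (max K1 K2)"
  proof
    show "0 \<le> max L1 L2" "0 \<le> max K1 K2" using L1 K1 by auto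
    show "\<bar>D1 f s\<bar> \<le> max L1 L2" "\<bar>D2 f s\<bar> \<le> max L1 L2" if "s \<in> square t" for s
      using L1(2)[OF that] L2(2)[OF that] by auto
    fix x y x' y' assume xy: "(x, y) \<in> square t" "(x', y') \<in> square t"
    have "K1 * (\<bar>x - x'\<bar> + \<bar>y - y'\<bar>) \<le> max K1 K2 * (\<bar>x - x'\<bar> + \<bar>y - y'\<bar>)"
      "K2 * (\<bar>x - x'\<bar> + \<bar>y - y'\<bar>) \<le> max K1 K2 * (\<bar>x - x'\<bar> + \<bar>y - y'\<bar>)" by (intro mult_right_mono; simp)+
    then show "\<bar>D1 f (x, y) - D1 f (x', y')\<bar> \<le> max K1 K2 * (\<bar>x - x'\<bar> + \<bar>y - y'\<bar>)"
       "\<bar>D2 f (x, y) - D2 f (x', y')\<bar> \<le> max K1 K2 * (\<bar>x - x'\<bar> + \<bar>y - y'\<bar>)"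
      using K1(2)[OF xy] K2(2)[OF xy] by linarith+
  next
    fix s s' assume "s \<in> square t" "s' \<in> square t" "dist s s' < \<rho>"
    then have d: "dist (F s) (F s') < c" by (rule r(2))
    have "dist (D1 f s) (D1 f s') \<le> dist (F s) (F s')" 
      using dist_fst_le[of "F s" "F s'"] by (simp add: F_def)
    moreover have d2: "dist (snd (F s)) (snd (F s')) \<le> dist (F s) (F s')" by (rule dist_snd_le)
    moreover have "dist (D2 f s) (D2 f s') \<le> dist (snd (F s)) (snd (F s'))"
      using dist_fst_le[of "snd (F s)" "snd (F s')"] by (simp add: F_def)
    moreover have "dist (snd (snd (F s))) (snd (snd (F s'))) \<le> dist (snd (F s)) (snd (F s'))" by (rule dist_snd_le)
    moreover have "dist (D1 (D1 f) s) (D1 (D1 f) s') \<le> dist (snd (snd (F s))) (snd (snd (F s')))"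
      using dist_fst_le[of "snd (snd (F s))" "snd (snd (F s'))"] by (simp add: F_def)
    moreover have "dist (D2 (D2 f) s) (D2 (D2 f) s') \<le> dist (snd (snd (F s))) (snd (snd (F s')))"
      using dist_snd_le[of "snd (snd (F s))" "snd (snd (F s'))"] by (simp add: F_def)
    ultimately show "\<bar>D1 f s - D1 f s'\<bar> < c \<and> \<bar>D2 f s - D2 f s'\<bar> < c \<and> \<bar>D1 (D1 f) s - D1 (D1 f) s'\<bar> < c \<and> \<bar>D2 (D2 f) s - D2 (D2 f) s'\<bar> < c"
      using d unfolding dist_real_def by linarith
  next
    fix s assume "s \<in> square t" "f s = u"
    then have "6 * c \<le> m s" by (intro c(2)) (simp add: G_def)
    then show "(3 * c \<le> \<bar>D1 f s\<bar> \<or> 3 * c \<le> \<bar>D2 f s\<bar>) \<and> (3 * c \<le> \<bar>D1 f s\<bar> \<or> 3 * c \<le> \<bar>D1 (D1 f) s\<bar>) \<and>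
       (3 * c \<le> \<bar>D2 f s\<bar> \<or> 3 * c \<le> \<bar>D2 (D2 f) s\<bar>)"
      unfolding m_def by auto
  qed (use t0 C2 c r in auto)
  then show thesis by (rule that)
qed

context regular_level begin

lemma regular_box_grid:
  assumes B: "grid_box x0 y0 n k \<epsilon> \<subseteq> square t" and d: "real n * \<epsilon> \<le> \<delta>" "real k * \<epsilon> \<le> \<delta>"
  shows "regular_box L (2 * K * \<delta>) (\<lambda>s. f s - u) (D1 f) (D2 f) (D1 (D1 f)) (grid_box x0 y0 n k \<epsilon>)"
    and "regular_box L (2 * K * \<delta>) (\<lambda>(x, y). f (y, x) - u) (\<lambda>(x, y). D2 f (y, x)) (\<lambda>(x, y). D1 f (y, x))
      (\<lambda>(x, y). D2 (D2 f) (y, x)) (grid_box y0 x0 k n \<epsilon>)"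
proof -
  note C = C2_imp_C1[OF C2]
  have cont: "continuous_on UNIV f" by (rule C1_continuous[OF C(1)])
  have w: "\<bar>D1 f s - D1 f s'\<bar> \<le> 2 * K * \<delta>" "\<bar>D2 f s - D2 f s'\<bar> \<le> 2 * K * \<delta>"
    if s: "s \<in> grid_box x0 y0 n k \<epsilon>" "s' \<in> grid_box x0 y0 n k \<epsilon>" for s s'
  proof -
    obtain x y x' y' where e: "s = (x, y)" "s' = (x', y')" by fastforce
    have "\<bar>x - x'\<bar> \<le> \<delta>" "\<bar>y - y'\<bar> \<le> \<delta>" using s d by (auto simp: e grid_box_def abs_le_iff)
    then have "K * (\<bar>x - x'\<bar> + \<bar>y - y'\<bar>) \<le> K * (2 * \<delta>)" using K0 by (intro mult_left_mono) auto
    moreover have "(x, y) \<in> square t" "(x', y') \<in> square t" using s B unfolding e by auto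
    ultimately show "\<bar>D1 f s - D1 f s'\<bar> \<le> 2 * K * \<delta>" "\<bar>D2 f s - D2 f s'\<bar> \<le> 2 * K * \<delta>"
      using lip1[of x y x' y'] lip2[of x y x' y'] unfolding e by linarith+
  qed
  have sw: "(y, x) \<in> grid_box x0 y0 n k \<epsilon>" if "(x, y) \<in> grid_box y0 x0 k n \<epsilon>" for x y
    using that by (auto simp: grid_box_def)
  show "regular_box L (2 * K * \<delta>) (\<lambda>s. f s - u) (D1 f) (D2 f) (D1 (D1 f)) (grid_box x0 y0 n k \<epsilon>)"
    unfolding regular_box_def
  proof (intro conjI allI impI ballI)
    show "continuous_on (grid_box x0 y0 n k \<epsilon>) (\<lambda>s. f s - u)"
      by (intro continuous_intros continuous_on_subset[OF cont]) auto
  next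
    fix x y
    show "((\<lambda>x. f (x, y) - u) has_real_derivative D1 f (x, y)) (at x)"
      using DERIV_diff[OF C1_DERIV(1)[OF C(1)] DERIV_const] by simp
    show "((\<lambda>y. f (x, y) - u) has_real_derivative D2 f (x, y)) (at y)"
      using DERIV_diff[OF C1_DERIV(2)[OF C(1)] DERIV_const] by simp
    show "((\<lambda>x. D1 f (x, y)) has_real_derivative D1 (D1 f) (x, y)) (at x)" by (rule C1_DERIV[OF C(2)])
  next
    fix x y assume "(x, y) \<in> grid_box x0 y0 n k \<epsilon>"
    then show "\<bar>D1 f (x, y)\<bar> \<le> L" using B by (intro bound) auto
  qed (auto intro: w)
  show "regular_box L (2 * K * \<delta>) (\<lambda>(x, y). f (y, x) - u) (\<lambda>(x, y). D2 f (y, x)) (\<lambda>(x, y). D1 f (y, x))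
      (\<lambda>(x, y). D2 (D2 f) (y, x)) (grid_box y0 x0 k n \<epsilon>)"
    unfolding regular_box_def
  proof (intro conjI allI impI ballI)
    show "continuous_on (grid_box y0 x0 k n \<epsilon>) (\<lambda>(x, y). f (y, x) - u)"
      unfolding case_prod_beta
      by (intro continuous_intros continuous_on_compose2[OF cont]) auto
  next
    fix x y
    show "((\<lambda>x. case (x, y) of (x, y) \<Rightarrow> f (y, x) - u) has_real_derivative (case (x, y) of (x, y) \<Rightarrow> D2 f (y, x))) (at x)"
      using DERIV_diff[OF C1_DERIV(2)[OF C(1)] DERIV_const] by simp
    show "((\<lambda>y. case (x, y) of (x, y) \<Rightarrow> f (y, x) - u) has_real_derivative (case (x, y) of (x, y) \<Rightarrow> D1 f (y, x))) (at y)"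
      using DERIV_diff[OF C1_DERIV(1)[OF C(1)] DERIV_const] by simp
    show "((\<lambda>x. case (x, y) of (x, y) \<Rightarrow> D2 f (y, x)) has_real_derivative (case (x, y) of (x, y) \<Rightarrow> D2 (D2 f) (y, x))) (at x)"
      using C1_DERIV[OF C(3)] by simp
  next
    fix x y assume "(x, y) \<in> grid_box y0 x0 k n \<epsilon>"
    then show "\<bar>case (x, y) of (x, y) \<Rightarrow> D2 f (y, x)\<bar> \<le> L" using B sw by (auto intro: bound)
  qed (auto intro: w sw)
qed

text \<open>\<open>count_const\<close> is the error of the grid counts in units of the mesh, and \<open>curv_const\<close> that of the length
  in units of the cubed block side; the latter is half the square of the constant in \<open>\<kappa> = O(\<delta>)\<close>.\<close>
definition "count_const = 10 + L / c"
definition "curv_const = (2 * K / (2 * c) * (1 + L / (2 * c)))\<^sup>2 / 2"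

text \<open>At the given point of the level set one of the partial derivatives is large, and its sign persists on
  the box. If it is the vertical one, the columns are steep; otherwise the coordinates are exchanged.
  In either case the derivatives along the rows satisfy one of the alternatives for quasiconvexity or
  quasiconcavity, for the same reason.\<close>
lemma grid_box_estimate:
  assumes e: "\<epsilon> > 0" and B: "grid_box x0 y0 n k \<epsilon> \<subseteq> square t"
    and d: "real n * \<epsilon> \<le> \<delta>" "real k * \<epsilon> \<le> \<delta>" "2 * \<delta> < \<rho>"
    and s0: "s0 \<in> grid_box x0 y0 n k \<epsilon>" "f s0 = u"
  shows "box_estimate (\<lambda>s. f s - u) x0 y0 n k \<epsilon> (count_const * \<epsilon> + curv_const * \<delta> ^ 3)"
proof -
  have close: "dist s s0 < \<rho>" if "s \<in> grid_box x0 y0 n k \<epsilon>" for s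
  proof -
    obtain x y x' y' where e: "s = (x, y)" "s0 = (x', y')" by fastforce
    have "\<bar>x - x'\<bar> \<le> \<delta>" "\<bar>y - y'\<bar> \<le> \<delta>" using that s0 d by (auto simp: e grid_box_def abs_le_iff)
    moreover have "dist s s0 \<le> \<bar>x - x'\<bar> + \<bar>y - y'\<bar>"
      unfolding e dist_Pair_Pair dist_real_def using sqrt_sum_squares_le_sum_abs[of "\<bar>x - x'\<bar>" "\<bar>y - y'\<bar>"] by simp
    ultimately show ?thesis using d by linarith
  qed
  have sT: "s0 \<in> square t" using s0 B by auto
  have U: "\<bar>D1 f s - D1 f s0\<bar> < c \<and> \<bar>D2 f s - D2 f s0\<bar> < c \<and> \<bar>D1 (D1 f) s - D1 (D1 f) s0\<bar> < c \<and> \<bar>D2 (D2 f) s - D2 (D2 f) s0\<bar> < c"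
    if "s \<in> grid_box x0 y0 n k \<epsilon>" for s using unif[OF _ sT close[OF that]] that B by blast
  have sgn: "(\<forall>s\<in>grid_box x0 y0 n k \<epsilon>. 2 * c \<le> h s) \<or> (\<forall>s\<in>grid_box x0 y0 n k \<epsilon>. h s \<le> - (2 * c))"
    if h: "3 * c \<le> \<bar>h s0\<bar>" "\<And>s. s \<in> grid_box x0 y0 n k \<epsilon> \<Longrightarrow> \<bar>h s - h s0\<bar> < c" for h :: "real \<times> real \<Rightarrow> real"
  proof (cases "h s0 \<ge> 0")
    case True
    then have "2 * c \<le> h s" if "s \<in> grid_box x0 y0 n k \<epsilon>" for s
      using h(1) h(2)[OF that] by linarith
    then show ?thesis by blast
  next
    case False
    then have "h s \<le> - (2 * c)" if "s \<in> grid_box x0 y0 n k \<epsilon>" for s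
      using h(1) h(2)[OF that] by linarith
    then show ?thesis by blast
  qed
  have sgn': "(\<forall>s\<in>grid_box x0 y0 n k \<epsilon>. 0 < h s) \<or> (\<forall>s\<in>grid_box x0 y0 n k \<epsilon>. h s < 0)"
    if h: "3 * c \<le> \<bar>h s0\<bar>" "\<And>s. s \<in> grid_box x0 y0 n k \<epsilon> \<Longrightarrow> \<bar>h s - h s0\<bar> < c" for h :: "real \<times> real \<Rightarrow> real"
  proof -
    have "(\<forall>s\<in>grid_box x0 y0 n k \<epsilon>. 2 * c \<le> h s) \<or> (\<forall>s\<in>grid_box x0 y0 n k \<epsilon>. h s \<le> - (2 * c))"
      by (rule sgn) (fact h)+
    then show ?thesis using c0 by force
  qed
  have nd: "(3 * c \<le> \<bar>D1 f s0\<bar> \<or> 3 * c \<le> \<bar>D2 f s0\<bar>)" "(3 * c \<le> \<bar>D1 f s0\<bar> \<or> 3 * c \<le> \<bar>D1 (D1 f) s0\<bar>)"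
       "(3 * c \<le> \<bar>D2 f s0\<bar> \<or> 3 * c \<le> \<bar>D2 (D2 f) s0\<bar>)"
    using nondegenerate[OF sT s0(2)] by auto
  have c2: "2 * c > 0" using c0 by simp
  have d0: "0 \<le> \<delta>" using d(1) e by (meson mult_nonneg_nonneg of_nat_0_le_iff order_trans less_imp_le)
  have err: "\<epsilon> * (10 + 2 * L / (2 * c)) + (2 * K * \<delta> / (2 * c) * (1 + L / (2 * c)))\<^sup>2 / 2 * z \<le> count_const * \<epsilon> + curv_const * \<delta> ^ 3"
    if "z \<le> \<delta>" for z
  proof -
    have "(2 * K * \<delta> / (2 * c) * (1 + L / (2 * c)))\<^sup>2 / 2 * z \<le> (2 * K * \<delta> / (2 * c) * (1 + L / (2 * c)))\<^sup>2 / 2 * \<delta>"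
      using that by (intro mult_left_mono) auto
    also have "\<dots> = curv_const * \<delta> ^ 3" unfolding curv_const_def by (simp add: power2_eq_square power3_eq_cube)
    finally show ?thesis by (simp add: count_const_def)
  qed
  show ?thesis
  proof (cases "3 * c \<le> \<bar>D2 f s0\<bar>")
    case True
    have s2: "(\<forall>s\<in>grid_box x0 y0 n k \<epsilon>. 2 * c \<le> D2 f s) \<or> (\<forall>s\<in>grid_box x0 y0 n k \<epsilon>. D2 f s \<le> - (2 * c))"
      by (rule sgn[of "D2 f"]) (use U True in blast)+
    have "box_estimate (\<lambda>s. f s - u) x0 y0 n k \<epsilon> (\<epsilon> * (10 + 2 * L / (2 * c)) + (2 * K * \<delta> / (2 * c) * (1 + L / (2 * c)))\<^sup>2 / 2 * (real n * \<epsilon>))"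
    proof (rule regular_box_estimate_vertical[OF regular_box_grid(1)[OF B d(1,2)] c2 e s2])
      show "(\<forall>s\<in>grid_box x0 y0 n k \<epsilon>. 0 < D1 f s) \<or> (\<forall>s\<in>grid_box x0 y0 n k \<epsilon>. D1 f s < 0) \<or>
       (\<forall>s\<in>grid_box x0 y0 n k \<epsilon>. 0 < D1 (D1 f) s) \<or> (\<forall>s\<in>grid_box x0 y0 n k \<epsilon>. D1 (D1 f) s < 0)"
        using nd(2)
      proof (elim disjE)
        assume "3 * c \<le> \<bar>D1 f s0\<bar>"
        then have "(\<forall>s\<in>grid_box x0 y0 n k \<epsilon>. 0 < D1 f s) \<or> (\<forall>s\<in>grid_box x0 y0 n k \<epsilon>. D1 f s < 0)"
          using U by (intro sgn'[of "D1 f"]) blast+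
        then show ?thesis by blast
      next
        assume "3 * c \<le> \<bar>D1 (D1 f) s0\<bar>"
        then have "(\<forall>s\<in>grid_box x0 y0 n k \<epsilon>. 0 < D1 (D1 f) s) \<or> (\<forall>s\<in>grid_box x0 y0 n k \<epsilon>. D1 (D1 f) s < 0)"
          using U by (intro sgn'[of "D1 (D1 f)"]) blast+
        then show ?thesis by blast
      qed
    qed
    then show ?thesis using err[OF d(1)] by (rule box_estimate_mono)
  next
    case False
    have sw: "(y, x) \<in> grid_box x0 y0 n k \<epsilon>" if "(x, y) \<in> grid_box y0 x0 k n \<epsilon>" for x y
      using that by (auto simp: grid_box_def)
    have sb: "(\<forall>s\<in>grid_box y0 x0 k n \<epsilon>. P (case s of (x, y) \<Rightarrow> h (y, x)))" if "\<forall>s\<in>grid_box x0 y0 n k \<epsilon>. P (h s)" for P and h :: "real \<times> real \<Rightarrow> real"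
      using that sw by auto
    have "box_estimate (\<lambda>(x, y). f (y, x) - u) y0 x0 k n \<epsilon> (\<epsilon> * (10 + 2 * L / (2 * c)) + (2 * K * \<delta> / (2 * c) * (1 + L / (2 * c)))\<^sup>2 / 2 * (real k * \<epsilon>))"
    proof (rule regular_box_estimate_vertical[OF regular_box_grid(2)[OF B d(1,2)] c2 e])
      have "3 * c \<le> \<bar>D1 f s0\<bar>" using nd(1) False by auto
      then have "(\<forall>s\<in>grid_box x0 y0 n k \<epsilon>. 2 * c \<le> D1 f s) \<or> (\<forall>s\<in>grid_box x0 y0 n k \<epsilon>. D1 f s \<le> - (2 * c))"
        using U by (intro sgn[of "D1 f"]) blast+
      then show "(\<forall>s\<in>grid_box y0 x0 k n \<epsilon>. 2 * c \<le> (case s of (x, y) \<Rightarrow> D1 f (y, x))) \<or>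
          (\<forall>s\<in>grid_box y0 x0 k n \<epsilon>. (case s of (x, y) \<Rightarrow> D1 f (y, x)) \<le> - (2 * c))"
        using sb[of "\<lambda>v. 2 * c \<le> v" "D1 f"] sb[of "\<lambda>v. v \<le> - (2 * c)" "D1 f"] by blast
      have "3 * c \<le> \<bar>D2 (D2 f) s0\<bar>" using nd(3) False by auto
      then have "(\<forall>s\<in>grid_box x0 y0 n k \<epsilon>. 0 < D2 (D2 f) s) \<or> (\<forall>s\<in>grid_box x0 y0 n k \<epsilon>. D2 (D2 f) s < 0)"
        using U by (intro sgn'[of "D2 (D2 f)"]) blast+
      then show "(\<forall>s\<in>grid_box y0 x0 k n \<epsilon>. 0 < (case s of (x, y) \<Rightarrow> D2 f (y, x))) \<or> (\<forall>s\<in>grid_box y0 x0 k n \<epsilon>. (case s of (x, y) \<Rightarrow> D2 f (y, x)) < 0) \<or>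
       (\<forall>s\<in>grid_box y0 x0 k n \<epsilon>. 0 < (case s of (x, y) \<Rightarrow> D2 (D2 f) (y, x))) \<or> (\<forall>s\<in>grid_box y0 x0 k n \<epsilon>. (case s of (x, y) \<Rightarrow> D2 (D2 f) (y, x)) < 0)"
        using sb[of "\<lambda>v. 0 < v" "D2 (D2 f)"] sb[of "\<lambda>v. v < 0" "D2 (D2 f)"] by blast
    qed
    from box_estimate_mono[OF this err[OF d(2)]] show ?thesis by (rule box_estimate_swap)
  qed
qed

end

section \<open>Counting the blocks that meet the level set\<close>

lemma card_close_multiples_le:
  fixes \<kappa> :: real
  assumes "finite S" "m > 0" "\<And>b. b \<in> S \<Longrightarrow> m dvd b" "0 \<le> \<kappa>"
    and close: "\<And>b b'. b \<in> S \<Longrightarrow> b' \<in> S \<Longrightarrow> b \<le> b' \<Longrightarrow> real (b' - b) \<le> \<kappa> * real m"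
  shows "real (card S) \<le> \<kappa> + 1"
proof (cases "S = {}")
  case False
  define b0 where "b0 = Min S"
  have b0: "b0 \<in> S" "\<And>b. b \<in> S \<Longrightarrow> b0 \<le> b" using False assms(1) by (auto simp: b0_def)
  have mult: "m * ((b - b0) div m) = b - b0" if "b \<in> S" for b
    using assms(3)[OF that] assms(3)[OF b0(1)] by (simp add: dvd_diff_nat)
  have "(b - b0) div m \<le> nat \<lfloor>\<kappa>\<rfloor>" if "b \<in> S" for b
  proof -
    have "real m * real ((b - b0) div m) = real (b - b0)" by (metis mult[OF that] of_nat_mult)
    also have "\<dots> \<le> \<kappa> * real m" using close[OF b0(1) that b0(2)[OF that]] .
    finally have "real ((b - b0) div m) \<le> \<kappa>" using \<open>m > 0\<close> by (simp add: mult.commute)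
    then show ?thesis by (simp add: le_nat_floor)
  qed
  then have "(\<lambda>b. (b - b0) div m) ` S \<subseteq> {..nat \<lfloor>\<kappa>\<rfloor>}" by auto
  moreover have "inj_on (\<lambda>b. (b - b0) div m) S"
    by (intro inj_onI) (metis b0(2) mult diff_add_inverse2 le_add_diff_inverse2)
  ultimately have "card S \<le> card {..nat \<lfloor>\<kappa>\<rfloor>}" by (intro card_inj_on_le) auto
  then have "real (card S) \<le> real (nat \<lfloor>\<kappa>\<rfloor>) + 1" by simp
  also have "\<dots> \<le> \<kappa> + 1" using assms(4) by simp
  finally show ?thesis .
qed (use assms in auto)

text \<open>The range is cut into cells of length \<open>\<rho>\<close>, in each of which the previous bound applies.\<close>
lemma card_locally_close_multiples_le:
  fixes \<kappa> \<epsilon> \<rho> :: real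
  assumes S: "S \<subseteq> {..Q}" and m: "m > 0" "\<And>b. b \<in> S \<Longrightarrow> m dvd b" and k: "0 \<le> \<kappa>" and e: "\<epsilon> > 0" "\<rho> > 0"
    and close: "\<And>b b'. b \<in> S \<Longrightarrow> b' \<in> S \<Longrightarrow> b \<le> b' \<Longrightarrow> real (b' - b) * \<epsilon> < \<rho> \<Longrightarrow> real (b' - b) \<le> \<kappa> * real m"
  shows "real (card S) \<le> (real Q * \<epsilon> / \<rho> + 1) * (\<kappa> + 1)"
proof -
  define cell where "cell = (\<lambda>b::nat. nat \<lfloor>real b * \<epsilon> / \<rho>\<rfloor>)"
  define l where "l = nat \<lfloor>real Q * \<epsilon> / \<rho>\<rfloor>"
  have fin: "finite S" using S finite_subset by blast
  have "cell b \<le> l" if "b \<in> S" for b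
  proof -
    have "real b * \<epsilon> / \<rho> \<le> real Q * \<epsilon> / \<rho>"
      using that S e by (intro divide_right_mono mult_right_mono) auto
    then show ?thesis unfolding cell_def l_def by (intro nat_mono floor_mono)
  qed
  then have "S = (\<Union>i\<le>l. {b\<in>S. cell b = i})" by auto
  then have "card S \<le> (\<Sum>i\<le>l. card {b\<in>S. cell b = i})" by (metis card_UN_le finite_atMost)
  then have "real (card S) \<le> (\<Sum>i\<le>l. real (card {b\<in>S. cell b = i}))" by (metis of_nat_le_iff of_nat_sum)
  also have "\<dots> \<le> (\<Sum>i\<le>l. \<kappa> + 1)"
  proof (rule sum_mono)
    fix i assume "i \<in> {..l}"
    show "real (card {b\<in>S. cell b = i}) \<le> \<kappa> + 1"
    proof (rule card_close_multiples_le[where m = m])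
      fix b b' assume b: "b \<in> {b\<in>S. cell b = i}" "b' \<in> {b\<in>S. cell b = i}" "b \<le> b'"
      have "0 \<le> real b * \<epsilon> / \<rho>" "0 \<le> real b' * \<epsilon> / \<rho>" using e by auto
      moreover have "nat \<lfloor>real b * \<epsilon> / \<rho>\<rfloor> = nat \<lfloor>real b' * \<epsilon> / \<rho>\<rfloor>" using b by (simp add: cell_def)
      ultimately have "real b' * \<epsilon> / \<rho> < real b * \<epsilon> / \<rho> + 1" by linarith
      then have "real b' * \<epsilon> < real b * \<epsilon> + \<rho>" using e by (simp add: field_simps)
      then have "real (b' - b) * \<epsilon> < \<rho>" using b(3) by (simp add: of_nat_diff left_diff_distrib)
      then show "real (b' - b) \<le> \<kappa> * real m" using b by (intro close) auto
    qed (use fin m k in auto)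
  qed
  also have "\<dots> = (real l + 1) * (\<kappa> + 1)" by simp
  also have "\<dots> \<le> (real Q * \<epsilon> / \<rho> + 1) * (\<kappa> + 1)"
    using e k by (intro mult_right_mono) (auto simp: l_def)
  finally show ?thesis .
qed

text \<open>Along a column, points where the field is within \<open>O(\<delta>)\<close> of the level and has a large derivative are
  either within \<open>O(\<delta>)\<close> of each other or at least \<open>\<rho>\<close> apart, because in between the derivative keeps
  its sign. So only boundedly many corners of blocks in one column can be of this kind.\<close>
lemma card_near_level_le:
  fixes r r1 :: "real \<Rightarrow> real"
  assumes d: "\<And>y. (r has_real_derivative r1 y) (at y)"
    and unif: "\<And>y y'. y \<in> {-t..t} \<Longrightarrow> y' \<in> {-t..t} \<Longrightarrow> \<bar>y - y'\<bar> < \<rho> \<Longrightarrow> \<bar>r1 y - r1 y'\<bar> < c"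
    and c: "c > 0" "\<rho> > 0" "\<epsilon> > 0" "0 \<le> L" "m > 0" and Q: "real Q * \<epsilon> = 2 * t"
  shows "real (card {b. b \<le> Q \<and> m dvd b \<and> 2 * c \<le> \<bar>r1 (-t + real b * \<epsilon>)\<bar> \<and>
      \<bar>r (-t + real b * \<epsilon>) - u\<bar> \<le> 2 * L * (real m * \<epsilon>)}) \<le> (2 * t / \<rho> + 1) * (4 * L / c + 1)"
proof -
  have "real (card {b. b \<le> Q \<and> m dvd b \<and> 2 * c \<le> \<bar>r1 (-t + real b * \<epsilon>)\<bar> \<and>
      \<bar>r (-t + real b * \<epsilon>) - u\<bar> \<le> 2 * L * (real m * \<epsilon>)}) \<le> (real Q * \<epsilon> / \<rho> + 1) * (4 * L / c + 1)"
  proof (rule card_locally_close_multiples_le[where m = m])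
    fix b b' assume b: "b \<in> {b. b \<le> Q \<and> m dvd b \<and> 2 * c \<le> \<bar>r1 (-t + real b * \<epsilon>)\<bar> \<and>
      \<bar>r (-t + real b * \<epsilon>) - u\<bar> \<le> 2 * L * (real m * \<epsilon>)}"
      "b' \<in> {b. b \<le> Q \<and> m dvd b \<and> 2 * c \<le> \<bar>r1 (-t + real b * \<epsilon>)\<bar> \<and>
      \<bar>r (-t + real b * \<epsilon>) - u\<bar> \<le> 2 * L * (real m * \<epsilon>)}"
      and le: "b \<le> b'" and near: "real (b' - b) * \<epsilon> < \<rho>"
    define y where "y = -t + real b * \<epsilon>" define y' where "y' = -t + real b' * \<epsilon>"
    have yy: "y' - y = real (b' - b) * \<epsilon>" using le by (simp add: y_def y'_def of_nat_diff left_diff_distrib)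
    have "real b' * \<epsilon> \<le> real Q * \<epsilon>" using b c by (intro mult_right_mono) auto
    moreover have "0 \<le> real b * \<epsilon>" "0 \<le> real (b' - b) * \<epsilon>" using c by auto
    ultimately have range: "-t \<le> y" "y \<le> y'" "y' \<le> t" using Q yy by (auto simp: y_def y'_def)
    obtain \<xi> where xi: "\<xi> \<in> {y..y'}" "r y' - r y = r1 \<xi> * (y' - y)"
      by (rule mean_value_any_order[where a = y and b = y' and r = r and ?r1.0 = r1 and x = y and x' = y']) (use d range in auto)
    have "\<bar>r1 \<xi> - r1 y\<bar> < c" using xi range near yy by (intro unif) auto
    moreover have "2 * c \<le> \<bar>r1 y\<bar>" using b by (simp add: y_def)
    ultimately have "c \<le> \<bar>r1 \<xi>\<bar>" by linarith
    then have "c * (y' - y) \<le> \<bar>r y' - r y\<bar>" unfolding xi(2) abs_mult using range by (intro mult_mono) auto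
    also have "\<dots> \<le> 4 * L * (real m * \<epsilon>)" using b by (simp add: y_def y'_def abs_le_iff)
    finally have "c * real (b' - b) * \<epsilon> \<le> (4 * L * real m) * \<epsilon>" unfolding yy by (simp add: mult.assoc)
    then have "c * real (b' - b) \<le> 4 * L * real m" using c by simp
    then show "real (b' - b) \<le> 4 * L / c * real m" using c by (simp add: field_simps)
  qed (use c in auto)
  then show ?thesis by (simp add: Q)
qed

lemma card_multiples_le:
  assumes "m > 0" shows "real (card {a. a \<le> Q \<and> m dvd a}) \<le> real Q / real m + 1"
proof -
  have "{a. a \<le> Q \<and> m dvd a} \<subseteq> (\<lambda>k. m * k) ` {..Q div m}"
    using assms by (auto simp: dvd_def less_eq_div_iff_mult_less_eq mult.commute)
  then have "card {a. a \<le> Q \<and> m dvd a} \<le> card ((\<lambda>k. m * k) ` {..Q div m})" by (intro card_mono) auto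
  also have "\<dots> \<le> Q div m + 1" using card_image_le[of "{..Q div m}" "\<lambda>k. m * k"] by simp
  finally have "real (card {a. a \<le> Q \<and> m dvd a}) \<le> real (Q div m) + 1" by linarith
  also have "real (Q div m) \<le> real Q / real m" by (metis of_nat_div_le_of_nat)
  finally show ?thesis by simp
qed

lemma grid_size_eq:
  assumes t: "t > 0" and e: "\<epsilon> > 0" and corners: "{-t, t} \<times> {-t, t} \<subseteq> grid t \<epsilon>"
  obtains Q where "real Q * \<epsilon> = 2 * t" "grid_size t \<epsilon> = Suc Q"
proof -
  have "(t, t) \<in> grid t \<epsilon>" using corners by auto
  then obtain Q where Q: "t = - t + real Q * \<epsilon>" by (auto simp: grid_def grid_point_def)
  have "fst ` grid t \<epsilon> = (\<lambda>i. - t + real i * \<epsilon>) ` {..Q}"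
  proof (intro equalityI subsetI)
    fix x assume "x \<in> fst ` grid t \<epsilon>"
    then obtain i where i: "x = - t + real i * \<epsilon>" "x \<le> t"
      unfolding grid_def grid_point_def square_def by fastforce
    then have "real i * \<epsilon> \<le> real Q * \<epsilon>" using Q by linarith
    then show "x \<in> (\<lambda>i. - t + real i * \<epsilon>) ` {..Q}" using e i by auto
  next
    fix x assume "x \<in> (\<lambda>i. - t + real i * \<epsilon>) ` {..Q}"
    then obtain i where i: "i \<le> Q" "x = - t + real i * \<epsilon>" by auto
    then have "real i * \<epsilon> \<le> real Q * \<epsilon>" using e by (intro mult_right_mono) auto
    then have "x \<le> t" using i Q by linarith
    then have "grid_point t \<epsilon> i 0 \<in> grid t \<epsilon>" using i e t by (auto simp: grid_def grid_point_def square_iff)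
    then show "x \<in> fst ` grid t \<epsilon>" using i by (force simp: grid_point_def)
  qed
  then have "grid_size t \<epsilon> = card ((\<lambda>i. - t + real i * \<epsilon>) ` {..Q})" by (simp add: grid_size_def)
  also have "\<dots> = Suc Q" using e by (subst card_image) (auto simp: inj_on_def)
  finally show thesis using Q that by auto
qed

section \<open>The estimator on a fine grid\<close>

locale regular_grid = regular_level +
  fixes \<epsilon> :: real and m Q :: nat
  assumes e0: "\<epsilon> > 0" and m0: "m > 0" and Q: "real Q * \<epsilon> = 2 * t" and size: "grid_size t \<epsilon> = Suc Q"
    and fine: "2 * (real m * \<epsilon>) < \<rho>"
begin

definition "\<delta> = real m * \<epsilon>"
definition "X a = - t + real a * \<epsilon>" for a :: nat
text \<open>The last block of a row or column may be truncated at the boundary of the square, and if \<open>m\<close>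
  divides \<open>Q\<close> there is one that starts on the boundary and has zero width.\<close>
definition "steps a = min (a + m) Q - a" for a
definition "starts = {a. a \<le> Q \<and> m dvd a}"
definition "block a b = grid_box (X a) (X b) (steps a) (steps b) \<epsilon>"
definition "open_block a b = open_grid_box (X a) (X b) (steps a) (steps b) \<epsilon>"
definition "level = {s\<in>square t. f s = u}"
definition "heaviside = (\<lambda>v::real. if 0 \<le> v then 1 else 0 :: real)"
definition "Z a b = sample heaviside (\<lambda>s. f s - u) (X a) (X b) \<epsilon>"
definition "met = {(a, b) \<in> starts \<times> starts. block a b \<inter> level \<noteq> {}}"

lemma heaviside: "threshold heaviside"
  by (auto simp: threshold_def heaviside_def mono_def)

lemma block_starts: "block_starts t \<epsilon> m = starts"
  by (auto simp: block_starts_def starts_def size)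

lemma finite_starts: "finite starts" by (simp add: starts_def)

lemma finite_met: "finite met"
  by (rule finite_subset[of _ "starts \<times> starts"]) (auto simp: met_def finite_starts)

lemma d0: "\<delta> > 0" using e0 m0 by (simp add: \<delta>_def)

lemma X_end: assumes "a \<le> Q" shows "X a + real (steps a) * \<epsilon> = X (min (a + m) Q)"
  using assms by (simp add: X_def steps_def of_nat_diff left_diff_distrib)

lemma X_mono: "a \<le> b \<Longrightarrow> X a \<le> X b" using e0 by (simp add: X_def)

lemma XQ: "X Q = t" and X0: "X 0 = - t" using Q by (simp_all add: X_def)

lemma X_range: assumes "a \<le> Q" shows "- t \<le> X a" "X a \<le> t"
  using X_mono[of 0 a] X_mono[OF assms] by (simp_all add: XQ X0)

lemma steps_le: "real (steps a) * \<epsilon> \<le> \<delta>"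
  unfolding \<delta>_def using e0 by (intro mult_right_mono) (auto simp: steps_def)

lemma block_eq: "a \<le> Q \<Longrightarrow> b \<le> Q \<Longrightarrow> block a b = {X a..X (min (a + m) Q)} \<times> {X b..X (min (b + m) Q)}"
  and open_block_eq: "a \<le> Q \<Longrightarrow> b \<le> Q \<Longrightarrow> open_block a b = {X a<..<X (min (a + m) Q)} \<times> {X b<..<X (min (b + m) Q)}"
  by (simp_all add: block_def open_block_def grid_box_def open_grid_box_def X_end)

lemma startsD: "a \<in> starts \<Longrightarrow> a \<le> Q" "a \<in> starts \<Longrightarrow> m dvd a" by (auto simp: starts_def)

lemma block_subset: assumes "a \<in> starts" "b \<in> starts" shows "block a b \<subseteq> square t"
proof -
  have "X (min (a + m) Q) \<le> t" "X (min (b + m) Q) \<le> t" by (auto intro: X_range)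
  then show ?thesis
    using X_range(1)[OF startsD(1)[OF assms(1)]] X_range(1)[OF startsD(1)[OF assms(2)]]
    unfolding block_eq[OF startsD(1)[OF assms(1)] startsD(1)[OF assms(2)]] square_def by auto
qed

lemma corner_in_block: assumes "a \<in> starts" "b \<in> starts" shows "(X a, X b) \<in> block a b"
  unfolding block_eq[OF startsD(1)[OF assms(1)] startsD(1)[OF assms(2)]]
  using startsD(1)[OF assms(1)] startsD(1)[OF assms(2)] by (auto intro!: X_mono)

lemma start_of:
  assumes "- t \<le> x" "x \<le> t"
  obtains a where "a \<in> starts" "X a \<le> x" "x \<le> X (min (a + m) Q)"
proof -
  define i where "i = nat \<lfloor>(x + t) / \<epsilon>\<rfloor>"
  have nn: "0 \<le> (x + t) / \<epsilon>" using assms e0 by auto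
  have i: "real i \<le> (x + t) / \<epsilon>" "(x + t) / \<epsilon> < real i + 1" using nn by (auto simp: i_def) 
  have i': "real i * \<epsilon> \<le> x + t" "x + t \<le> (real i + 1) * \<epsilon>" using i e0 by (auto simp: field_simps)
  have "real i * \<epsilon> \<le> real Q * \<epsilon>" using i' assms Q by linarith
  then have iQ: "i \<le> Q" using e0 by simp
  define a where "a = m * (i div m)"
  have a: "a \<le> i" "i < a + m" using mult_div_mod_eq[of m i] mod_less_divisor[OF m0, of i] unfolding a_def by linarith+
  show thesis
  proof (rule that[of a])
    show "a \<in> starts" using order_trans[OF a(1) iQ] by (simp add: starts_def) (simp add: a_def)
    have "X a \<le> X i" using a by (intro X_mono)
    then show "X a \<le> x" using i'(1) by (simp add: X_def)
    have "x \<le> X (Suc i)" using i'(2) by (simp add: X_def algebra_simps)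
    also have "X (Suc i) \<le> X (a + m)" using a by (intro X_mono) auto
    finally show "x \<le> X (min (a + m) Q)" using assms(2) by (simp add: min_def XQ)
  qed
qed

lemma level_cover: "level \<subseteq> (\<Union>(a, b)\<in>met. {s\<in>block a b. f s - u = 0})"
proof
  fix s assume s: "s \<in> level"
  obtain x y where xy: "s = (x, y)" by fastforce
  have "- t \<le> x" "x \<le> t" "- t \<le> y" "y \<le> t" using s by (auto simp: level_def xy square_iff)
  then obtain a b where ab: "a \<in> starts" "X a \<le> x" "x \<le> X (min (a + m) Q)" "b \<in> starts" "X b \<le> y" "y \<le> X (min (b + m) Q)"
    by (metis start_of)
  then have "s \<in> block a b" by (simp add: block_eq startsD xy)
  moreover from this have "(a, b) \<in> met" using s ab by (auto simp: met_def)
  ultimately show "s \<in> (\<Union>(a, b)\<in>met. {s\<in>block a b. f s - u = 0})" using s by (auto simp: level_def)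
qed

lemma open_block_disjoint:
  assumes "a \<in> starts" "b \<in> starts" "a' \<in> starts" "b' \<in> starts" "(a, b) \<noteq> (a', b')"
  shows "open_block a b \<inter> open_block a' b' = {}"
proof -
  have *: "X (min (a + m) Q) \<le> X a'" if "a \<in> starts" "a' \<in> starts" "a < a'" for a a'
  proof -
    have "m dvd a' - a" using that by (auto simp: starts_def)
    then have "a + m \<le> a'" using that(3) by (auto dest!: dvd_imp_le)
    then show ?thesis by (intro X_mono) auto
  qed
  then have D: "{X a<..<X (min (a + m) Q)} \<inter> {X a'<..<X (min (a' + m) Q)} = {}" if "a \<in> starts" "a' \<in> starts" "a \<noteq> a'" for a a'
    using *[OF that(1,2)] *[OF that(2,1)] that(3) by (cases "a < a'") auto
  have "a \<noteq> a' \<or> b \<noteq> b'" using assms(5) by blast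
  then show ?thesis
    unfolding open_block_eq[OF startsD(1)[OF assms(1)] startsD(1)[OF assms(2)]]
      open_block_eq[OF startsD(1)[OF assms(3)] startsD(1)[OF assms(4)]] Times_Int_Times
    using D[OF assms(1,3)] D[OF assms(2,4)] by (elim disjE) (simp_all only: Times_empty simp_thms)
qed

lemma open_block_subset: assumes "a \<in> starts" "b \<in> starts" shows "open_block a b \<subseteq> square t"
proof -
  have "open_block a b \<subseteq> block a b" using assms by (auto simp: open_block_eq block_eq startsD)
  then show ?thesis using block_subset[OF assms] by blast
qed

lemma block_estimate:
  assumes "(a, b) \<in> met"
  shows "box_estimate (\<lambda>s. f s - u) (X a) (X b) (steps a) (steps b) \<epsilon> (count_const * \<epsilon> + curv_const * \<delta> ^ 3)"
proof -
  obtain s0 where s0: "s0 \<in> block a b" "f s0 = u" using assms by (auto simp: met_def level_def)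
  have ab: "a \<in> starts" "b \<in> starts" using assms by (auto simp: met_def)
  show ?thesis
    by (rule grid_box_estimate[where ?s0.0 = s0])
      (use e0 block_subset[OF ab] steps_le fine s0 in \<open>auto simp: block_def \<delta>_def\<close>)
qed

lemma zeta_eq: "zeta f t u \<epsilon> (a + i) (b + j) = Z a b i j"
  by (simp add: zeta_def Z_def sample_def heaviside_def X_def grid_point_def algebra_simps)

lemma N_h_eq: "N_h f t u \<epsilon> m a b = (\<Sum>i<min (a + m) (Suc Q) - a. column_changes (Z a b) (steps b) i)"
proof -
  have "N_h f t u \<epsilon> m a b = (\<Sum>i = a..<min (a + m) (Suc Q). \<Sum>j = b..<min (b + m) Q. \<bar>zeta f t u \<epsilon> i j - zeta f t u \<epsilon> i (j + 1)\<bar>)"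
    by (simp add: N_h_def size)
  also have "\<dots> = (\<Sum>i<min (a + m) (Suc Q) - a. \<Sum>j<steps b. \<bar>zeta f t u \<epsilon> (a + i) (b + j) - zeta f t u \<epsilon> (a + i) (b + Suc j)\<bar>)"
    unfolding sum.atLeastLessThan_shift_0[of _ a] sum.atLeastLessThan_shift_0[of _ b] steps_def atLeast0LessThan by simp
  finally show ?thesis unfolding zeta_eq column_changes_def .
qed

lemma N_v_eq: "N_v f t u \<epsilon> m a b = (\<Sum>j<min (b + m) (Suc Q) - b. row_changes (Z a b) (steps a) j)"
proof -
  have "N_v f t u \<epsilon> m a b = (\<Sum>i = a..<min (a + m) Q. \<Sum>j = b..<min (b + m) (Suc Q). \<bar>zeta f t u \<epsilon> i j - zeta f t u \<epsilon> (i + 1) j\<bar>)"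
    by (simp add: N_v_def size)
  also have "\<dots> = (\<Sum>i<steps a. \<Sum>j<min (b + m) (Suc Q) - b. \<bar>zeta f t u \<epsilon> (a + i) (b + j) - zeta f t u \<epsilon> (a + Suc i) (b + j)\<bar>)"
    unfolding sum.atLeastLessThan_shift_0[of _ a] sum.atLeastLessThan_shift_0[of _ b] steps_def atLeast0LessThan by simp
  finally show ?thesis unfolding zeta_eq row_changes_def by (subst sum.swap)
qed

text \<open>The estimator sums over all rows or columns of a block except the last one, which belongs to the next
  block; at the boundary of the square there is no next block and the last one is included.\<close>
lemma truncated_sum_close:
  fixes h :: "nat \<Rightarrow> real"
  assumes "a \<le> Q" and h: "\<And>i. i \<le> steps a \<Longrightarrow> 0 \<le> h i" "\<And>i. i \<le> steps a \<Longrightarrow> h i \<le> 2"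
  shows "\<bar>(\<Sum>i<min (a + m) (Suc Q) - a. h i) - (\<Sum>i\<le>steps a. h i)\<bar> \<le> 2"
proof -
  have "min (a + m) (Suc Q) - a = steps a \<or> min (a + m) (Suc Q) - a = Suc (steps a)"
    using assms(1) by (auto simp: steps_def)
  then show ?thesis
  proof
    assume *: "min (a + m) (Suc Q) - a = steps a"
    have "(\<Sum>i\<le>steps a. h i) = (\<Sum>i<steps a. h i) + h (steps a)" by (simp add: lessThan_Suc_atMost[symmetric])
    then show ?thesis unfolding * using h[of "steps a"] by simp
  next
    assume *: "min (a + m) (Suc Q) - a = Suc (steps a)"
    show ?thesis unfolding * by (simp add: lessThan_Suc_atMost)
  qed
qed

text \<open>On a block without points of the level set the field stays on one side of the level.\<close>
lemma unmet_block_zero: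
  assumes ab: "a \<in> starts" "b \<in> starts" and no: "(a, b) \<notin> met"
  shows "N_h f t u \<epsilon> m a b = 0" "N_v f t u \<epsilon> m a b = 0"
proof -
  have nz: "f s \<noteq> u" if "s \<in> block a b" for s
    using that no ab block_subset[OF ab] by (auto simp: met_def level_def)
  have "connected (f ` block a b)"
    unfolding block_def grid_box_def
    by (intro connected_continuous_image continuous_on_subset[OF C1_continuous[OF C2_imp_C1(1)[OF C2]]] connected_Times) auto
  then have "(\<forall>s\<in>block a b. u \<le> f s) \<or> (\<forall>s\<in>block a b. f s < u)"
    using connectedD_interval[of "f ` block a b" _ _ u] nz by (smt (verit) image_iff)
  then obtain v where v: "\<And>s. s \<in> block a b \<Longrightarrow> heaviside (f s - u) = v"
    by (metis (no_types, opaque_lifting) heaviside_def diff_ge_0_iff_ge linorder_not_le)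
  have Zv: "Z a b i j = v" if "i \<le> steps a" "j \<le> steps b" for i j
    unfolding Z_def sample_def using that e0 by (intro v) (auto simp: block_def grid_box_def)
  have "i \<le> steps a" if "i < min (a + m) (Suc Q) - a" for i a using that by (auto simp: steps_def)
  then show "N_h f t u \<epsilon> m a b = 0" "N_v f t u \<epsilon> m a b = 0"
    unfolding N_h_eq N_v_eq column_changes_def row_changes_def
    by (simp_all add: Zv)
qed

lemma estimator_eq:
  "perimeter_estimator f \<epsilon> m t u = (\<Sum>(a, b)\<in>met. \<epsilon> * norm (N_h f t u \<epsilon> m a b, N_v f t u \<epsilon> m a b))"
proof -
  have "perimeter_estimator f \<epsilon> m t u = (\<Sum>(a, b)\<in>starts \<times> starts. \<epsilon> * norm (N_h f t u \<epsilon> m a b, N_v f t u \<epsilon> m a b))"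
    by (simp add: perimeter_estimator_def block_starts sum.cartesian_product sum_distrib_left case_prod_beta)
  also have "\<dots> = (\<Sum>(a, b)\<in>met. \<epsilon> * norm (N_h f t u \<epsilon> m a b, N_v f t u \<epsilon> m a b))"
    using unmet_block_zero by (intro sum.mono_neutral_right) (auto simp: finite_starts met_def)
  finally show ?thesis .
qed

text \<open>A block that meets the level set is charged to its lower left corner. There the field is within
  \<open>2 L \<delta>\<close> of the level and one partial derivative is still large. According to which one it is, the
  corners are counted by columns or by rows; there are \<open>O(1 / \<delta>)\<close> of these, and each contains boundedly
  many such corners.\<close>
lemma card_met: "real (card met) \<le> 2 * ((2 * t / \<delta> + 1) * ((2 * t / \<rho> + 1) * (4 * L / c + 1)))"
proof -
  define V where "V = (\<lambda>a. {b. b \<le> Q \<and> m dvd b \<and> 2 * c \<le> \<bar>D2 f (X a, - t + real b * \<epsilon>)\<bar> \<and>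
      \<bar>f (X a, - t + real b * \<epsilon>) - u\<bar> \<le> 2 * L * (real m * \<epsilon>)})"
  define H where "H = (\<lambda>b. {a. a \<le> Q \<and> m dvd a \<and> 2 * c \<le> \<bar>D1 f (- t + real a * \<epsilon>, X b)\<bar> \<and>
      \<bar>f (- t + real a * \<epsilon>, X b) - u\<bar> \<le> 2 * L * (real m * \<epsilon>)})"
  let ?N = "(2 * t / \<rho> + 1) * (4 * L / c + 1)"
  note C = C2_imp_C1[OF C2]
  have V: "real (card (V a)) \<le> ?N" if "a \<in> starts" for a
    unfolding V_def
  proof (rule card_near_level_le)
    show "((\<lambda>y. f (X a, y)) has_real_derivative D2 f (X a, y)) (at y)" for y by (rule C1_DERIV[OF C(1)])
    fix y y' assume "y \<in> {- t..t}" "y' \<in> {- t..t}" "\<bar>y - y'\<bar> < \<rho>"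
    then show "\<bar>D2 f (X a, y) - D2 f (X a, y')\<bar> < c"
      using unif[of "(X a, y)" "(X a, y')"] X_range[OF startsD(1)[OF that]]
      by (simp add: square_iff dist_Pair_Pair dist_real_def)
  qed (use c0 \<rho>0 e0 L0 m0 Q in auto)
  have H: "real (card (H b)) \<le> ?N" if "b \<in> starts" for b
    unfolding H_def
  proof (rule card_near_level_le)
    show "((\<lambda>x. f (x, X b)) has_real_derivative D1 f (x, X b)) (at x)" for x by (rule C1_DERIV[OF C(1)])
    fix y y' assume "y \<in> {- t..t}" "y' \<in> {- t..t}" "\<bar>y - y'\<bar> < \<rho>"
    then show "\<bar>D1 f (y, X b) - D1 f (y', X b)\<bar> < c"
      using unif[of "(y, X b)" "(y', X b)"] X_range[OF startsD(1)[OF that]]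
      by (simp add: square_iff dist_Pair_Pair dist_real_def)
  qed (use c0 \<rho>0 e0 L0 m0 Q in auto)
  have fin: "finite (V a)" "finite (H a)" for a by (auto simp: V_def H_def)
  have "met \<subseteq> Sigma starts V \<union> prod.swap ` Sigma starts H"
  proof
    fix p assume p: "p \<in> met"
    obtain a b where ab: "p = (a, b)" "a \<in> starts" "b \<in> starts" using p by (auto simp: met_def)
    obtain x y where s: "(x, y) \<in> block a b" "f (x, y) = u" using p by (auto simp: met_def level_def ab)
    have sT: "(x, y) \<in> square t" "(X a, X b) \<in> square t"
      using s block_subset[OF ab(2,3)] corner_in_block[OF ab(2,3)] by auto
    have "\<bar>x - X a\<bar> \<le> real (steps a) * \<epsilon>" "\<bar>y - X b\<bar> \<le> real (steps b) * \<epsilon>"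
      using s(1) by (auto simp: block_def grid_box_def)
    then have xy: "\<bar>x - X a\<bar> \<le> \<delta>" "\<bar>y - X b\<bar> \<le> \<delta>" using steps_le[of a] steps_le[of b] by auto
    have "dist (X a, X b) (x, y) \<le> \<bar>x - X a\<bar> + \<bar>y - X b\<bar>"
      unfolding dist_Pair_Pair dist_real_def
      using sqrt_sum_squares_le_sum_abs[of "\<bar>X a - x\<bar>" "\<bar>X b - y\<bar>"] by (simp add: abs_minus_commute)
    then have "dist (X a, X b) (x, y) < \<rho>" using xy fine by (simp add: \<delta>_def)
    note U = unif[OF sT(2,1) this]
    have "\<bar>f (X a, X b) - f (x, y)\<bar> \<le> L * (\<bar>X a - x\<bar> + \<bar>X b - y\<bar>)"
      by (rule increment_le[OF C(1) bound sT(2,1)])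
    also have "\<dots> \<le> L * (2 * \<delta>)" using xy L0 by (intro mult_left_mono) (auto simp: abs_minus_commute)
    finally have fu: "\<bar>f (X a, X b) - u\<bar> \<le> 2 * L * (real m * \<epsilon>)" using s(2) by (simp add: \<delta>_def)
    have "3 * c \<le> \<bar>D1 f (x, y)\<bar> \<or> 3 * c \<le> \<bar>D2 f (x, y)\<bar>" using nondegenerate[OF sT(1) s(2)] by blast
    then have "2 * c \<le> \<bar>D1 f (X a, X b)\<bar> \<or> 2 * c \<le> \<bar>D2 f (X a, X b)\<bar>" using U by linarith
    then have "b \<in> V a \<or> a \<in> H b"
      using fu startsD[OF ab(2)] startsD[OF ab(3)] unfolding V_def H_def X_def[symmetric] by blast
    then show "p \<in> Sigma starts V \<union> prod.swap ` Sigma starts H"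
      using ab by (auto simp: image_iff)
  qed
  then have "card met \<le> card (Sigma starts V \<union> prod.swap ` Sigma starts H)"
    using fin finite_starts by (intro card_mono) auto
  also have "\<dots> \<le> card (Sigma starts V) + card (prod.swap ` Sigma starts H)" by (rule card_Un_le)
  also have "\<dots> \<le> card (Sigma starts V) + card (Sigma starts H)"
    using fin finite_starts by (intro add_left_mono card_image_le) auto
  also have "\<dots> = (\<Sum>a\<in>starts. card (V a)) + (\<Sum>a\<in>starts. card (H a))"
    using fin finite_starts by simp
  finally have "real (card met) \<le> (\<Sum>a\<in>starts. real (card (V a))) + (\<Sum>a\<in>starts. real (card (H a)))"
    by (metis of_nat_add of_nat_le_iff of_nat_sum)
  also have "\<dots> \<le> (\<Sum>a\<in>starts. ?N) + (\<Sum>a\<in>starts. ?N)" by (intro add_mono sum_mono V H)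
  also have "\<dots> = 2 * (real (card starts) * ?N)" by simp
  also have "\<dots> \<le> 2 * ((2 * t / \<delta> + 1) * ?N)"
  proof -
    have "real Q / real m = 2 * t / \<delta>" using Q e0 m0 unfolding \<delta>_def by (simp add: field_simps)
    then have "real (card starts) \<le> 2 * t / \<delta> + 1"
      using card_multiples_le[OF m0, of Q] by (simp add: starts_def)
    moreover have "0 \<le> ?N" using t0 \<rho>0 L0 c0 by (intro mult_nonneg_nonneg) auto
    ultimately show ?thesis by (intro mult_left_mono mult_right_mono) auto
  qed
  finally show ?thesis .
qed

text \<open>The approximate lengths \<open>len p\<close> of the blocks are summed. Covering the level set by the closed blocks
  bounds its length from above, the disjoint compact parts in the open blocks bound it from below.\<close>
lemma estimator_error:
  obtains P where "P \<ge> 0" "hausdorff1 level = ennreal P"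
    "\<bar>perimeter_estimator f \<epsilon> m t u - P\<bar> \<le> real (card met) * ((2 * count_const + 4) * \<epsilon> + 2 * curv_const * \<delta> ^ 3)"
proof -
  define \<eta> where "\<eta> = count_const * \<epsilon> + curv_const * \<delta> ^ 3"
  define N where "N = (\<lambda>(a, b). \<epsilon> * norm (N_h f t u \<epsilon> m a b, N_v f t u \<epsilon> m a b))"
  define good where "good = (\<lambda>p len. 0 \<le> len \<and>
     hausdorff1 {s\<in>block (fst p) (snd p). f s - u = 0} \<le> ennreal (len + \<eta>) \<and>
     (\<forall>e>0. \<exists>K. compact K \<and> K \<subseteq> {s\<in>open_block (fst p) (snd p). f s - u = 0} \<and> ennreal (len - e) \<le> hausdorff1 K) \<and>
     \<bar>N p - len\<bar> \<le> \<eta> + 4 * \<epsilon>)"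
  have eta0: "0 \<le> \<eta>" unfolding \<eta>_def count_const_def curv_const_def using e0 d0 L0 c0 by (intro add_nonneg_nonneg mult_nonneg_nonneg) auto
  have "\<exists>len\<ge>0. hausdorff1 {s\<in>block (fst p) (snd p). f s - u = 0} \<le> ennreal (len + \<eta>) \<and>
     (\<forall>e>0. \<exists>K. compact K \<and> K \<subseteq> {s\<in>open_block (fst p) (snd p). f s - u = 0} \<and> ennreal (len - e) \<le> hausdorff1 K) \<and>
     \<bar>N p - len\<bar> \<le> \<eta> + 4 * \<epsilon>" if p: "p \<in> met" for p
  proof -
    obtain a b where ab: "p = (a, b)" by fastforce
    have st: "a \<in> starts" "b \<in> starts" using p by (auto simp: met_def ab)
    obtain len where l: "0 \<le> len" "hausdorff1 {s\<in>block a b. f s - u = 0} \<le> ennreal (len + \<eta>)"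
     "(\<forall>e>0. \<exists>K. compact K \<and> K \<subseteq> {s\<in>open_block a b. f s - u = 0} \<and> ennreal (len - e) \<le> hausdorff1 K)"
     and th: "\<forall>\<theta>. threshold \<theta> \<longrightarrow>
        few_changes (sample \<theta> (\<lambda>s. f s - u) (X a) (X b) \<epsilon>) (steps a) (steps b) \<and>
        \<bar>\<epsilon> * change_norm (sample \<theta> (\<lambda>s. f s - u) (X a) (X b) \<epsilon>) (steps a) (steps b) - len\<bar> \<le> \<eta>"
      using block_estimate[of a b] p
      unfolding ab box_estimate_def block_def[symmetric] open_block_def[symmetric] \<eta>_def[symmetric] by blast
    let ?h = "\<Sum>i\<le>steps a. column_changes (Z a b) (steps b) i"
    let ?v = "\<Sum>j\<le>steps b. row_changes (Z a b) (steps a) j"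
    have th': "(\<forall>i\<le>steps a. column_changes (Z a b) (steps b) i \<le> 2)" "(\<forall>j\<le>steps b. row_changes (Z a b) (steps a) j \<le> 2)"
       "\<bar>\<epsilon> * norm (?h, ?v) - len\<bar> \<le> \<eta>"
      using th[rule_format, OF heaviside] unfolding Z_def[symmetric] by blast+
    have "\<bar>N_h f t u \<epsilon> m a b - ?h\<bar> \<le> 2"
      unfolding N_h_eq
      by (rule truncated_sum_close) (use th' startsD st in \<open>auto simp: column_changes_def intro: sum_nonneg\<close>)
    moreover have "\<bar>N_v f t u \<epsilon> m a b - ?v\<bar> \<le> 2"
      unfolding N_v_eq
      by (rule truncated_sum_close) (use th' startsD st in \<open>auto simp: row_changes_def intro: sum_nonneg\<close>)
    ultimately have "\<bar>norm (N_h f t u \<epsilon> m a b, N_v f t u \<epsilon> m a b) - norm (?h, ?v)\<bar> \<le> 4"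
      using norm_Pair_diff_le[of "N_h f t u \<epsilon> m a b" "N_v f t u \<epsilon> m a b" ?h ?v] by linarith
    then have "\<epsilon> * \<bar>norm (N_h f t u \<epsilon> m a b, N_v f t u \<epsilon> m a b) - norm (?h, ?v)\<bar> \<le> \<epsilon> * 4" using e0 by simp
    then have "\<bar>N p - \<epsilon> * norm (?h, ?v)\<bar> \<le> 4 * \<epsilon>"
      using e0 by (simp add: N_def ab right_diff_distrib[symmetric] abs_mult)
    then have "\<bar>N p - len\<bar> \<le> \<eta> + 4 * \<epsilon>" using th'(3) by linarith
    then show ?thesis using l unfolding ab fst_conv snd_conv by blast
  qed
  then have "\<forall>p\<in>met. \<exists>len. good p len" unfolding good_def by blast
  then obtain len where "\<forall>p\<in>met. good p (len p)" using bchoice by blast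
  then have len: "\<And>p. p \<in> met \<Longrightarrow> 0 \<le> len p"
     "\<And>p. p \<in> met \<Longrightarrow> hausdorff1 {s\<in>block (fst p) (snd p). f s - u = 0} \<le> ennreal (len p + \<eta>)"
     "\<And>p e. p \<in> met \<Longrightarrow> e > 0 \<Longrightarrow> \<exists>K. compact K \<and> K \<subseteq> {s\<in>open_block (fst p) (snd p). f s - u = 0} \<and> ennreal (len p - e) \<le> hausdorff1 K"
     "\<And>p. p \<in> met \<Longrightarrow> \<bar>N p - len p\<bar> \<le> \<eta> + 4 * \<epsilon>"
    unfolding good_def by blast+
  define \<Lambda> where "\<Lambda> = (\<Sum>p\<in>met. len p)"
  have L0: "0 \<le> \<Lambda>" unfolding \<Lambda>_def using len(1) by (intro sum_nonneg)
  have "hausdorff1 level \<le> hausdorff1 (\<Union>p\<in>met. {s\<in>block (fst p) (snd p). f s - u = 0})"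
    using level_cover by (intro hausdorff1_mono) (auto simp: case_prod_beta)
  also have "\<dots> \<le> (\<Sum>p\<in>met. hausdorff1 {s\<in>block (fst p) (snd p). f s - u = 0})"
    by (rule hausdorff1_UN_le[OF finite_met])
  also have "\<dots> \<le> (\<Sum>p\<in>met. ennreal (len p + \<eta>))" by (intro sum_mono len(2))
  also have "\<dots> = ennreal (\<Sum>p\<in>met. len p + \<eta>)" using len(1) eta0 by (intro sum_ennreal) auto
  also have "(\<Sum>p\<in>met. len p + \<eta>) = \<Lambda> + real (card met) * \<eta>" by (simp add: \<Lambda>_def sum.distrib)
  finally have upper: "hausdorff1 level \<le> ennreal (\<Lambda> + real (card met) * \<eta>)" .
  then obtain P where P: "P \<ge> 0" "hausdorff1 level = ennreal P"
    by (cases "hausdorff1 level") (auto simp: top_unique)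
  have "0 \<le> \<Lambda> + real (card met) * \<eta>" using L0 eta0 by simp
  then have Ple: "P \<le> \<Lambda> + real (card met) * \<eta>" using upper P by simp
  have "\<Lambda> \<le> P"
  proof (rule field_le_epsilon)
    fix e :: real assume e: "e > 0"
    \<comment> \<open>The loss is shared among the blocks; adding one avoids division by zero.\<close>
    define e' where "e' = e / (real (card met) + 1)"
    have e': "e' > 0" "real (card met) * e' \<le> e" using e by (auto simp: e'_def field_simps)
    have "\<forall>p\<in>met. \<exists>K. compact K \<and> K \<subseteq> {s\<in>open_block (fst p) (snd p). f s - u = 0} \<and> ennreal (len p - e') \<le> hausdorff1 K"
      using len(3) e'(1) by blast
    then obtain K where "\<forall>p\<in>met. compact (K p) \<and> K p \<subseteq> {s\<in>open_block (fst p) (snd p). f s - u = 0} \<and> ennreal (len p - e') \<le> hausdorff1 (K p)"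
      using bchoice[of met "\<lambda>p K. compact K \<and> K \<subseteq> {s\<in>open_block (fst p) (snd p). f s - u = 0} \<and> ennreal (len p - e') \<le> hausdorff1 K"] by blast
    then have K: "\<And>p. p \<in> met \<Longrightarrow> compact (K p)" "\<And>p. p \<in> met \<Longrightarrow> K p \<subseteq> {s\<in>open_block (fst p) (snd p). f s - u = 0}"
      "\<And>p. p \<in> met \<Longrightarrow> ennreal (len p - e') \<le> hausdorff1 (K p)"
      by blast+
    have disj: "disjoint_family_on K met"
      unfolding disjoint_family_on_def
    proof (intro ballI impI)
      fix p q assume pq: "p \<in> met" "q \<in> met" "p \<noteq> q"
      have "open_block (fst p) (snd p) \<inter> open_block (fst q) (snd q) = {}"
        using pq by (intro open_block_disjoint) (auto simp: met_def prod_eq_iff)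
      then show "K p \<inter> K q = {}" using K(2)[OF pq(1)] K(2)[OF pq(2)] by blast
    qed
    have "ennreal (\<Lambda> - real (card met) * e') = ennreal (\<Sum>p\<in>met. len p - e')" by (simp add: \<Lambda>_def sum_subtractf)
    also have "\<dots> \<le> ennreal (\<Sum>p\<in>met. max 0 (len p - e'))" by (intro ennreal_leI sum_mono) auto
    also have "\<dots> = (\<Sum>p\<in>met. ennreal (max 0 (len p - e')))" by (intro sum_ennreal[symmetric]) auto
    also have "\<dots> = (\<Sum>p\<in>met. ennreal (len p - e'))" by simp
    also have "\<dots> \<le> (\<Sum>p\<in>met. hausdorff1 (K p))" by (intro sum_mono K(3))
    also have "\<dots> \<le> hausdorff1 (\<Union>p\<in>met. K p)" by (intro hausdorff1_disjoint_compact_UN finite_met K(1) disj)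
    also have "\<dots> \<le> hausdorff1 level"
    proof (rule hausdorff1_mono, rule UN_least)
      fix p assume p: "p \<in> met"
      then have "open_block (fst p) (snd p) \<subseteq> square t" by (intro open_block_subset) (auto simp: met_def)
      then show "K p \<subseteq> level" using K(2)[OF p] by (auto simp: level_def)
    qed
    finally have "\<Lambda> - real (card met) * e' \<le> P" using P by (auto simp: ennreal_le_iff2)
    then show "\<Lambda> \<le> P + e" using e'(2) by linarith
  qed
  moreover have "\<bar>perimeter_estimator f \<epsilon> m t u - \<Lambda>\<bar> \<le> real (card met) * (\<eta> + 4 * \<epsilon>)"
  proof -
    have "\<bar>perimeter_estimator f \<epsilon> m t u - \<Lambda>\<bar> = \<bar>\<Sum>p\<in>met. N p - len p\<bar>"
      by (simp add: estimator_eq \<Lambda>_def sum_subtractf N_def)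
    also have "\<dots> \<le> (\<Sum>p\<in>met. \<bar>N p - len p\<bar>)" by (rule sum_abs)
    also have "\<dots> \<le> (\<Sum>p\<in>met. \<eta> + 4 * \<epsilon>)" by (intro sum_mono len(4))
    finally show ?thesis by simp
  qed
  moreover have "0 \<le> real (card met) * \<eta>" using eta0 by simp
  ultimately have "\<bar>perimeter_estimator f \<epsilon> m t u - P\<bar> \<le> real (card met) * (\<eta> + 4 * \<epsilon>) + real (card met) * \<eta>"
    using Ple by linarith
  also have "\<dots> = real (card met) * ((2 * count_const + 4) * \<epsilon> + 2 * curv_const * \<delta> ^ 3)" by (simp add: \<eta>_def algebra_simps)
  finally show thesis using P that by blast
qed

end

section \<open>Convergence\<close>

text \<open>Near a point of the level set with nonzero gradient the field takes smaller values along one of the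
  coordinate axes.\<close>
lemma frontier_excursion:
  assumes C: "C1 f" and nd: "\<And>s. s \<in> T \<Longrightarrow> f s = u \<Longrightarrow> D1 f s \<noteq> 0 \<or> D2 f s \<noteq> 0"
  shows "T \<inter> frontier (excursion f u) = {s\<in>T. f s = u}"
proof -
  have cont: "continuous_on UNIV f" by (rule C1_continuous[OF C])
  have closed: "closed (excursion f u)"
    unfolding excursion_def by (intro closed_Collect_le continuous_on_const cont)
  have "open {s. u < f s}" by (intro open_Collect_less continuous_on_const cont)
  then have int: "{s. u < f s} \<subseteq> interior (excursion f u)"
    by (intro interior_maximal) (auto simp: excursion_def)
  have line: "\<exists>h. \<bar>h\<bar> < d \<and> r (z + h) < r z" if r: "(r has_real_derivative l) (at z)" and l: "l \<noteq> 0" and d: "d > 0" for r :: "real \<Rightarrow> real" and l z d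
  proof (cases "l > 0")
    case True
    obtain e where e: "e > 0" "\<forall>h>0. h < e \<longrightarrow> r (z - h) < r z"
      using DERIV_pos_inc_left[OF r True] by blast
    show ?thesis using e d by (intro exI[of _ "- (min d e / 2)"]) auto
  next
    case False
    then have "l < 0" using l by simp
    then obtain e where e: "e > 0" "\<forall>h>0. h < e \<longrightarrow> r (z + h) < r z"
      using DERIV_neg_dec_right[OF r] by blast
    show ?thesis using e d by (intro exI[of _ "min d e / 2"]) auto
  qed
  have notint: "s \<notin> interior (excursion f u)" if s: "s \<in> T" "f s = u" for s
  proof
    assume "s \<in> interior (excursion f u)"
    then obtain d where d: "d > 0" "ball s d \<subseteq> excursion f u" by (auto simp: mem_interior)
    obtain x y where xy: "s = (x, y)" by fastforce
    have "\<exists>s'\<in>ball s d. f s' < u" using nd[OF s]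
    proof
      assume "D1 f s \<noteq> 0"
      then obtain h where "\<bar>h\<bar> < d" "f (x + h, y) < f (x, y)"
        using line[OF C1_DERIV(1)[OF C, of y x] _ d(1)] by (auto simp: xy)
      then show ?thesis using s by (intro bexI[of _ "(x + h, y)"]) (auto simp: xy dist_Pair_Pair dist_real_def)
    next
      assume "D2 f s \<noteq> 0"
      then obtain h where "\<bar>h\<bar> < d" "f (x, y + h) < f (x, y)"
        using line[OF C1_DERIV(2)[OF C, of x y] _ d(1)] by (auto simp: xy)
      then show ?thesis using s by (intro bexI[of _ "(x, y + h)"]) (auto simp: xy dist_Pair_Pair dist_real_def)
    qed
    then show False using d(2) by (force simp: excursion_def)
  qed
  show ?thesis
    using int notint closed unfolding frontier_def by (auto simp: excursion_def closure_closed not_less le_less)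
qed

lemma (in regular_level) perimeter_eq: "perimeter (square t) f u = hausdorff1 {s\<in>square t. f s = u}"
proof -
  have "square t \<inter> frontier (excursion f u) = {s\<in>square t. f s = u}"
  proof (rule frontier_excursion)
    fix s assume "s \<in> square t" "f s = u"
    then show "D1 f s \<noteq> 0 \<or> D2 f s \<noteq> 0" using nondegenerate[of s] c0 by auto
  qed (use C2_imp_C1[OF C2] in auto)
  then show ?thesis by (simp add: perimeter_def)
qed

text \<open>There are \<open>O(1 / \<delta>)\<close> blocks with an error of \<open>O(\<epsilon> + \<delta>\<^sup>3)\<close> each. Here \<open>\<epsilon> / \<delta> = 1 / m\<close> and
  \<open>\<delta>\<^sup>2 = (m\<^sup>3 \<epsilon>\<^sup>2) / m\<close>.\<close>
lemma (in regular_grid) estimator_error_rate: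
  assumes "\<delta> \<le> t"
  obtains P where "0 \<le> P" "perimeter (square t) f u = ennreal P"
    "\<bar>perimeter_estimator f \<epsilon> m t u - P\<bar>
      \<le> 6 * t * ((2 * t / \<rho> + 1) * (4 * L / c + 1)) * (2 * count_const + 4 + 2 * curv_const * (real m ^ 3 * \<epsilon> ^ 2)) / real m"
proof -
  obtain P where P: "P \<ge> 0" "hausdorff1 level = ennreal P"
    "\<bar>perimeter_estimator f \<epsilon> m t u - P\<bar> \<le> real (card met) * ((2 * count_const + 4) * \<epsilon> + 2 * curv_const * \<delta> ^ 3)"
    by (rule estimator_error)
  let ?N = "(2 * t / \<rho> + 1) * (4 * L / c + 1)"
  have N0: "0 \<le> ?N" using t0 \<rho>0 L0 c0 by (intro mult_nonneg_nonneg) auto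
  have nn: "0 \<le> count_const" "0 \<le> curv_const" using L0 c0 by (auto simp: count_const_def curv_const_def)
  have "2 * t / \<delta> + 1 \<le> 3 * t / \<delta>" using assms d0 by (simp add: field_simps)
  then have "real (card met) \<le> 2 * (3 * t / \<delta> * ?N)"
    using card_met N0 by (meson mult_left_mono mult_right_mono order_trans zero_le_numeral)
  then have "real (card met) * ((2 * count_const + 4) * \<epsilon> + 2 * curv_const * \<delta> ^ 3) \<le> 2 * (3 * t / \<delta> * ?N) * ((2 * count_const + 4) * \<epsilon> + 2 * curv_const * \<delta> ^ 3)"
    using nn e0 d0 by (intro mult_right_mono) auto
  also have "\<dots> = 6 * t * ?N * (((2 * count_const + 4) * \<epsilon> + 2 * curv_const * \<delta> ^ 3) / \<delta>)" by (simp add: mult.assoc)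
  also have "((2 * count_const + 4) * \<epsilon> + 2 * curv_const * \<delta> ^ 3) / \<delta> = (2 * count_const + 4 + 2 * curv_const * (real m ^ 3 * \<epsilon> ^ 2)) / real m"
    using e0 m0 unfolding \<delta>_def by (simp add: field_simps power2_eq_square power3_eq_cube)
  finally show thesis using P perimeter_eq that[of P] by (simp add: level_def)
qed

lemma estimator_converges:
  fixes m :: "nat \<Rightarrow> nat" and \<epsilon> g :: "nat \<Rightarrow> real"
  assumes t0: "t > 0" and C2: "C2 f" and reg: "regular_at_level (square t) f u"
    and m1: "\<And>n. n \<ge> 1 \<Longrightarrow> m n \<ge> 1" and m: "filterlim m at_top sequentially"
    and e: "\<And>n. n \<ge> 1 \<Longrightarrow> \<epsilon> n > 0"
    and lim: "(\<lambda>n. real (m n) * \<epsilon> n powr (2/3)) \<longlonglongrightarrow> C"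
    and corners: "\<And>n. n \<ge> 1 \<Longrightarrow> {-t, t} \<times> {-t, t} \<subseteq> grid t (\<epsilon> n)"
    and g: "g \<in> o(\<lambda>n. real (m n))"
  shows "(\<lambda>n. ereal (g n) * \<bar>ereal (perimeter_estimator f (\<epsilon> n) (m n) t u)
         - enn2ereal (perimeter (square t) f u)\<bar>) \<longlonglongrightarrow> 0"
proof -
  obtain c \<rho> L K where "regular_level f t u c \<rho> L K" by (rule regular_level_exists[OF t0 C2 reg])
  then interpret regular_level f t u c \<rho> L K .
  define P where "P = enn2real (perimeter (square t) f u)"
  define A where "A = 6 * t * ((2 * t / \<rho> + 1) * (4 * L / c + 1))"
  define R where "R = (\<lambda>n. real (m n) ^ 3 * \<epsilon> n ^ 2)"
  have "(\<lambda>n. (real (m n) * \<epsilon> n powr (2/3)) ^ 3) \<longlonglongrightarrow> C ^ 3" by (intro tendsto_power lim)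
  moreover have "\<forall>\<^sub>F n in sequentially. (real (m n) * \<epsilon> n powr (2/3)) ^ 3 = R n"
    using eventually_ge_at_top[of 1]
  proof eventually_elim
    case (elim n)
    have "(\<epsilon> n powr (2/3)) ^ 3 = \<epsilon> n powr (real 3 * (2/3))" using e[OF elim] by (subst powr_power) auto
    also have "\<dots> = \<epsilon> n ^ 2" using e[OF elim] by simp
    finally show ?case by (simp add: R_def power_mult_distrib)
  qed
  ultimately have R: "R \<longlonglongrightarrow> C ^ 3" using tendsto_cong by fast
  have minf: "filterlim (\<lambda>n. real (m n)) at_top sequentially"
    by (rule filterlim_compose[OF filterlim_real_sequentially m])
  have "(\<lambda>n. sqrt (R n / real (m n))) \<longlonglongrightarrow> sqrt 0"
    by (intro tendsto_real_sqrt tendsto_divide_0[OF R] filterlim_at_top_imp_at_infinity minf)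
  moreover have "\<forall>\<^sub>F n in sequentially. sqrt (R n / real (m n)) = real (m n) * \<epsilon> n"
    using eventually_ge_at_top[of 1]
  proof eventually_elim
    case (elim n)
    have "R n / real (m n) = (real (m n) * \<epsilon> n) ^ 2"
      using m1[OF elim] by (simp add: R_def power2_eq_square power3_eq_cube)
    then show ?case using e[OF elim] by simp
  qed
  ultimately have "(\<lambda>n. real (m n) * \<epsilon> n) \<longlonglongrightarrow> 0" using tendsto_cong by fastforce
  then have small: "\<forall>\<^sub>F n in sequentially. real (m n) * \<epsilon> n < min t (\<rho> / 2)"
    using t0 \<rho>0 by (intro order_tendstoD(2)) auto
  have rate: "\<forall>\<^sub>F n in sequentially. perimeter (square t) f u = ennreal P \<and>
     \<bar>perimeter_estimator f (\<epsilon> n) (m n) t u - P\<bar> \<le> A * (2 * count_const + 4 + 2 * curv_const * R n) / real (m n)"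
    using small eventually_ge_at_top[of 1]
  proof eventually_elim
    case (elim n)
    obtain Q where Q: "real Q * \<epsilon> n = 2 * t" "grid_size t (\<epsilon> n) = Suc Q"
      by (rule grid_size_eq[OF t0 e[OF elim(2)] corners[OF elim(2)]])
    interpret regular_grid f t u c \<rho> L K "\<epsilon> n" "m n" Q
      using elim e[OF elim(2)] m1[OF elim(2)] Q by unfold_locales auto
    have "\<delta> \<le> t" using elim(1) by (simp add: \<delta>_def)
    then obtain P' where P': "0 \<le> P'" "perimeter (square t) f u = ennreal P'"
       "\<bar>perimeter_estimator f (\<epsilon> n) (m n) t u - P'\<bar> \<le> A * (2 * count_const + 4 + 2 * curv_const * R n) / real (m n)"
      unfolding A_def R_def by (rule estimator_error_rate)
    then show ?case by (simp add: P_def)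
  qed
  have "(\<lambda>n. g n / real (m n)) \<longlonglongrightarrow> 0" by (rule smalloD_tendsto[OF g])
  then have "(\<lambda>n. \<bar>g n / real (m n)\<bar> * (A * (2 * count_const + 4 + 2 * curv_const * R n))) \<longlonglongrightarrow> 0 * (A * (2 * count_const + 4 + 2 * curv_const * C ^ 3))"
    by (intro tendsto_intros R tendsto_rabs_zero)
  then have bnd: "(\<lambda>n. \<bar>g n / real (m n)\<bar> * (A * (2 * count_const + 4 + 2 * curv_const * R n))) \<longlonglongrightarrow> 0" by simp
  have lim0: "(\<lambda>n. g n * \<bar>perimeter_estimator f (\<epsilon> n) (m n) t u - P\<bar>) \<longlonglongrightarrow> 0"
  proof (rule Lim_null_comparison[OF _ bnd])
    show "\<forall>\<^sub>F n in sequentially. norm (g n * \<bar>perimeter_estimator f (\<epsilon> n) (m n) t u - P\<bar>)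
        \<le> \<bar>g n / real (m n)\<bar> * (A * (2 * count_const + 4 + 2 * curv_const * R n))"
      using rate
    proof eventually_elim
      case (elim n)
      then have "\<bar>g n\<bar> * \<bar>perimeter_estimator f (\<epsilon> n) (m n) t u - P\<bar> \<le> \<bar>g n\<bar> * (A * (2 * count_const + 4 + 2 * curv_const * R n) / real (m n))"
        by (intro mult_left_mono) auto
      then show ?case by (simp add: abs_mult)
    qed
  qed
  obtain n0 where "perimeter (square t) f u = ennreal P"
    using eventually_happens'[OF _ rate] by (auto simp: sequentially_bot)
  then have "enn2ereal (perimeter (square t) f u) = enn2ereal (ennreal P)" by (rule arg_cong)
  also have "\<dots> = ereal P" by (rule enn2ereal_ennreal) (simp add: P_def)
  finally have "enn2ereal (perimeter (square t) f u) = ereal P" .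
  then show ?thesis using tendsto_ereal[OF lim0] by (simp add: zero_ereal_def)
qed

theorem theorem1:
  fixes M :: "'w measure" and X :: "real \<times> real \<Rightarrow> 'w \<Rightarrow> real"
    and t C u :: real and m :: "nat \<Rightarrow> nat" and \<epsilon> g :: "nat \<Rightarrow> real"
  assumes "t > 0"
    and "C2_random_field M X"
    and "as_regular_field M (square t) X"
    and "\<And>n. n \<ge> 1 \<Longrightarrow> m n \<ge> 1"
    and "mono_on {1..} m"
    and "filterlim m at_top sequentially"
    and "\<And>n. n \<ge> 1 \<Longrightarrow> \<epsilon> n > 0"
    and "C > 0"
    and "(\<lambda>n. real (m n) * \<epsilon> n powr (2/3)) \<longlonglongrightarrow> C"
    and "\<And>n. n \<ge> 1 \<Longrightarrow> {-t, t} \<times> {-t, t} \<subseteq> grid t (\<epsilon> n)"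
    and "mono_on {1..} g"
    and "g \<in> o(\<lambda>n. real (m n))"
  shows "AE \<omega> in M.
    (\<lambda>n. ereal (g n) *
       \<bar>ereal (perimeter_estimator (\<lambda>s. X s \<omega>) (\<epsilon> n) (m n) t u)
         - enn2ereal (perimeter (square t) (\<lambda>s. X s \<omega>) u)\<bar>) \<longlonglongrightarrow> 0"
proof -
  have "AE \<omega> in M. regular_at_level (square t) (\<lambda>s. X s \<omega>) u"
    using assms(3) by (simp add: as_regular_field_def)
  then show ?thesis
    using AE_space
  proof eventually_elim
    case (elim \<omega>)
    have "C2 (\<lambda>s. X s \<omega>)" using assms(2) elim(2) by (simp add: C2_random_field_def)
    then show ?case
      by (rule estimator_converges[OF assms(1) _ elim(1) assms(4,6,7,9,10,12)])
  qed
qed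

end
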